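(* Let $H:[0,T]\times\mathbb{R}^n\times\mathbb{R}^n\to\mathbb{R}$ satisfy (H1)–(H4) and (HLC), where $H$ (jointly in $(t,x,p)$), $c(\cdot)$ and each $k_R(\cdot)$ are continuous. Let $(\mathbb{R}^{n+1},f,l)$ be the Steiner representation of $H$ and $g:\mathbb{R}^n\to\mathbb{R}$ locally Lipschitz. Then the value function $$V(t_0,x_0)=\inf_{(x,a)(\cdot)\in S_f(t_0,x_0)}\Big\{g(x(T))+\int_{t_0}^T l(t,x(t),a(t))\,dt\Big\}$$ is locally Lipschitz continuous on $[0,T]\times\mathbb{R}^n$.
   Context: Hypotheses: (H1) $H(\cdot,x,p)$ Lebesgue measurable; (H2) $H(t,\cdot,\cdot)$ continuous; (H3) $H(t,x,\cdot)$ convex; (H4) there is measurable $c\ge0$ with $|H(t,x,p)-H(t,x,q)|\le c(t)(1+|x|)|p-q|$; (HLC) for each $R>0$ there is measurable $k_R\ge0$ with $|H(t,x,p)-H(t,y,p)|\le k_R(t)(1+|p|)|x-y|$ for $x,y\in\bar B_R$, all $p$. $H^*(t,x,v)=\sup_p\{\langle v,p\rangle-H(t,x,p)\}$. $S_f(t_0,x_0)$: pairs $x(\cdot)$ absolutely continuous on $[t_0,T]$, $a(\cdot)\in L^1([t_0,T],\mathbb{R}^{n+1})$, with $\dot x=f(t,x,a)$ a.e. and $x(t_0)=x_0$. Steiner representation: $E(t,x)=\mathrm{epi}\,H^*(t,x,\cdot)\subset\mathbb{R}^{n+1}$; $\Phi(t,x,a)=E(t,x)\cap\bar B(a,2d(a,E(t,x)))$;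 Steiner point $s_m(K)=m\int_{S^{m-1}}p\max_{y\in K}\langle p,y\rangle\,\mu(dp)$ ($\mu$ normalized rotation-invariant measure on the unit sphere); $(f,l)(t,x,a)=s_{n+1}(\Phi(t,x,a))$ with $f\in\mathbb{R}^n$, $l\in\mathbb{R}$. *)

theory Defs
  imports "HOL-Analysis.Analysis"
begin

definition abs_continuous_on :: "real \<Rightarrow> real \<Rightarrow> (real \<Rightarrow> 'a::real_normed_vector) \<Rightarrow> bool" where
  "abs_continuous_on a b x \<longleftrightarrow>
     (\<forall>\<epsilon>>0. \<exists>\<delta>>0. \<forall>(N::nat) u v.
        (\<forall>i<N. a \<le> u i \<and> u i \<le> v i \<and> v i \<le> b) \<and>
        (\<forall>i<N. \<forall>j<N. i \<noteq> j \<longrightarrow> v i \<le> u j \<or> v j \<le> u i) \<and>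
        (\<Sum>i<N. v i - u i) < \<delta>
        \<longrightarrow> (\<Sum>i<N. norm (x (v i) - x (u i))) < \<epsilon>)"

definition loc_lipschitz_on :: "'a::metric_space set \<Rightarrow> ('a \<Rightarrow> 'b::metric_space) \<Rightarrow> bool" where
  "loc_lipschitz_on S F \<longleftrightarrow>
     (\<forall>z\<in>S. \<exists>r>0. \<exists>L. \<forall>u\<in>S \<inter> ball z r. \<forall>w\<in>S \<inter> ball z r. dist (F u) (F w) \<le> L * dist u w)"

definition Hstar :: "(real \<Rightarrow> 'a::real_inner \<Rightarrow> 'a \<Rightarrow> real) \<Rightarrow> real \<Rightarrow> 'a \<Rightarrow> 'a \<Rightarrow> ereal" where
  "Hstar H t x v = (SUP p. ereal (inner v p - H t x p))"

definition epiHstar :: "(real \<Rightarrow> 'a::real_inner \<Rightarrow> 'a \<Rightarrow> real) \<Rightarrow> real \<Rightarrow> 'a \<Rightarrow> ('a \<times> real) set" where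
  "epiHstar H t x = {(v, r). Hstar H t x v \<le> ereal r}"

definition supp_fun :: "'b::real_inner set \<Rightarrow> 'b \<Rightarrow> real" where
  "supp_fun K q = Sup ((\<lambda>y. inner q y) ` K)"

text \<open>Normalized rotation-invariant measure on the unit sphere, realised as the image of the
  normalized Lebesgue measure on the unit ball under radial projection p \<mapsto> p/|p|.
  Integral of a function phi against it: \<close>
definition sphere_avg :: "('b::euclidean_space \<Rightarrow> 'c::euclidean_space) \<Rightarrow> 'c" where
  "sphere_avg \<phi> = (1 / measure lborel (ball (0::'b) 1)) *\<^sub>R
      (LINT p:ball 0 1|lborel. \<phi> (p /\<^sub>R norm p))"

definition steiner_point :: "'b::euclidean_space set \<Rightarrow> 'b" where
  "steiner_point K = real DIM('b) *\<^sub>R sphere_avg (\<lambda>p. supp_fun K p *\<^sub>R p)"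

definition Phi_set :: "(real \<Rightarrow> 'a::real_inner \<Rightarrow> 'a \<Rightarrow> real) \<Rightarrow> real \<Rightarrow> 'a \<Rightarrow> 'a \<times> real \<Rightarrow> ('a \<times> real) set" where
  "Phi_set H t x a = epiHstar H t x \<inter> cball a (2 * infdist a (epiHstar H t x))"

definition steiner_f :: "(real \<Rightarrow> 'a::euclidean_space \<Rightarrow> 'a \<Rightarrow> real) \<Rightarrow> real \<Rightarrow> 'a \<Rightarrow> 'a \<times> real \<Rightarrow> 'a" where
  "steiner_f H t x a = fst (steiner_point (Phi_set H t x a))"

definition steiner_l :: "(real \<Rightarrow> 'a::euclidean_space \<Rightarrow> 'a \<Rightarrow> real) \<Rightarrow> real \<Rightarrow> 'a \<Rightarrow> 'a \<times> real \<Rightarrow> real" where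
  "steiner_l H t x a = snd (steiner_point (Phi_set H t x a))"

definition traj_pairs :: "(real \<Rightarrow> 'a::euclidean_space \<Rightarrow> 'a \<times> real \<Rightarrow> 'a) \<Rightarrow> real \<Rightarrow> real \<Rightarrow> 'a
      \<Rightarrow> ((real \<Rightarrow> 'a) \<times> (real \<Rightarrow> 'a \<times> real)) set" where
  "traj_pairs f T t0 x0 = {(x, a).
      abs_continuous_on t0 T x \<and>
      set_integrable lborel {t0..T} a \<and>
      (AE t in lborel. t \<in> {t0..T} \<longrightarrow> (x has_vector_derivative f t (x t) (a t)) (at t within {t0..T})) \<and>
      x t0 = x0}"

definition value_fun :: "(real \<Rightarrow> 'a::euclidean_space \<Rightarrow> 'a \<times> real \<Rightarrow> 'a) \<Rightarrow> (real \<Rightarrow> 'a \<Rightarrow> 'a \<times> real \<Rightarrow> real)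
      \<Rightarrow> ('a \<Rightarrow> real) \<Rightarrow> real \<Rightarrow> real \<Rightarrow> 'a \<Rightarrow> ereal" where
  "value_fun f l g T t0 x0 =
     (INF xa\<in>traj_pairs f T t0 x0.
        ereal (g (fst xa T) + (LINT t:{t0..T}|lborel. l t (fst xa t) (snd xa t))))"

end

theory Submission
  imports Defs
begin

text \<open>
  The Steiner representation \<open>e = (f, l)\<close> takes values in the epigraph \<open>E(t,x)\<close> of \<open>H\<^sup>*(t,x,\<cdot>)\<close>, so
  \<open>|f| \<le> c(t)(1 + |x|)\<close> and \<open>l \<ge> -H(t,x,0)\<close>; it is jointly continuous, and on bounded sets Lipschitz
  in \<open>(x,a)\<close> uniformly in \<open>t\<close> and \<open>a\<close>. Given an admissible pair \<open>(x,a)\<close> from \<open>(t0,x0)\<close>, extend \<open>a\<close> by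
  \<open>0\<close> to \<open>[0,T]\<close>, approximate it in \<open>L\<^sup>1\<close> by a continuous control \<open>b\<close>, and solve the state equation from
  \<open>(t1,y0)\<close> with \<open>b\<close>; continuity of \<open>b\<close> makes this a classical initial value problem. Gronwall's
  inequality bounds the excess cost of the new pair by a constant times
  \<open>|x0 - y0| + |t0 - t1|\<close> plus an arbitrarily small error, and one takes the infimum over \<open>(x,a)\<close>.
\<close>

text \<open>The obstacle is that controls are unbounded: a nearly optimal \<open>a\<close> may have
  an arbitrarily large \<open>L^1\<close> norm, so no constant may depend on it. The radius in
  \<open>Phi_set\<close> is what makes this possible. It is twice the distance to the epigraph, so
  the nearest point lies well inside the ball and other points can be slid towards it; the resulting
  Lipschitz constant of \<open>e\<close> does not see the size of \<open>a\<close>, and an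
  \<open>L^1\<close> error in the control enters the cost linearly.

  The running cost is bounded below on bounded sets of states but not above, and this asymmetry
  decides how different starting times are handled. A new pair that starts later drops a piece of
  the old cost, for which only the lower bound matters. A new pair that starts earlier needs a
  control on the additional piece, and there the extension by \<open>0\<close> gives a cost of order
  \<open>|t0 - t1|\<close>. The comparison is one-sided, and exchanging the two starting points
  gives the other side.

  That the Steiner point lies in its set is derived from its defining integral by comparison with
  the support function in every direction.\<close>

section \<open>Epigraphs of conjugates\<close>

lemma convex_minorant_cone:
  fixes \<phi> :: "'a::euclidean_space \<Rightarrow> real"
  assumes conv: "convex_on UNIV \<phi>" and "0 \<le> d" and low: "\<And>p. - d * norm p \<le> \<phi> p"
  obtains u where "norm u \<le> d" and "\<And>p. inner u p \<le> \<phi> p"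
proof -
  define S where "S = {(p::'a, r::real). r < - d * norm p}"
  define W where "W = {(p::'a, r::real). \<phi> p \<le> r}"
  have "convex W"
    using conv convex_epigraph[of UNIV \<phi>] by (simp add: W_def epigraph_def case_prod_unfold)
  moreover have "convex S"
  proof (rule convexI)
    fix x y :: "'a \<times> real" and s t :: real
    assume x: "x \<in> S" and y: "y \<in> S" and st: "0 \<le> s" "0 \<le> t" "s + t = 1"
    obtain p r where xe: "x = (p, r)" by fastforce
    obtain q m where ye: "y = (q, m)" by fastforce
    have r: "r < - d * norm p" "m < - d * norm q" using x y by (auto simp: S_def xe ye)
    have "norm (s *\<^sub>R p + t *\<^sub>R q) \<le> s * norm p + t * norm q"
      using norm_triangle_ineq[of "s *\<^sub>R p" "t *\<^sub>R q"] st by simp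
    then have "d * norm (s *\<^sub>R p + t *\<^sub>R q) \<le> d * (s * norm p + t * norm q)"
      using \<open>0 \<le> d\<close> by (rule mult_left_mono)
    moreover have "s * r + t * m < s * (- d * norm p) + t * (- d * norm q)"
    proof (cases "s = 0")
      case False
      then have "s * r < s * (- d * norm p)" using r(1) st by (intro mult_strict_left_mono) auto
      moreover have "t * m \<le> t * (- d * norm q)" using r st by (intro mult_left_mono) auto
      ultimately show ?thesis by linarith
    qed (use r st in auto)
    ultimately have "s * r + t * m < - d * norm (s *\<^sub>R p + t *\<^sub>R q)"
      by (simp add: algebra_simps)
    then show "s *\<^sub>R x + t *\<^sub>R y \<in> S" by (simp add: S_def xe ye)
  qed
  moreover have "(0, -1) \<in> S" "(0, \<phi> 0) \<in> W" by (auto simp: S_def W_def)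
  moreover have "x \<notin> W" if "x \<in> S" for x
    using that low[of "fst x"] by (auto simp: S_def W_def)
  then have "S \<inter> W = {}" by blast
  ultimately obtain a b where ab: "a \<noteq> 0" "\<And>x. x \<in> S \<Longrightarrow> inner a x \<le> b" "\<And>x. x \<in> W \<Longrightarrow> b \<le> inner a x"
    using separating_hyperplane_sets[of S W] by (metis empty_iff)
  obtain q \<tau> where a: "a = (q, \<tau>)" by fastforce
  have S: "inner q p + \<tau> * r \<le> b" if "r < - d * norm p" for p r
    using ab(2)[of "(p, r)"] that by (simp add: S_def a)
  have W: "b \<le> inner q p + \<tau> * \<phi> p" for p
    using ab(3)[of "(p, \<phi> p)"] by (simp add: W_def a)
  have "\<not> \<tau> < 0"
  proof
    assume "\<tau> < 0"
    \<comment> \<open>Below the cone at \<open>p = 0\<close> every negative \<open>r\<close> is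
      allowed; this one makes \<open>\<tau> * r\<close> equal to
      \<open>\<bar>b\<bar> + 1\<close>.\<close>
    have "inner q 0 + \<tau> * ((\<bar>b\<bar> + 1) / \<tau>) \<le> b"
      using \<open>\<tau> < 0\<close> by (intro S) (auto simp: divide_neg_neg divide_less_0_iff)
    then show False using \<open>\<tau> < 0\<close> by simp
  qed
  \<comment> \<open>Both sets project onto the whole space, so a vertical hyperplane would make
    \<open>inner q\<close> constant, hence \<open>q = 0\<close>, against
    \<open>a \<noteq> 0\<close>.\<close>
  moreover have "\<tau> \<noteq> 0"
  proof
    assume "\<tau> = 0"
    then have "inner q p = b" for p using S[of "- d * norm p - 1" p] W[of p] by simp
    then have "inner q q = inner q 0" by metis
    with ab(1) show False by (simp add: a \<open>\<tau> = 0\<close> zero_prod_def)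
  qed
  ultimately have \<tau>: "\<tau> > 0" by simp
  define u where "u = (- 1 / \<tau>) *\<^sub>R q"
  define \<beta> where "\<beta> = b / \<tau>"
  have lo: "- d * norm p \<le> \<beta> + inner u p" for p
  proof (rule dense_le)
    fix r assume "r < - d * norm p"
    from S[OF this] show "r \<le> \<beta> + inner u p" using \<tau> by (simp add: u_def \<beta>_def field_simps)
  qed
  have up: "\<beta> + inner u p \<le> \<phi> p" for p
    using W[of p] \<tau> by (simp add: u_def \<beta>_def field_simps)
  have \<beta>: "0 \<le> \<beta>" using lo[of 0] by simp
  show ?thesis
  proof
    show "inner u p \<le> \<phi> p" for p using up[of p] \<beta> by linarith
    show "norm u \<le> d"
    proof (rule ccontr)
      assume n: "\<not> norm u \<le> d"
      then have pos: "norm u * (norm u - d) > 0" using \<open>0 \<le> d\<close> by (intro mult_pos_pos) linarith+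
      \<comment> \<open>Chosen so that the bound \<open>lo\<close> at \<open>- s *\<^sub>R u\<close>
        would read \<open>\<beta> + 1 \<le> \<beta>\<close>.\<close>
      define s where "s = (\<beta> + 1) / (norm u * (norm u - d))"
      have s: "s * (norm u * (norm u - d)) = \<beta> + 1" and "s \<ge> 0"
        using pos \<beta> by (auto simp: s_def)
      have "- d * (s * norm u) \<le> \<beta> - s * (norm u * norm u)"
        using lo[of "- s *\<^sub>R u"] \<open>s \<ge> 0\<close> by (simp add: power2_norm_eq_inner[symmetric] power2_eq_square)
      with s show False by (simp add: algebra_simps)
    qed
  qed
qed

text \<open>The extended-real supremum is dissolved into affine inequalities indexed by
  \<open>p\<close>; the arguments about the epigraph use only these.\<close>

lemma mem_epiHstar: "(v, r) \<in> epiHstar H t x \<longleftrightarrow> (\<forall>p. inner v p - r \<le> H t x p)"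
  by (auto simp: epiHstar_def Hstar_def SUP_le_iff algebra_simps)

lemma epiHstar_eq: "epiHstar H t x = (\<Inter>p. {z. inner (p, - 1) z \<le> H t x p})"
  by (auto simp: mem_epiHstar inner_commute)

lemma closed_epiHstar: "closed (epiHstar H t x)"
  unfolding epiHstar_eq by (intro closed_INT ballI closed_halfspace_le)

lemma convex_epiHstar: "convex (epiHstar H t x)"
  unfolding epiHstar_eq by (intro convex_INT convex_halfspace_le)

text \<open>This turns closeness of Hamiltonians into closeness of epigraphs. If the affine function
  of \<open>(v, r)\<close> lies below \<open>H\<close> up to a constant \<open>\<eta>\<close> and a
  cone of slope \<open>d\<close>, then raising the point by \<open>\<eta>\<close> absorbs the
  constant, and tilting it by the vector from \<open>convex_minorant_cone\<close> absorbs the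
  cone.\<close>

lemma epiHstar_perturb:
  fixes H :: "real \<Rightarrow> 'a::euclidean_space \<Rightarrow> 'a \<Rightarrow> real"
  assumes "convex_on UNIV (H t x)" "0 \<le> d"
    and "\<And>p. inner v p - r - \<eta> - d * norm p \<le> H t x p"
  obtains w where "norm (w - v) \<le> d" "(w, r + \<eta>) \<in> epiHstar H t x"
proof -
  have "convex_on UNIV (\<lambda>p. H t x p + (r + \<eta> + inner (- v) p))"
  proof (rule convex_on_add[OF assms(1)])
    show "convex_on UNIV (\<lambda>p. r + \<eta> + inner (- v) p)"
      by (rule convex_onI) (auto simp: algebra_simps inner_simps)
  qed
  moreover have "- d * norm p \<le> H t x p + (r + \<eta> + inner (- v) p)" for p
    using assms(3)[of p] by simp
  ultimately obtain u where u: "norm u \<le> d" "\<And>p. inner u p \<le> H t x p + (r + \<eta> + inner (- v) p)"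
    using convex_minorant_cone[OF _ assms(2)] by blast
  show ?thesis
  proof
    show "norm ((v + u) - v) \<le> d" using u by simp
    show "(v + u, r + \<eta>) \<in> epiHstar H t x"
      unfolding mem_epiHstar using u(2) by (auto simp: inner_simps algebra_simps)
  qed
qed

text \<open>The case \<open>v = 0\<close>, \<open>\<eta> = 0\<close> of the perturbation lemma: the
  resulting \<open>v\<close> is a subgradient of \<open>H t x\<close> at 0. It shows that the
  epigraph is nonempty and reaches into a ball of explicit size.\<close>

lemma epiHstar_subgradient:
  fixes H :: "real \<Rightarrow> 'a::euclidean_space \<Rightarrow> 'a \<Rightarrow> real"
  assumes "convex_on UNIV (H t x)" "0 \<le> C" "\<And>p q. \<bar>H t x p - H t x q\<bar> \<le> C * norm (p - q)"
  obtains v where "norm v \<le> C" "(v, - H t x 0) \<in> epiHstar H t x"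
proof -
  have "inner 0 p - (- H t x 0) - 0 - C * norm p \<le> H t x p" for p
    using assms(3)[of p 0] by simp
  then obtain w where "norm (w - 0) \<le> C" "(w, - H t x 0 + 0) \<in> epiHstar H t x"
    by (rule epiHstar_perturb[of H t x C 0 "- H t x 0" 0, OF assms(1,2)])
  with that show ?thesis by simp
qed

text \<open>A Lipschitz function has a conjugate with bounded domain: along
  \<open>s *\<^sub>R v\<close> the linear function grows like \<open>s * norm v ^ 2\<close>, but
  \<open>H\<close> grows at most like \<open>s * C * norm v\<close>.\<close>

lemma epiHstar_norm_le:
  fixes H :: "real \<Rightarrow> 'a::euclidean_space \<Rightarrow> 'a \<Rightarrow> real"
  assumes "(v, r) \<in> epiHstar H t x" "\<And>p q. \<bar>H t x p - H t x q\<bar> \<le> C * norm (p - q)"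
  shows "norm v \<le> C"
proof (rule ccontr)
  assume n: "\<not> norm v \<le> C"
  have C: "0 \<le> C"
  proof (cases "v = 0")
    case False
    have "0 \<le> C * norm v" using assms(2)[of v 0] by simp
    then show ?thesis using False by (simp add: zero_le_mult_iff)
  qed (use n in \<open>use assms(2)[of "SOME i. i \<in> Basis" 0] in \<open>auto simp: SOME_Basis\<close>\<close>)
  with n have pos: "norm v * (norm v - C) > 0" by (intro mult_pos_pos) linarith+
  define \<beta> where "\<beta> = \<bar>r + H t x 0\<bar>"
  define s where "s = (\<beta> + 1) / (norm v * (norm v - C))"
  have s: "s * (norm v * (norm v - C)) = \<beta> + 1" and "s \<ge> 0"
    using pos by (auto simp: s_def \<beta>_def)
  have "inner v (s *\<^sub>R v) - r \<le> H t x (s *\<^sub>R v)" using assms(1) mem_epiHstar by metis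
  also have "\<dots> \<le> H t x 0 + C * (s * norm v)" using assms(2)[of "s *\<^sub>R v" 0] \<open>s \<ge> 0\<close> by simp
  finally have "s * (norm v * norm v) - C * (s * norm v) \<le> r + H t x 0"
    by (simp add: power2_norm_eq_inner[symmetric] power2_eq_square)
  with s show False by (simp add: algebra_simps \<beta>_def)
qed

lemma epiHstar_ge: "(v, r) \<in> epiHstar H t x \<Longrightarrow> - H t x 0 \<le> r"
  using mem_epiHstar[of v r H t x] by (auto dest: spec[of _ 0])

lemma dist_epi_le:
  fixes v w :: "'a::euclidean_space"
  shows "norm (w - v) \<le> d \<Longrightarrow> dist (v, r) (w, r + \<eta>) \<le> d + \<bar>\<eta>\<bar>"
  using norm_Pair_le[of "v - w" "- \<eta>"] by (simp add: dist_norm norm_minus_commute)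

text \<open>A point \<open>y'\<close> of \<open>F\<close> close to \<open>y\<close> may miss the
  ball of radius \<open>2 * d'\<close> about \<open>b\<close>, by at most
  \<open>3 * \<theta>\<close>. The nearest point \<open>\<pi>\<close> has distance only
  \<open>d'\<close> from \<open>b\<close>, so moving \<open>y'\<close> towards \<open>\<pi>\<close>
  regains the overshoot. The displacement is at most \<open>9 * \<theta>\<close> whatever
  \<open>d'\<close> is. Closeness is assumed only on the traces in the balls, because far out the
  epigraphs need not be uniformly close.\<close>

lemma near_ball_trace:
  fixes E F :: "'b::euclidean_space set"
  assumes E: "closed E" "E \<noteq> {}" and F: "closed F" "convex F" "F \<noteq> {}"
    and EF: "\<And>y. y \<in> E \<inter> cball a (2 * infdist a E) \<Longrightarrow> \<exists>z\<in>F. dist y z \<le> \<epsilon>"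
    and FE: "\<And>y. y \<in> F \<inter> cball b (2 * infdist b F) \<Longrightarrow> \<exists>z\<in>E. dist y z \<le> \<epsilon>"
    and \<theta>: "\<epsilon> + dist a b \<le> \<theta>" "0 < \<theta>"
    and y: "y \<in> E \<inter> cball a (2 * infdist a E)"
  shows "\<exists>z\<in>F \<inter> cball b (2 * infdist b F). dist y z \<le> 10 * \<theta>"
proof -
  define d where "d = infdist a E"
  define d' where "d' = infdist b F"
  obtain \<pi> where \<pi>: "\<pi> \<in> F" "d' = dist b \<pi>"
    using infdist_attains_inf[OF F(1,3)] by (auto simp: d'_def)
  have d': "0 \<le> d'" by (simp add: \<pi>)
  have "\<pi> \<in> F \<inter> cball b (2 * infdist b F)" using \<pi> d' by (auto simp: d'_def[symmetric])
  then obtain \<rho> where \<rho>: "\<rho> \<in> E" "dist \<pi> \<rho> \<le> \<epsilon>" using FE by blast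
  have "d \<le> dist a \<rho>" using \<rho> by (simp add: d_def infdist_le)
  also have "\<dots> \<le> dist a b + dist b \<pi> + dist \<pi> \<rho>" by metric
  finally have dd': "d \<le> d' + \<theta>" using \<rho> \<theta> \<pi> by simp
  obtain y' where y': "y' \<in> F" "dist y y' \<le> \<epsilon>" using EF y by blast
  have "dist a y \<le> 2 * d" using y by (simp add: d_def)
  moreover have "dist b y' \<le> dist a b + dist a y + dist y y'" by metric
  ultimately have by': "dist b y' \<le> 2 * d' + 3 * \<theta>" using dd' y' \<theta> by linarith
  \<comment> \<open>The fraction for which the gain \<open>l * (d' + 3 * \<theta>)\<close> equals
    the overshoot \<open>3 * \<theta>\<close>. Positivity of \<open>\<theta>\<close> covers
    \<open>d' = 0\<close>.\<close>
  define l where "l = 3 * \<theta> / (d' + 3 * \<theta>)"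
  have l: "0 \<le> l" "l \<le> 1" "l * (d' + 3 * \<theta>) = 3 * \<theta>" using d' \<theta>(2) by (auto simp: l_def field_simps)
  define z where "z = (1 - l) *\<^sub>R y' + l *\<^sub>R \<pi>"
  have "z \<in> F" unfolding z_def using F(2) y'(1) \<pi>(1) l by (intro convexD) auto
  moreover have "dist b z \<le> 2 * d'"
  proof -
    have "b - z = (1 - l) *\<^sub>R (b - y') + l *\<^sub>R (b - \<pi>)" by (simp add: z_def algebra_simps)
    then have "dist b z \<le> (1 - l) * dist b y' + l * dist b \<pi>"
      using norm_triangle_ineq[of "(1 - l) *\<^sub>R (b - y')" "l *\<^sub>R (b - \<pi>)"] l by (simp add: dist_norm)
    also have "\<dots> \<le> (1 - l) * (2 * d' + 3 * \<theta>) + l * d'"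
      using by' l \<pi> by (intro add_mono mult_left_mono) auto
    also have "\<dots> = 2 * d' + 3 * \<theta> - l * (d' + 3 * \<theta>)" by (simp add: algebra_simps)
    finally show ?thesis using l(3) by simp
  qed
  moreover have "dist y z \<le> 10 * \<theta>"
  proof -
    have "y' - z = l *\<^sub>R (y' - \<pi>)" by (simp add: z_def algebra_simps)
    then have "dist y' z = l * dist y' \<pi>" using l by (simp add: dist_norm)
    also have "\<dots> \<le> l * (3 * (d' + 3 * \<theta>))"
    proof (rule mult_left_mono)
      have "dist y' \<pi> \<le> dist b y' + dist b \<pi>" by metric
      then show "dist y' \<pi> \<le> 3 * (d' + 3 * \<theta>)" using by' \<pi> \<theta> by simp
    qed (use l in auto)
    also have "\<dots> = 3 * (l * (d' + 3 * \<theta>))" by simp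
    finally have "dist y' z \<le> 9 * \<theta>" using l(3) by simp
    moreover have "dist y z \<le> dist y y' + dist y' z" by metric
    ultimately show ?thesis using y' \<theta> zero_le_dist[of a b] by linarith
  qed
  ultimately show ?thesis by (auto simp: d'_def)
qed

section \<open>Steiner points\<close>

lemma supp_fun_upper:
  assumes "bounded K" "y \<in> K"
  shows "inner q y \<le> supp_fun K q"
  unfolding supp_fun_def
proof (rule cSUP_upper[OF assms(2)])
  from assms(1) obtain B where B: "\<And>y. y \<in> K \<Longrightarrow> norm y \<le> B" by (auto simp: bounded_iff)
  have "inner q y \<le> norm q * B" if "y \<in> K" for y
    using norm_cauchy_schwarz[of q y] mult_left_mono[OF B[OF that], of "norm q"] by simp
  then show "bdd_above (inner q ` K)" by (auto intro!: bdd_aboveI)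
qed

lemma supp_fun_least:
  assumes "K \<noteq> {}" "\<And>y. y \<in> K \<Longrightarrow> inner q y \<le> c"
  shows "supp_fun K q \<le> c"
  unfolding supp_fun_def using assms by (intro cSUP_least) auto

lemma supp_fun_near:
  assumes "K \<noteq> {}" "bounded L" "\<And>y. y \<in> K \<Longrightarrow> \<exists>z\<in>L. dist y z \<le> \<theta>"
  shows "supp_fun K q \<le> supp_fun L q + norm q * \<theta>"
proof (rule supp_fun_least[OF assms(1)])
  fix y assume "y \<in> K"
  then obtain z where z: "z \<in> L" "dist y z \<le> \<theta>" using assms(3) by blast
  have "inner q y = inner q z + inner q (y - z)" by (simp add: inner_diff_right)
  also have "\<dots> \<le> supp_fun L q + norm q * dist y z"
    using supp_fun_upper[OF assms(2) z(1)] norm_cauchy_schwarz[of q "y - z"]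
    by (intro add_mono) (auto simp: dist_norm)
  also have "\<dots> \<le> supp_fun L q + norm q * \<theta>" using z by (auto intro: mult_left_mono)
  finally show "inner q y \<le> supp_fun L q + norm q * \<theta>" .
qed

lemma supp_fun_triangle:
  assumes "K \<noteq> {}" "bounded K"
  shows "supp_fun K (p + q) \<le> supp_fun K p + supp_fun K q"
  using assms by (intro supp_fun_least) (auto simp: inner_add_left intro!: add_mono supp_fun_upper)

lemma supp_fun_scaleR:
  assumes K: "K \<noteq> {}" "bounded K" and s: "0 \<le> s"
  shows "supp_fun K (s *\<^sub>R q) = s * supp_fun K q"
proof -
  have le: "supp_fun K (s *\<^sub>R q) \<le> s * supp_fun K q" if "0 \<le> s" for s q
    using K that by (intro supp_fun_least) (auto intro!: mult_left_mono supp_fun_upper)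
  show ?thesis
  proof (cases "s = 0")
    case True
    have "(\<lambda>y. inner (0 *\<^sub>R q) y) ` K = {0}" using K by auto
    then show ?thesis unfolding supp_fun_def True by simp
  next
    case False
    then have "supp_fun K q \<le> (1 / s) * supp_fun K (s *\<^sub>R q)"
      using le[of "1 / s" "s *\<^sub>R q"] s by simp
    with le[OF s, of q] False s show ?thesis by (simp add: field_simps)
  qed
qed

lemma supp_fun_lipschitz:
  assumes "K \<noteq> {}" and B: "\<And>y. y \<in> K \<Longrightarrow> norm y \<le> B"
  shows "\<bar>supp_fun K p - supp_fun K q\<bar> \<le> B * norm (p - q)"
proof -
  have K: "bounded K" using B by (auto simp: bounded_iff)
  have "supp_fun K p \<le> supp_fun K q + B * norm (p - q)" for p q
  proof (rule supp_fun_least[OF assms(1)])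
    fix y assume y: "y \<in> K"
    have "inner p y = inner q y + inner (p - q) y" by (simp add: inner_diff_left)
    also have "\<dots> \<le> supp_fun K q + norm (p - q) * norm y"
      using supp_fun_upper[OF K y] norm_cauchy_schwarz[of "p - q" y] by (intro add_mono) auto
    also have "\<dots> \<le> supp_fun K q + B * norm (p - q)"
      using B[OF y] mult_right_mono[OF B[OF y], of "norm (p - q)"] by (simp add: mult.commute)
    finally show "inner p y \<le> supp_fun K q + B * norm (p - q)" .
  qed
  from this[of p q] this[of q p] show ?thesis by (simp add: norm_minus_commute)
qed

lemma continuous_supp_fun:
  assumes "K \<noteq> {}" "bounded K"
  shows "continuous_on UNIV (supp_fun K)"
proof -
  obtain B where B: "0 < B" "\<And>y. y \<in> K \<Longrightarrow> norm y \<le> B"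
    using assms(2) by (auto simp: bounded_pos)
  have "B-lipschitz_on UNIV (supp_fun K)"
    using supp_fun_lipschitz[OF assms(1) B(2)] B(1)
    by (intro lipschitz_onI) (auto simp: dist_norm)
  then show ?thesis by (rule lipschitz_on_continuous_on)
qed

section \<open>Averages over the unit sphere\<close>

abbreviation unit_ball :: "'b::euclidean_space set" where "unit_ball \<equiv> ball 0 1"

lemma unit_ball_measure_pos: "0 < measure lborel (unit_ball :: 'b::euclidean_space set)"
  using content_ball_pos[of 1 "0::'b"] by simp

lemma measurable_sgn_comp:
  fixes \<phi> :: "'b::euclidean_space \<Rightarrow> 'c::euclidean_space"
  assumes "continuous_on UNIV \<phi>"
  shows "(\<lambda>p. \<phi> (sgn p)) \<in> borel_measurable borel"
proof -
  have "\<phi> \<in> borel_measurable borel" using assms by (rule borel_measurable_continuous_onI)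
  moreover have "(\<lambda>p. sgn p) \<in> borel_measurable (borel :: 'b measure)"
    unfolding sgn_div_norm by measurable
  ultimately show ?thesis by measurable
qed

text \<open>The radial projection is \<open>sgn\<close>, which sends 0 to 0; the compact set
  containing its values is therefore taken to be the closed ball and not the sphere.\<close>

lemma norm_sgn_comp_bounded:
  fixes \<phi> :: "'b::euclidean_space \<Rightarrow> 'c::euclidean_space"
  assumes "continuous_on UNIV \<phi>"
  obtains C where "0 \<le> C" "\<And>p. norm (\<phi> (sgn p)) \<le> C"
proof -
  have "compact (\<phi> ` cball 0 1)"
    using assms by (intro compact_continuous_image continuous_on_subset[OF assms]) auto
  then obtain C where "\<And>p. p \<in> cball 0 1 \<Longrightarrow> norm (\<phi> p) \<le> C"
    using compact_imp_bounded bounded_iff by (metis imageI)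
  then have "norm (\<phi> (sgn p)) \<le> C" for p by (simp add: norm_sgn)
  moreover from this[of 0] have "0 \<le> C" using norm_ge_zero order_trans by blast
  ultimately show ?thesis using that by blast
qed

lemma integrable_ball_const:
  "integrable lborel (\<lambda>p::'b::euclidean_space. indicator (ball 0 r) p *\<^sub>R (C::real))"
  using emeasure_lborel_ball_finite[of "0::'b" r]
  by (intro integrable_scaleR_left integrable_real_indicator) auto

lemma set_integrable_bounded_ball:
  fixes F :: "'b::euclidean_space \<Rightarrow> 'c::euclidean_space"
  assumes "F \<in> borel_measurable borel" "\<And>p. p \<in> ball 0 r \<Longrightarrow> norm (F p) \<le> C"
  shows "set_integrable lborel (ball 0 r) F"
  unfolding set_integrable_def
proof (rule Bochner_Integration.integrable_bound[of lborel "\<lambda>p. indicator (ball 0 r) p *\<^sub>R C"])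
  show "integrable lborel (\<lambda>p::'b. indicator (ball 0 r) p *\<^sub>R C)" by (rule integrable_ball_const)
  show "(\<lambda>x. indicat_real (ball 0 r) x *\<^sub>R F x) \<in> borel_measurable lborel"
    using assms(1) by (intro borel_measurable_scaleR borel_measurable_indicator) auto
  show "AE x in lborel. norm (indicat_real (ball 0 r) x *\<^sub>R F x) \<le> norm (indicat_real (ball 0 r) x *\<^sub>R C)"
    using assms(2) by (auto simp: indicator_def intro!: AE_I2 order_trans[OF _ abs_ge_self])
qed

lemma sphere_avg_sgn:
  "sphere_avg \<phi> = (1 / measure lborel (unit_ball :: 'b::euclidean_space set)) *\<^sub>R
     (LINT p:unit_ball|lborel. \<phi> (sgn (p::'b)))"
  by (simp add: sphere_avg_def sgn_div_norm)

lemma set_integrable_sgn_comp: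
  fixes \<phi> :: "'b::euclidean_space \<Rightarrow> 'c::euclidean_space"
  assumes "continuous_on UNIV \<phi>"
  shows "set_integrable lborel unit_ball (\<lambda>p. \<phi> (sgn p))"
proof -
  obtain C where C: "0 \<le> C" "\<And>p. norm (\<phi> (sgn p)) \<le> C" using norm_sgn_comp_bounded[OF assms] by blast
  show ?thesis by (rule set_integrable_bounded_ball[OF measurable_sgn_comp[OF assms] C(2)])
qed

lemma sphere_avg_dist:
  fixes \<phi> \<psi> :: "'b::euclidean_space \<Rightarrow> 'c::euclidean_space"
  assumes \<phi>: "continuous_on UNIV \<phi>" and \<psi>: "continuous_on UNIV \<psi>"
    and le: "\<And>u. norm u \<le> 1 \<Longrightarrow> norm (\<phi> u - \<psi> u) \<le> \<theta>"
  shows "dist (sphere_avg \<phi>) (sphere_avg \<psi>) \<le> \<theta>"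
proof -
  let ?B = "unit_ball :: 'b set"
  have int: "set_integrable lborel ?B (\<lambda>p. \<phi> (sgn p) - \<psi> (sgn p))"
    by (intro set_integral_diff set_integrable_sgn_comp \<phi> \<psi>)
  have "norm (LINT p:?B|lborel. \<phi> (sgn p) - \<psi> (sgn p)) \<le> (LINT p:?B|lborel. norm (\<phi> (sgn p) - \<psi> (sgn p)))"
    by (rule set_integral_norm_bound[OF int])
  also have "\<dots> \<le> (LINT p:?B|lborel. \<theta>)"
  proof (rule set_integral_mono)
    show "set_integrable lborel ?B (\<lambda>p. norm (\<phi> (sgn p) - \<psi> (sgn p)))" using int by (rule set_integrable_norm)
    show "set_integrable lborel ?B (\<lambda>p. \<theta>)"
      by (rule set_integrable_bounded_ball[where C = "\<bar>\<theta>\<bar>"]) auto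
    show "norm (\<phi> (sgn p) - \<psi> (sgn p)) \<le> \<theta>" for p by (rule le) (simp add: norm_sgn)
  qed
  also have "\<dots> = measure lborel ?B * \<theta>"
    by (simp add: set_lebesgue_integral_def)
  finally have "norm ((LINT p:?B|lborel. \<phi> (sgn p)) - (LINT p:?B|lborel. \<psi> (sgn p))) \<le> measure lborel ?B * \<theta>"
    by (simp add: set_integral_diff set_integrable_sgn_comp \<phi> \<psi>)
  then show ?thesis
    using unit_ball_measure_pos[where 'b='b]
    by (simp add: sphere_avg_sgn dist_norm scaleR_diff_right[symmetric] divide_le_eq mult.commute)
qed

text \<open>Mutual distance \<open>\<theta>\<close> makes the two support functions differ by at
  most \<open>\<theta>\<close> on unit vectors, and averaging against unit vectors does not enlarge
  this. The dimension is the factor in the definition of the Steiner point.\<close>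

lemma steiner_point_dist:
  fixes K L :: "'b::euclidean_space set" and \<theta> :: real
  assumes K: "K \<noteq> {}" "bounded K" and L: "L \<noteq> {}" "bounded L"
    and KL: "\<And>y. y \<in> K \<Longrightarrow> \<exists>z\<in>L. dist y z \<le> \<theta>" and LK: "\<And>y. y \<in> L \<Longrightarrow> \<exists>z\<in>K. dist y z \<le> \<theta>"
  shows "dist (steiner_point K) (steiner_point L) \<le> DIM('b) * \<theta>"
proof -
  have \<theta>: "0 \<le> \<theta>" using K(1) KL by (meson all_not_in_conv zero_le_dist order_trans)
  have "dist (sphere_avg (\<lambda>p. supp_fun K p *\<^sub>R p)) (sphere_avg (\<lambda>p. supp_fun L p *\<^sub>R p)) \<le> \<theta>"
  proof (rule sphere_avg_dist)
    show "continuous_on UNIV (\<lambda>p. supp_fun K p *\<^sub>R p)" "continuous_on UNIV (\<lambda>p. supp_fun L p *\<^sub>R p)"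
      using continuous_supp_fun[OF K] continuous_supp_fun[OF L] by (auto intro!: continuous_intros)
    fix u :: 'b assume u: "norm u \<le> 1"
    have "\<bar>supp_fun K u - supp_fun L u\<bar> \<le> norm u * \<theta>"
      using supp_fun_near[OF K(1) L(2) KL, of u] supp_fun_near[OF L(1) K(2) LK, of u] by auto
    then have "\<bar>supp_fun K u - supp_fun L u\<bar> * norm u \<le> (norm u * \<theta>) * norm u"
      by (rule mult_right_mono) simp
    also have "\<dots> \<le> 1 * \<theta> * 1" using u \<theta> by (intro mult_mono) auto
    finally show "norm (supp_fun K u *\<^sub>R u - supp_fun L u *\<^sub>R u) \<le> \<theta>"
      by (simp add: scaleR_diff_left[symmetric])
  qed
  then show ?thesis unfolding steiner_point_def
    by (simp add: dist_norm scaleR_diff_right[symmetric])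
qed

section \<open>Radial moments and membership of the Steiner point\<close>

lemma lborel_integral_affine_euclidean:
  fixes G :: "'b::euclidean_space \<Rightarrow> real"
  assumes "c \<noteq> 0" "G \<in> borel_measurable borel"
  shows "(LINT x|lborel. G x) = \<bar>c\<bar> ^ DIM('b) * (LINT x|lborel. G (t + c *\<^sub>R x))"
  by (subst lborel_affine[OF assms(1), of t])
    (use assms(2) in \<open>simp add: integral_density integral_distr\<close>)

lemma sgn_scaleR_pos: "0 < s \<Longrightarrow> sgn (s *\<^sub>R p) = sgn (p::'b::euclidean_space)"
  by (simp add: sgn_scaleR)

text \<open>Differentiating \<open>s \<mapsto> \<integral> max 0 (1 - |s p|) \<psi>(p) dp = s\<^sup>-\<^sup>m \<integral> max 0 (1 - |p|) \<psi>(p) dp\<close>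
  at \<open>s = 1\<close> replaces polar coordinates.\<close>
lemma radial_moment:
  fixes \<psi> :: "'b::euclidean_space \<Rightarrow> real"
  assumes [measurable]: "\<psi> \<in> borel_measurable borel" and C: "\<And>p. \<bar>\<psi> p\<bar> \<le> C"
    and hom: "\<And>s p. 0 < s \<Longrightarrow> \<psi> (s *\<^sub>R p) = \<psi> p"
  shows "(real DIM('b) + 1) * (LINT p:unit_ball|lborel. norm p * \<psi> p) = DIM('b) * (LINT p:unit_ball|lborel. \<psi> p)"
proof -
  let ?B = "unit_ball :: 'b set" and ?m = "DIM('b)"
  define w where "w p = max 0 (1 - norm (p::'b))" for p
  have [measurable]: "w \<in> borel_measurable borel" unfolding w_def by measurable
  have C0: "0 \<le> C" using C[of 0] by linarith
  define \<epsilon> where "\<epsilon> n = inverse (real (Suc n))" for n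
  have \<epsilon>: "0 < \<epsilon> n" for n by (simp add: \<epsilon>_def)
  have \<epsilon>0: "\<epsilon> \<longlonglongrightarrow> 0" unfolding \<epsilon>_def by (rule LIMSEQ_inverse_real_of_nat)
  have int_\<psi>: "set_integrable lborel ?B \<psi>" using C by (intro set_integrable_bounded_ball[where C = C]) auto
  have int_n\<psi>: "set_integrable lborel ?B (\<lambda>p. norm p * \<psi> p)"
  proof (rule set_integrable_bounded_ball[where C = "1 * C"])
    show "norm (norm p * \<psi> p) \<le> 1 * C" if "p \<in> ball 0 1" for p
      using that C[of p] C0 unfolding real_norm_def abs_mult by (intro mult_mono) auto
  qed simp
  have w: "w p * \<psi> p = indicator ?B p *\<^sub>R (\<psi> p - norm p * \<psi> p)" for p
    by (auto simp: w_def indicator_def algebra_simps)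
  have int_w: "integrable lborel (\<lambda>p. w p * \<psi> p)"
    unfolding w using set_integral_diff(1)[OF int_\<psi> int_n\<psi>] by (simp add: set_integrable_def)
  define I where "I = (LINT p|lborel. w p * \<psi> p)"
  have I: "I = (LINT p:?B|lborel. \<psi> p) - (LINT p:?B|lborel. norm p * \<psi> p)"
    unfolding I_def w using set_integral_diff(2)[OF int_\<psi> int_n\<psi>] by (simp add: set_lebesgue_integral_def)
  have sc: "I = (1 + \<epsilon> n) ^ ?m * (LINT p|lborel. w ((1 + \<epsilon> n) *\<^sub>R p) * \<psi> p)" for n
    unfolding I_def
    using lborel_integral_affine_euclidean[of "1 + \<epsilon> n" "\<lambda>p. w p * \<psi> p" 0] \<epsilon>[of n] hom[of "1 + \<epsilon> n"]
    by simp
  have int_ws: "integrable lborel (\<lambda>p. w ((1 + \<epsilon> n) *\<^sub>R p) * \<psi> p)" for n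
  proof (rule Bochner_Integration.integrable_bound[of lborel "\<lambda>p. indicator ?B p *\<^sub>R C"])
    show "integrable lborel (\<lambda>p::'b. indicator ?B p *\<^sub>R C)" by (rule integrable_ball_const)
    have "\<bar>w ((1 + \<epsilon> n) *\<^sub>R p) * \<psi> p\<bar> \<le> \<bar>indicator ?B p * C\<bar>" for p
    proof (cases "p \<in> ?B")
      case True
      then show ?thesis using C[of p] mult_mono[of "w ((1 + \<epsilon> n) *\<^sub>R p)" 1 "\<bar>\<psi> p\<bar>" C] \<epsilon>[of n]
        by (auto simp: abs_mult w_def)
    next
      case False
      then have "1 \<le> (1 + \<epsilon> n) * norm p" using \<epsilon>[of n] mult_mono[of 1 "1 + \<epsilon> n" 1 "norm p"] by simp
      then show ?thesis using \<epsilon>[of n] by (simp add: w_def)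
    qed
    then show "AE p in lborel. norm (w ((1 + \<epsilon> n) *\<^sub>R p) * \<psi> p) \<le> norm (indicat_real ?B p *\<^sub>R C)" by simp
  qed simp
  \<comment> \<open>Difference quotients of the scaled weight at scale 1. For fixed \<open>p\<close>
    in the open ball they are eventually equal to \<open>- (norm p * \<psi> p)\<close>, and off the
    ball they vanish. Since \<open>w\<close> is 1-Lipschitz in the norm, \<open>C\<close> dominates
    them on the ball.\<close>
  define D where "D n p = (w ((1 + \<epsilon> n) *\<^sub>R p) * \<psi> p - w p * \<psi> p) / \<epsilon> n" for n p
  have lim1: "(\<lambda>n. LINT p|lborel. D n p) \<longlonglongrightarrow> (LINT p|lborel. - (indicator ?B p *\<^sub>R (norm p * \<psi> p)))"
  proof (rule integral_dominated_convergence[where w = "\<lambda>p. indicator ?B p *\<^sub>R C"])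
    show "integrable lborel (\<lambda>p::'b. indicator ?B p *\<^sub>R C)" by (rule integrable_ball_const)
    show "AE p in lborel. (\<lambda>n. D n p) \<longlonglongrightarrow> - (indicator ?B p *\<^sub>R (norm p * \<psi> p))"
    proof (rule AE_I2)
      fix p :: 'b
      have "\<forall>\<^sub>F n in sequentially. D n p = - (indicator ?B p *\<^sub>R (norm p * \<psi> p))"
      proof (cases "p \<in> ?B")
        case True
        have "(\<lambda>n. (1 + \<epsilon> n) * norm p) \<longlonglongrightarrow> (1 + 0) * norm p" by (intro tendsto_intros \<epsilon>0)
        then have "\<forall>\<^sub>F n in sequentially. (1 + \<epsilon> n) * norm p < 1"
          using True by (intro order_tendstoD(2)) auto
        then show ?thesis
        proof eventually_elim
          case (elim n)
          then have "w ((1 + \<epsilon> n) *\<^sub>R p) - w p = - (\<epsilon> n * norm p)"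
            using True \<epsilon>[of n] by (simp add: w_def algebra_simps del: scaleR_left_distrib)
          then show ?case using True \<epsilon>[of n] by (simp add: D_def left_diff_distrib[symmetric])
        qed
      next
        case False
        then have "1 \<le> (1 + \<epsilon> n) * norm p" for n using \<epsilon>[of n] mult_mono[of 1 "1 + \<epsilon> n" 1 "norm p"] by simp
        then have "D n p = 0" for n using \<epsilon>[of n] False by (simp add: D_def w_def)
        then show ?thesis using False by simp
      qed
      then show "(\<lambda>n. D n p) \<longlonglongrightarrow> - (indicator ?B p *\<^sub>R (norm p * \<psi> p))" by (rule tendsto_eventually)
    qed
    have "\<bar>D n p\<bar> \<le> indicator ?B p * C" for n p
    proof (cases "p \<in> ?B")
      case True
      have "norm ((1 + \<epsilon> n) *\<^sub>R p) = norm p + \<epsilon> n * norm p" "0 \<le> \<epsilon> n * norm p"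
        using \<epsilon>[of n] by (auto simp: algebra_simps simp del: scaleR_left_distrib)
      then have "\<bar>w ((1 + \<epsilon> n) *\<^sub>R p) - w p\<bar> \<le> \<epsilon> n * norm p"
        unfolding w_def by linarith
      also have "\<dots> \<le> \<epsilon> n * 1" using True \<epsilon>[of n] by (intro mult_left_mono) auto
      finally have "\<bar>w ((1 + \<epsilon> n) *\<^sub>R p) - w p\<bar> * \<bar>\<psi> p\<bar> \<le> \<epsilon> n * C" using C[of p] \<epsilon>[of n] by (intro mult_mono) auto
      then have "\<bar>(w ((1 + \<epsilon> n) *\<^sub>R p) - w p) * \<psi> p / \<epsilon> n\<bar> \<le> C"
        using \<epsilon>[of n] by (simp add: abs_mult divide_le_eq mult.commute)
      then show ?thesis using True by (simp add: D_def left_diff_distrib)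
    next
      case False
      then have "1 \<le> (1 + \<epsilon> n) * norm p" using \<epsilon>[of n] mult_mono[of 1 "1 + \<epsilon> n" 1 "norm p"] by simp
      then show ?thesis using \<epsilon>[of n] False by (simp add: D_def w_def)
    qed
    then show "AE p in lborel. norm (D n p) \<le> indicator ?B p *\<^sub>R C" for n by simp
    show "(\<lambda>p. D n p) \<in> borel_measurable lborel" for n unfolding D_def by measurable
    show "(\<lambda>p. - (indicator ?B p *\<^sub>R (norm p * \<psi> p))) \<in> borel_measurable lborel"
      using assms(1) by (intro borel_measurable_uminus borel_measurable_scaleR borel_measurable_indicator
          borel_measurable_times) auto
  qed
  \<comment> \<open>The same integrals computed by the change of variables \<open>sc\<close>:
    homogeneity of degree 0 leaves only the Jacobian, whose derivative at scale 1 is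
    \<open>- DIM('b)\<close>. Equating the two limits gives the moment identity.\<close>
  have eq: "(LINT p|lborel. D n p) = (1 / (1 + \<epsilon> n) ^ ?m - 1) / \<epsilon> n * I" for n
  proof -
    have "(LINT p|lborel. D n p) = ((LINT p|lborel. w ((1 + \<epsilon> n) *\<^sub>R p) * \<psi> p) - I) / \<epsilon> n"
      unfolding D_def I_def using int_ws[of n] int_w by simp
    moreover have "(LINT p|lborel. w ((1 + \<epsilon> n) *\<^sub>R p) * \<psi> p) = I / (1 + \<epsilon> n) ^ ?m"
      using sc[of n] \<epsilon>[of n] by (simp add: field_simps)
    ultimately show ?thesis by (simp add: field_simps)
  qed
  have lim2: "(\<lambda>n. (1 / (1 + \<epsilon> n) ^ ?m - 1) / \<epsilon> n * I) \<longlonglongrightarrow> - real ?m * I"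
  proof (rule tendsto_mult[OF _ tendsto_const])
    have "((\<lambda>s::real. 1 / (1 + s) ^ ?m) has_real_derivative - real ?m) (at 0)"
      by (auto intro!: derivative_eq_intros)
    then have "((\<lambda>s::real. (1 / (1 + s) ^ ?m - 1) / s) \<longlongrightarrow> - real ?m) (at 0)"
      by (simp add: DERIV_def)
    moreover have "filterlim \<epsilon> (at 0) sequentially"
      using \<epsilon>0 \<epsilon> by (auto simp: filterlim_at less_imp_neq[symmetric])
    ultimately show "(\<lambda>n. (1 / (1 + \<epsilon> n) ^ ?m - 1) / \<epsilon> n) \<longlonglongrightarrow> - real ?m"
      by (rule filterlim_compose)
  qed
  have "(LINT p|lborel. - (indicator ?B p *\<^sub>R (norm p * \<psi> p))) = - real ?m * I"
    using LIMSEQ_unique[OF lim1[unfolded eq] lim2] .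
  then have "(LINT p:?B|lborel. norm p * \<psi> p) = real ?m * I" by (simp add: set_lebesgue_integral_def)
  then show ?thesis unfolding I by (simp add: algebra_simps)
qed

text \<open>The Steiner point is the mean of \<open>\<nabla>h\<close> over the ball (with any radial weight), and sublinearity
  of the support function \<open>h\<close> gives \<open>h(p + \<epsilon>q) - h(p) \<le> \<epsilon> h(q)\<close>; the gradient itself is avoided
  by moving the difference quotient onto the weight \<open>max 0 (1 - |p|)\<close>.\<close>
lemma steiner_point_inner_le:
  fixes K :: "'b::euclidean_space set"
  assumes K: "K \<noteq> {}" "bounded K"
  shows "inner (steiner_point K) q \<le> supp_fun K q"
proof -
  let ?B = "unit_ball :: 'b set" and ?m = "real DIM('b)"
  define h where "h = supp_fun K"
  have h_cont: "continuous_on UNIV h" unfolding h_def by (rule continuous_supp_fun[OF K])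
  then have [measurable]: "h \<in> borel_measurable borel" by (rule borel_measurable_continuous_onI)
  define w where "w p = max 0 (1 - norm (p::'b))" for p
  have [measurable]: "w \<in> borel_measurable borel" unfolding w_def by measurable
  have w01: "0 \<le> w p" "w p \<le> 1" for p by (auto simp: w_def)
  \<comment> \<open>The degree-zero extension of the integrand that defines the component of the
    Steiner point in direction \<open>q\<close>.\<close>
  define \<psi> where "\<psi> p = inner (sgn p) q * h (sgn p)" for p
  have \<psi>_cont: "continuous_on UNIV (\<lambda>u. inner u q * h u)" using h_cont by (intro continuous_intros)
  have \<psi>_meas: "\<psi> \<in> borel_measurable borel"
    unfolding \<psi>_def by (rule measurable_sgn_comp[OF \<psi>_cont])
  obtain C where C: "\<And>p. \<bar>\<psi> p\<bar> \<le> C"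
    using norm_sgn_comp_bounded[OF \<psi>_cont] unfolding \<psi>_def real_norm_def by metis
  have hom: "h p = norm p * h (sgn p)" for p
    using supp_fun_scaleR[OF K norm_ge_zero[of p], of "sgn p"] by (cases "p = 0") (auto simp: h_def sgn_div_norm)
  have mom: "(?m + 1) * (LINT p:?B|lborel. norm p * \<psi> p) = ?m * (LINT p:?B|lborel. \<psi> p)"
    using radial_moment[OF \<psi>_meas C] by (simp add: \<psi>_def sgn_scaleR_pos)
  \<comment> \<open>The moment identity for the constant 1; below it gives the integral of
    \<open>w\<close> as \<open>vol / (?m + 1)\<close>.\<close>
  have mom1: "(?m + 1) * (LINT p:?B|lborel. norm p * 1) = ?m * (LINT p:?B|lborel. 1)"
    by (rule radial_moment[where C = 1]) auto
  \<comment> \<open>A shift by \<open>\<epsilon> n *\<^sub>R q\<close> has length at most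
    \<open>norm q\<close>, so one ball of this radius carries all shifted weights.\<close>
  define r where "r = 2 + norm q"
  obtain M where M: "0 \<le> M" "\<And>p. p \<in> cball 0 r \<Longrightarrow> \<bar>h p\<bar> \<le> M"
  proof -
    have "compact (h ` cball 0 r)"
      by (intro compact_continuous_image continuous_on_subset[OF h_cont]) auto
    then obtain M where "\<And>p. p \<in> cball 0 r \<Longrightarrow> \<bar>h p\<bar> \<le> M"
      using compact_imp_bounded bounded_iff real_norm_def by (metis imageI)
    then have "0 \<le> \<bar>M\<bar>" "\<And>p. p \<in> cball 0 r \<Longrightarrow> \<bar>h p\<bar> \<le> \<bar>M\<bar>" by force+
    then show ?thesis using that by blast
  qed
  define \<epsilon> where "\<epsilon> n = inverse (real (Suc n))" for n
  have \<epsilon>: "0 < \<epsilon> n" "\<epsilon> n \<le> 1" for n by (auto simp: \<epsilon>_def inverse_eq_divide)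
  have \<epsilon>0: "\<epsilon> \<longlonglongrightarrow> 0" unfolding \<epsilon>_def by (rule LIMSEQ_inverse_real_of_nat)
  have nq: "norm (\<epsilon> n *\<^sub>R q) \<le> norm q" for n
    using \<epsilon>[of n] mult_right_mono[of "\<epsilon> n" 1 "norm q"] by simp
  have w_out: "w (p - \<epsilon> n *\<^sub>R q) = 0" "w p = 0" if "p \<notin> ball 0 r" for p n
  proof -
    have "2 + norm q \<le> norm p" using that by (simp add: r_def)
    then have "1 \<le> norm p" "1 \<le> norm (p - \<epsilon> n *\<^sub>R q)"
      using norm_triangle_ineq2[of p "\<epsilon> n *\<^sub>R q"] nq[of n] norm_ge_zero[of q] by linarith+
    then show "w (p - \<epsilon> n *\<^sub>R q) = 0" "w p = 0" by (auto simp: w_def)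
  qed
  have int: "integrable lborel (\<lambda>p. w (p - s *\<^sub>R q) * h p)" if "s = 0 \<or> s = \<epsilon> n" for s n
  proof (rule Bochner_Integration.integrable_bound[OF integrable_ball_const[of r M]])
    have "\<bar>w (p - s *\<^sub>R q) * h p\<bar> \<le> indicator (ball 0 r) p * M" for p
    proof (cases "p \<in> ball 0 r")
      case True
      have "w (p - s *\<^sub>R q) * \<bar>h p\<bar> \<le> 1 * M" using True M w01 by (intro mult_mono) auto
      then show ?thesis using True w01 by (simp add: abs_mult)
    qed (use w_out that in auto)
    then show "AE p in lborel. norm (w (p - s *\<^sub>R q) * h p) \<le> norm (indicat_real (ball 0 r) p *\<^sub>R M)"
      using M(1) by simp
  qed simp
  have int_w: "integrable lborel w"
  proof (rule Bochner_Integration.integrable_bound[OF integrable_ball_const[of r 1]])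
    have "\<bar>w p\<bar> \<le> indicator (ball 0 r) p" for p
      using w01[of p] w_out[of p] by (cases "p \<in> ball 0 r") auto
    then show "AE p in lborel. norm (w p) \<le> norm (indicat_real (ball 0 r) p *\<^sub>R (1::real))" by simp
  qed simp
  define D where "D n p = (w (p - \<epsilon> n *\<^sub>R q) * h p - w p * h p) / \<epsilon> n" for n p
  have D_le: "(LINT p|lborel. D n p) \<le> h q * (LINT p|lborel. w p)" for n
  proof -
    \<comment> \<open>Translation invariance moves the shift from the weight to \<open>h\<close>,
      where sublinearity can be used; for the limit it stays on the weight, which is differentiable
      almost everywhere.\<close>
    have tr: "(LINT p|lborel. w (p - \<epsilon> n *\<^sub>R q) * h p) = (LINT p|lborel. w p * h (p + \<epsilon> n *\<^sub>R q))"
      using lborel_integral_affine_euclidean[of 1 "\<lambda>p. w (p - \<epsilon> n *\<^sub>R q) * h p" "\<epsilon> n *\<^sub>R q"]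
      by (simp add: add.commute)
    have int': "integrable lborel (\<lambda>p. w p * h (p + \<epsilon> n *\<^sub>R q))"
    proof (rule Bochner_Integration.integrable_bound[OF integrable_ball_const[of 1 M]])
      have "\<bar>w p * h (p + \<epsilon> n *\<^sub>R q)\<bar> \<le> indicator (ball 0 1) p * M" for p
      proof (cases "p \<in> ?B")
        case True
        have "norm (p + \<epsilon> n *\<^sub>R q) \<le> r"
          using True norm_triangle_ineq[of p "\<epsilon> n *\<^sub>R q"] nq[of n] by (simp add: r_def)
        then have "w p * \<bar>h (p + \<epsilon> n *\<^sub>R q)\<bar> \<le> 1 * M" using M w01 by (intro mult_mono) auto
        then show ?thesis using True w01 by (simp add: abs_mult)
      qed (auto simp: w_def)
      then show "AE p in lborel. norm (w p * h (p + \<epsilon> n *\<^sub>R q)) \<le> norm (indicat_real (ball 0 1) p *\<^sub>R M)"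
        using M(1) by simp
    qed simp
    have "(LINT p|lborel. w p * h (p + \<epsilon> n *\<^sub>R q)) \<le> (LINT p|lborel. w p * h p + w p * (\<epsilon> n * h q))"
    proof (rule integral_mono[OF int'])
      show "integrable lborel (\<lambda>p. w p * h p + w p * (\<epsilon> n * h q))"
        using int[of 0] int_w by simp
      have "h (p + \<epsilon> n *\<^sub>R q) \<le> h p + \<epsilon> n * h q" for p
        using supp_fun_triangle[OF K, of p "\<epsilon> n *\<^sub>R q"] supp_fun_scaleR[OF K, of "\<epsilon> n" q] \<epsilon>[of n]
        by (simp add: h_def)
      then show "w p * h (p + \<epsilon> n *\<^sub>R q) \<le> w p * h p + w p * (\<epsilon> n * h q)" for p
        unfolding distrib_left[symmetric] by (rule mult_left_mono) (rule w01)
    qed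
    also have "\<dots> = (LINT p|lborel. w p * h p) + (LINT p|lborel. w p) * (\<epsilon> n * h q)"
      using int[of 0] int_w by simp
    finally have "(LINT p|lborel. w (p - \<epsilon> n *\<^sub>R q) * h p) - (LINT p|lborel. w p * h p)
        \<le> \<epsilon> n * (h q * (LINT p|lborel. w p))"
      unfolding tr by (simp add: algebra_simps)
    moreover have "(LINT p|lborel. D n p)
        = ((LINT p|lborel. w (p - \<epsilon> n *\<^sub>R q) * h p) - (LINT p|lborel. w p * h p)) / \<epsilon> n"
      unfolding D_def using int[of 0] int[of "\<epsilon> n" n] by simp
    ultimately show ?thesis using \<epsilon>(1)[of n] by (simp add: divide_le_eq mult.commute)
  qed
  have "(\<lambda>n. LINT p|lborel. D n p) \<longlonglongrightarrow> (LINT p|lborel. indicator ?B p *\<^sub>R (norm p * \<psi> p))"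
  proof (rule integral_dominated_convergence[where w = "\<lambda>p. indicator (ball 0 r) p *\<^sub>R (norm q * M)"])
    show "integrable lborel (\<lambda>p::'b. indicator (ball 0 r) p *\<^sub>R (norm q * M))" by (rule integrable_ball_const)
    \<comment> \<open>The weight has a kink on the unit sphere, which is a null set.\<close>
    have "AE p in lborel. p \<notin> sphere (0::'b) 1"
      using negligible_sphere[of "0::'b" 1] null_sets_completion_iff[of "sphere (0::'b) 1" lborel]
      by (intro AE_not_in) (simp add: negligible_iff_null_sets)
    then show "AE p in lborel. (\<lambda>n. D n p) \<longlonglongrightarrow> indicator ?B p *\<^sub>R (norm p * \<psi> p)"
    proof eventually_elim
      case (elim p)
      have lim: "(\<lambda>n. norm (p - \<epsilon> n *\<^sub>R q)) \<longlonglongrightarrow> norm (p - 0 *\<^sub>R q)" by (intro tendsto_intros \<epsilon>0)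
      \<comment> \<open>At the origin the norm is not differentiable, but \<open>h\<close> vanishes
        there. Outside the closed ball both weights are eventually 0. Inside, the chain rule for the
        norm gives the derivative of the weight.\<close>
      consider "p = 0" | "p \<noteq> 0" "norm p < 1" | "norm p > 1" using elim by force
      then show ?case
      proof cases
        case 1
        then have "h p = 0" using hom[of p] by simp
        then show ?thesis using 1 by (simp add: D_def)
      next
        case 3
        have "\<forall>\<^sub>F n in sequentially. norm (p - \<epsilon> n *\<^sub>R q) > 1"
          using lim 3 by (intro order_tendstoD(1)) auto
        then have "\<forall>\<^sub>F n in sequentially. D n p = indicator ?B p *\<^sub>R (norm p * \<psi> p)"
          by eventually_elim (use 3 in \<open>simp add: D_def w_def\<close>)
        then show ?thesis by (rule tendsto_eventually)
      next
        case 2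
        have "((\<lambda>s. p - s *\<^sub>R q) has_derivative (\<lambda>s. - (s *\<^sub>R q))) (at 0)"
          by (auto intro!: derivative_eq_intros)
        moreover have "(norm has_derivative (\<lambda>h. inner (sgn p) h)) (at (p - 0 *\<^sub>R q))"
          using has_derivative_norm[OF 2(1)] by (simp add: inner_commute)
        ultimately have "((\<lambda>s. norm (p - s *\<^sub>R q)) has_derivative (\<lambda>s. inner (sgn p) (- (s *\<^sub>R q)))) (at 0)"
          by (rule has_derivative_compose)
        moreover have "(\<lambda>s. inner (sgn p) (- (s *\<^sub>R q))) = (*) (- inner (sgn p) q)"
          by (auto simp: fun_eq_iff)
        ultimately have "((\<lambda>s. norm (p - s *\<^sub>R q)) has_real_derivative - inner (sgn p) q) (at 0)"
          by (simp only: has_field_derivative_def)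
        then have "((\<lambda>s. (norm (p - s *\<^sub>R q) - norm p) / s) \<longlongrightarrow> - inner (sgn p) q) (at 0)"
          by (simp add: DERIV_def)
        moreover have "filterlim \<epsilon> (at 0) sequentially"
          using \<epsilon>0 \<epsilon>(1) by (auto simp: filterlim_at less_imp_neq[symmetric])
        ultimately have "(\<lambda>n. (norm (p - \<epsilon> n *\<^sub>R q) - norm p) / \<epsilon> n) \<longlonglongrightarrow> - inner (sgn p) q"
          by (rule filterlim_compose)
        then have "(\<lambda>n. - ((norm (p - \<epsilon> n *\<^sub>R q) - norm p) / \<epsilon> n) * h p) \<longlonglongrightarrow> - (- inner (sgn p) q) * h p"
          by (intro tendsto_intros)
        moreover have "\<forall>\<^sub>F n in sequentially. norm (p - \<epsilon> n *\<^sub>R q) < 1"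
          using lim 2 by (intro order_tendstoD(2)) auto
        then have "\<forall>\<^sub>F n in sequentially. - ((norm (p - \<epsilon> n *\<^sub>R q) - norm p) / \<epsilon> n) * h p = D n p"
        proof eventually_elim
          case (elim n)
          then have w_eq: "w (p - \<epsilon> n *\<^sub>R q) - w p = - (norm (p - \<epsilon> n *\<^sub>R q) - norm p)"
            using 2 by (auto simp: w_def)
          have "D n p = (w (p - \<epsilon> n *\<^sub>R q) - w p) * h p / \<epsilon> n" by (simp add: D_def left_diff_distrib)
          also have "\<dots> = - ((norm (p - \<epsilon> n *\<^sub>R q) - norm p) / \<epsilon> n) * h p"
            by (simp only: w_eq minus_divide_left times_divide_eq_left)
          finally show ?case by (rule sym)
        qed
        ultimately have "(\<lambda>n. D n p) \<longlonglongrightarrow> inner (sgn p) q * h p"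
          by (simp add: filterlim_cong)
        moreover have "inner (sgn p) q * h p = indicator ?B p *\<^sub>R (norm p * \<psi> p)"
          using 2 hom[of p] by (simp add: \<psi>_def)
        ultimately show ?thesis by simp
      qed
    qed
    have "\<bar>D n p\<bar> \<le> indicator (ball 0 r) p * (norm q * M)" for n p
    proof (cases "p \<in> ball 0 r")
      case True
      have "\<bar>w (p - \<epsilon> n *\<^sub>R q) - w p\<bar> \<le> \<bar>norm (p - \<epsilon> n *\<^sub>R q) - norm p\<bar>" by (auto simp: w_def)
      also have "\<dots> \<le> norm (\<epsilon> n *\<^sub>R q)" using norm_triangle_ineq3[of "p - \<epsilon> n *\<^sub>R q" p] by simp
      finally have "\<bar>w (p - \<epsilon> n *\<^sub>R q) - w p\<bar> \<le> \<epsilon> n * norm q" using \<epsilon>(1)[of n] by simp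
      then have "\<bar>w (p - \<epsilon> n *\<^sub>R q) - w p\<bar> * \<bar>h p\<bar> \<le> (\<epsilon> n * norm q) * M"
        using True M(2)[of p] \<epsilon>[of n] by (intro mult_mono) auto
      then have "\<bar>(w (p - \<epsilon> n *\<^sub>R q) - w p) * h p / \<epsilon> n\<bar> \<le> norm q * M"
        using \<epsilon>[of n] by (simp add: abs_mult divide_le_eq mult.commute mult.left_commute)
      then show ?thesis using True by (simp add: D_def left_diff_distrib)
    qed (simp add: D_def w_out)
    then show "AE p in lborel. norm (D n p) \<le> indicator (ball 0 r) p *\<^sub>R (norm q * M)" for n by simp
    show "(\<lambda>p. D n p) \<in> borel_measurable lborel" for n unfolding D_def by measurable
    show "(\<lambda>p. indicator ?B p *\<^sub>R (norm p * \<psi> p)) \<in> borel_measurable lborel"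
      using \<psi>_meas by (intro borel_measurable_scaleR borel_measurable_indicator borel_measurable_times) auto
  qed
  then have A: "(LINT p:?B|lborel. norm p * \<psi> p) \<le> h q * (LINT p|lborel. w p)"
    unfolding set_lebesgue_integral_def by (rule LIMSEQ_le_const2) (use D_le in auto)
  define vol where "vol = measure lborel ?B"
  have vol: "vol > 0" unfolding vol_def by (rule unit_ball_measure_pos)
  have one: "(LINT p:?B|lborel. (1::real)) = vol"
    by (simp add: set_lebesgue_integral_def vol_def)
  have i1: "set_integrable lborel ?B (\<lambda>p. 1::real)" "set_integrable lborel ?B norm"
    by (rule set_integrable_bounded_ball[where C = 1]; auto)+
  have "(LINT p|lborel. w p) = (LINT p:?B|lborel. 1 - norm p)"
    unfolding set_lebesgue_integral_def by (intro Bochner_Integration.integral_cong) (auto simp: w_def indicator_def)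
  also have "\<dots> = vol - (LINT p:?B|lborel. norm p)"
    using set_integral_diff(2)[OF i1] one by simp
  finally have "(?m + 1) * (LINT p|lborel. w p) = (?m + 1) * vol - (?m + 1) * (LINT p:?B|lborel. norm p)"
    by (simp only: right_diff_distrib)
  then have "(?m + 1) * (LINT p|lborel. w p) = vol"
    using mom1 one by (simp add: algebra_simps)
  \<comment> \<open>Multiplying by \<open>?m + 1\<close> turns the left side into \<open>?m\<close>
    times the integral of \<open>\<psi>\<close> by \<open>mom\<close>, and the weight on the right
    into the volume. The dimension then matches the factor in \<open>steiner_point\<close>.\<close>
  moreover have "(?m + 1) * (LINT p:?B|lborel. norm p * \<psi> p) \<le> (?m + 1) * (h q * (LINT p|lborel. w p))"
    by (rule mult_left_mono[OF A]) simp
  ultimately have "?m * (LINT p:?B|lborel. \<psi> p) \<le> h q * vol"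
    unfolding mom by (simp add: mult.left_commute)
  moreover have "inner (steiner_point K) q = ?m * ((1 / vol) * (LINT p:?B|lborel. \<psi> p))"
  proof -
    have "set_integrable lborel ?B (\<lambda>p. h (sgn p) *\<^sub>R sgn p)"
      using h_cont by (intro set_integrable_sgn_comp continuous_intros)
    then have "inner (LINT p:?B|lborel. h (sgn p) *\<^sub>R sgn p) q = (LINT p:?B|lborel. \<psi> p)"
      unfolding set_lebesgue_integral_def set_integrable_def \<psi>_def
      by (subst integral_inner_left[symmetric]) (auto simp: mult.commute mult.left_commute)
    then show ?thesis by (simp add: steiner_point_def sphere_avg_sgn vol_def h_def)
  qed
  ultimately have "vol * inner (steiner_point K) q \<le> vol * supp_fun K q"
    using vol by (simp add: h_def field_simps)
  then show ?thesis using vol by simp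
qed

text \<open>If the point were outside, a strictly separating direction \<open>a\<close> would
  contradict \<open>steiner_point_inner_le\<close> for \<open>- a\<close>.\<close>

lemma steiner_point_mem:
  fixes K :: "'b::euclidean_space set"
  assumes "K \<noteq> {}" "compact K" "convex K"
  shows "steiner_point K \<in> K"
proof (rule ccontr)
  assume "steiner_point K \<notin> K"
  then obtain a b where ab: "inner a (steiner_point K) < b" "\<And>y. y \<in> K \<Longrightarrow> b < inner a y"
    using separating_hyperplane_closed_point[of K "steiner_point K"] assms compact_imp_closed by metis
  have "supp_fun K (- a) \<le> - b" by (intro supp_fun_least) (use assms ab(2) in \<open>auto simp: less_imp_le\<close>)
  with steiner_point_inner_le[of K "- a"] assms compact_imp_bounded[of K] ab(1)
  show False by (simp add: inner_commute)
qed

section \<open>Absolutely continuous curves\<close>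

text \<open>Translates absolute continuity, which speaks of numbered intervals, to tagged partial
  divisions. The open intervals are disjoint subsets of \<open>U\<close>, so their total length is
  at most its measure.\<close>

lemma abs_continuous_sum_small:
  fixes x :: "real \<Rightarrow> 'a::euclidean_space"
  assumes ac: "\<And>(N::nat) u v. (\<forall>i<N. a \<le> u i \<and> u i \<le> v i \<and> v i \<le> b) \<Longrightarrow>
        (\<forall>i<N. \<forall>j<N. i \<noteq> j \<longrightarrow> v i \<le> u j \<or> v j \<le> u i) \<Longrightarrow>
        (\<Sum>i<N. v i - u i) < \<delta> \<Longrightarrow> (\<Sum>i<N. norm (x (v i) - x (u i))) < \<epsilon>"
    and D: "D tagged_partial_division_of {a..b}"
    and U: "U \<in> lmeasurable" "measure lebesgue U < \<delta>" and DU: "\<And>t k. (t, k) \<in> D \<Longrightarrow> k \<subseteq> U"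
  shows "(\<Sum>(t, k)\<in>D. norm (x (Sup k) - x (Inf k))) < \<epsilon>"
proof -
  \<comment> \<open>Degenerate intervals contribute nothing to the sum, but a point inside another
    interval would violate the ordering of endpoints that absolute continuity asks for; they are
    removed.\<close>
  define D' where "D' = {(t, k) \<in> D. Inf k < Sup k}"
  have finD: "finite D" using D by (rule tagged_partial_division_ofD(1))
  have D'D: "D' \<subseteq> D" by (auto simp: D'_def)
  have finD': "finite D'" using finD D'D finite_subset by blast
  have k: "k = {Inf k..Sup k}" "Inf k \<le> Sup k" "a \<le> Inf k" "Sup k \<le> b" if tk: "(t, k) \<in> D" for t k
  proof -
    obtain u v where uv: "k = cbox u v" using D tk tagged_partial_division_ofD(4) by blast
    moreover have "t \<in> k" "k \<subseteq> {a..b}" using D tk tagged_partial_division_ofD(2,3) by blast+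
    ultimately have "u \<le> v" "a \<le> u" "v \<le> b" by auto
    then show "k = {Inf k..Sup k}" "Inf k \<le> Sup k" "a \<le> Inf k" "Sup k \<le> b" by (auto simp: uv)
  qed
  define N where "N = card D'"
  obtain e where e: "bij_betw e {..<N} D'"
    using ex_bij_betw_nat_finite[OF finD'] by (auto simp: N_def atLeast0LessThan)
  define u v where "u i = Inf (snd (e i))" and "v i = Sup (snd (e i))" for i
  have eD: "e i \<in> D'" if "i < N" for i using e that by (auto simp: bij_betw_def)
  have uv: "a \<le> u i \<and> u i < v i \<and> v i \<le> b \<and> snd (e i) = {u i..v i}" if "i < N" for i
    using eD[OF that] k[of "fst (e i)" "snd (e i)"] by (auto simp: D'_def u_def v_def)
  have disj: "{u i<..<v i} \<inter> {u j<..<v j} = {}" if "i < N" "j < N" "i \<noteq> j" for i j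
  proof -
    have "e i \<noteq> e j" using e that by (auto simp: bij_betw_def inj_on_def)
    then have "interior (snd (e i)) \<inter> interior (snd (e j)) = {}"
      using tagged_partial_division_ofD(5)[OF D, of "fst (e i)" "snd (e i)" "fst (e j)" "snd (e j)"]
        eD[OF that(1)] eD[OF that(2)] D'D by (metis prod.collapse subsetD)
    then show ?thesis using uv[OF that(1)] uv[OF that(2)] by (simp add: interior_atLeastAtMost_real)
  qed
  have "(\<Sum>i<N. v i - u i) = (\<Sum>i<N. measure lebesgue {u i<..<v i})"
    by (rule sum.cong) (use uv in \<open>auto simp: less_imp_le\<close>)
  also have "\<dots> = measure lebesgue (\<Union>i<N. {u i<..<v i})"
  proof (rule measure_finite_Union[symmetric])
    show "disjoint_family_on (\<lambda>i. {u i<..<v i}) {..<N}"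
      using disj by (auto simp: disjoint_family_on_def)
    show "emeasure lebesgue {u i<..<v i} \<noteq> \<infinity>" if "i \<in> {..<N}" for i
      using uv[of i] that by (simp add: less_imp_le)
  qed auto
  also have "\<dots> \<le> measure lebesgue U"
  proof (rule measure_mono_fmeasurable[OF _ _ U(1)])
    show "(\<Union>i<N. {u i<..<v i}) \<subseteq> U"
    proof safe
      fix i y assume i: "i < N" and "y \<in> {u i<..<v i}"
      then have "y \<in> snd (e i)" using uv[OF i] by auto
      then show "y \<in> U" using DU[of "fst (e i)" "snd (e i)"] eD[OF i] D'D by auto
    qed
  qed auto
  finally have len: "(\<Sum>i<N. v i - u i) < \<delta>" using U(2) by simp
  have "(\<Sum>i<N. norm (x (v i) - x (u i))) < \<epsilon>"
  proof (rule ac[OF _ _ len])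
    show "\<forall>i<N. a \<le> u i \<and> u i \<le> v i \<and> v i \<le> b" using uv by (simp add: less_imp_le)
    show "\<forall>i<N. \<forall>j<N. i \<noteq> j \<longrightarrow> v i \<le> u j \<or> v j \<le> u i"
    proof (intro allI impI)
      fix i j assume ij: "i < N" "j < N" "i \<noteq> j"
      show "v i \<le> u j \<or> v j \<le> u i"
      proof (rule ccontr)
        assume n: "\<not> ?thesis"
        have "max (u i) (u j) < min (v i) (v j)" using n uv[OF ij(1)] uv[OF ij(2)] by auto
        then obtain m where "max (u i) (u j) < m" "m < min (v i) (v j)" using dense by blast
        then have "m \<in> {u i<..<v i} \<inter> {u j<..<v j}" by auto
        then show False using disj[OF ij] by blast
      qed
    qed
  qed
  also have "(\<Sum>i<N. norm (x (v i) - x (u i))) = (\<Sum>z\<in>D'. norm (x (Sup (snd z)) - x (Inf (snd z))))"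
    unfolding u_def v_def by (rule sum.reindex_bij_betw[OF e])
  also have "\<dots> = (\<Sum>z\<in>D. norm (x (Sup (snd z)) - x (Inf (snd z))))"
  proof (rule sum.mono_neutral_left[OF finD D'D])
    show "\<forall>z\<in>D - D'. norm (x (Sup (snd z)) - x (Inf (snd z))) = 0"
      using k(2) by (force simp: D'_def)
  qed
  finally show ?thesis by (simp add: case_prod_unfold)
qed

text \<open>The fundamental theorem is proved by choosing a gauge. At tags in the exceptional null
  set the gauge is an open set of small measure, on which absolute continuity controls the
  increments; at other tags differentiability controls the error. Integrability of \<open>F\<close>
  comes out as part of the conclusion.\<close>

lemma abs_continuous_has_integral:
  fixes x :: "real \<Rightarrow> 'a::euclidean_space"
  assumes ab: "a \<le> b" and ac: "abs_continuous_on a b x"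
    and ae: "AE t in lborel. t \<in> {a..b} \<longrightarrow> (x has_vector_derivative F t) (at t within {a..b})"
  shows "(F has_integral x b - x a) {a..b}"
proof -
  obtain N where N: "N \<in> null_sets lborel"
    "\<And>t. t \<notin> N \<Longrightarrow> t \<in> {a..b} \<Longrightarrow> (x has_vector_derivative F t) (at t within {a..b})"
    using ae by (auto elim!: AE_E3)
  have negN: "negligible N" using N(1) by (simp add: negligible_iff_null_sets null_sets_completionI)
  \<comment> \<open>With value 0 on \<open>N\<close>, a tag in \<open>N\<close> contributes only the
    increment of \<open>x\<close>.\<close>
  define G where "G t = (if t \<in> N then 0 else F t)" for t
  have "(G has_integral x b - x a) {a..b}"
    unfolding has_integral_real
  proof (intro allI impI)
    fix e :: real assume e: "e > 0"
    \<comment> \<open>The derivative errors add up to \<open>\<eta> * (b - a)\<close>; the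
      \<open>+ 1\<close> allows \<open>a = b\<close> and makes the bound by \<open>e / 2\<close>
      strict.\<close>
    define \<eta> where "\<eta> = e / (2 * (b - a + 1))"
    have \<eta>: "\<eta> > 0" "\<eta> * (b - a) < e / 2" using e ab by (auto simp: \<eta>_def field_simps)
    obtain \<delta> where \<delta>: "\<delta> > 0" "\<And>(n::nat) u v. (\<forall>i<n. a \<le> u i \<and> u i \<le> v i \<and> v i \<le> b) \<Longrightarrow>
        (\<forall>i<n. \<forall>j<n. i \<noteq> j \<longrightarrow> v i \<le> u j \<or> v j \<le> u i) \<Longrightarrow>
        (\<Sum>i<n. v i - u i) < \<delta> \<Longrightarrow> (\<Sum>i<n. norm (x (v i) - x (u i))) < e / 2"
      using ac[unfolded abs_continuous_on_def, rule_format, OF half_gt_zero[OF e]] by blast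
    obtain U where U: "open U" "N \<subseteq> U" "U \<in> lmeasurable" "measure lebesgue U < \<delta>"
    proof -
      have "N \<in> sets lebesgue" using N(1) by auto
      then obtain U where U: "open U" "N \<subseteq> U" "U - N \<in> lmeasurable" "emeasure lebesgue (U - N) < ennreal \<delta>"
        using sets_lebesgue_outer_open[of N \<delta>] \<delta>(1) by blast
      have Nn: "N \<in> null_sets lebesgue" using N(1) by (rule null_sets_completionI)
      have un: "U = N \<union> (U - N)" using U(2) by blast
      have "emeasure lebesgue U = emeasure lebesgue (U - N)"
        using emeasure_Un_null_set[of "U - N" lebesgue N] Nn U(3) un by (metis Un_commute fmeasurableD)
      then have m: "emeasure lebesgue U < ennreal \<delta>" using U(4) by simp
      have "U \<in> sets lebesgue" using U(1) by (auto intro: borel_open)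
      with m have lm: "U \<in> lmeasurable" by (intro fmeasurableI) (auto simp: less_top intro: order.strict_trans)
      then have "measure lebesgue U < \<delta>" using m by (simp add: emeasure_eq_measure2 ennreal_less_iff)
      with U lm that show ?thesis by blast
    qed
    have "\<exists>d>0. \<forall>y\<in>{a..b}. norm (y - t) < d \<longrightarrow> norm (x y - x t - (y - t) *\<^sub>R F t) \<le> \<eta> * norm (y - t)"
      if "t \<notin> N" "t \<in> {a..b}" for t
      using N(2)[OF that] \<eta>(1) unfolding has_vector_derivative_def has_derivative_within_alt by blast
    then have "\<forall>t. \<exists>d. t \<notin> N \<longrightarrow> t \<in> {a..b} \<longrightarrow> d > 0 \<and> (\<forall>y\<in>{a..b}. norm (y - t) < d
        \<longrightarrow> norm (x y - x t - (y - t) *\<^sub>R F t) \<le> \<eta> * norm (y - t))" by blast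
    from choice[OF this] obtain d where d: "\<And>t. t \<notin> N \<Longrightarrow> t \<in> {a..b} \<Longrightarrow> d t > 0"
      "\<And>t y. t \<notin> N \<Longrightarrow> t \<in> {a..b} \<Longrightarrow> y \<in> {a..b} \<Longrightarrow> norm (y - t) < d t
         \<Longrightarrow> norm (x y - x t - (y - t) *\<^sub>R F t) \<le> \<eta> * norm (y - t)"
      by blast
    define \<gamma> where "\<gamma> t = (if t \<in> N then U else ball t (if t \<in> {a..b} then d t else 1))" for t
    have gauge: "gauge \<gamma>" unfolding gauge_def \<gamma>_def using U d(1) by auto
    have small: "norm ((\<Sum>(t, k)\<in>D. measure lborel k *\<^sub>R G t) - (x b - x a)) < e"
      if D: "D tagged_division_of {a..b}" and fine: "\<gamma> fine D" for D
    proof -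
      have finD: "finite D" using D by auto
      define r where "r z = norm (measure lborel (snd z) *\<^sub>R G (fst z) - (x (Sup (snd z)) - x (Inf (snd z))))" for z
      define D1 where "D1 = {z\<in>D. fst z \<in> N}"
      define D2 where "D2 = {z\<in>D. fst z \<notin> N}"
      have "(\<Sum>(t, k)\<in>D. measure lborel k *\<^sub>R G t) - (x b - x a)
          = (\<Sum>z\<in>D. measure lborel (snd z) *\<^sub>R G (fst z) - (x (Sup (snd z)) - x (Inf (snd z))))"
        using additive_tagged_division_1[OF ab D, of x] by (simp add: sum_subtractf case_prod_unfold)
      also have "norm \<dots> \<le> (\<Sum>z\<in>D. r z)" unfolding r_def by (rule norm_sum)
      also have "\<dots> = (\<Sum>z\<in>D1. r z) + (\<Sum>z\<in>D2. r z)"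
        unfolding D1_def D2_def using finD by (subst sum.union_disjoint[symmetric]) (auto intro: sum.cong)
      also have "(\<Sum>z\<in>D1. r z) < e / 2"
      proof -
        have D1: "D1 tagged_partial_division_of {a..b}"
          by (rule tagged_partial_division_subset[of D]) (use D in \<open>auto simp: tagged_division_of_def D1_def\<close>)
        have "(\<Sum>(t, k)\<in>D1. norm (x (Sup k) - x (Inf k))) < e / 2"
        proof (rule abs_continuous_sum_small[OF _ D1 U(3,4)])
          show "(\<Sum>i<n. norm (x (v i) - x (u i))) < e / 2"
            if "\<forall>i<n. a \<le> u i \<and> u i \<le> v i \<and> v i \<le> b"
              "\<forall>i<n. \<forall>j<n. i \<noteq> j \<longrightarrow> v i \<le> u j \<or> v j \<le> u i" "(\<Sum>i<n. v i - u i) < \<delta>"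
            for n :: nat and u v by (rule \<delta>(2)[OF that])
          show "k \<subseteq> U" if "(t, k) \<in> D1" for t k
            using fineD[OF fine, of t k] that by (simp add: D1_def \<gamma>_def)
        qed
        also have "(\<Sum>(t, k)\<in>D1. norm (x (Sup k) - x (Inf k))) = (\<Sum>z\<in>D1. r z)"
          by (rule sum.cong) (auto simp: D1_def r_def G_def norm_minus_commute)
        finally show ?thesis .
      qed
      also have "(\<Sum>z\<in>D2. r z) \<le> (\<Sum>z\<in>D2. \<eta> * measure lborel (snd z))"
      proof (rule sum_mono)
        fix z assume z: "z \<in> D2"
        obtain t k where zt: "z = (t, k)" by fastforce
        have tk: "(t, k) \<in> D" "t \<notin> N" using z by (auto simp: D2_def zt)
        obtain u v where uv: "k = cbox u v" using D tk tagged_division_ofD(4) by blast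
        have t: "t \<in> k" "k \<subseteq> {a..b}" using D tk tagged_division_ofD(2,3) by blast+
        then have t': "t \<in> {a..b}" "u \<le> t" "t \<le> v" by (auto simp: uv)
        then have uvab: "u \<in> {a..b}" "v \<in> {a..b}" using t by (auto simp: uv)
        have "k \<subseteq> ball t (d t)" using fineD[OF fine tk(1)] tk(2) t'(1) by (simp add: \<gamma>_def)
        moreover have "u \<in> k" "v \<in> k" using t' by (auto simp: uv)
        ultimately have "norm (u - t) < d t" "norm (v - t) < d t"
          by (auto simp: subset_iff dist_norm norm_minus_commute)
        then have b: "norm (x u - x t - (u - t) *\<^sub>R F t) \<le> \<eta> * (t - u)"
          "norm (x v - x t - (v - t) *\<^sub>R F t) \<le> \<eta> * (v - t)"
          using d(2)[OF tk(2) t'(1) uvab(1)] d(2)[OF tk(2) t'(1) uvab(2)] t' by auto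
        \<comment> \<open>The tag lies between the endpoints, so the errors at the two endpoints add
          up to exactly \<open>\<eta> * (v - u)\<close>.\<close>
        have "(v - u) *\<^sub>R F t - (x v - x u)
            = (x u - x t - (u - t) *\<^sub>R F t) - (x v - x t - (v - t) *\<^sub>R F t)" by (simp add: algebra_simps)
        then have "norm ((v - u) *\<^sub>R F t - (x v - x u)) \<le> \<eta> * (t - u) + \<eta> * (v - t)"
          using norm_triangle_ineq4 b by (smt (verit))
        then show "r z \<le> \<eta> * measure lborel (snd z)"
          using t' tk by (simp add: r_def zt uv G_def algebra_simps)
      qed
      also have "\<dots> \<le> (\<Sum>z\<in>D. \<eta> * measure lborel (snd z))"
        using finD \<eta>(1) by (intro sum_mono2) (auto simp: D2_def)
      also have "\<dots> = \<eta> * (b - a)"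
        using additive_content_tagged_division[of D a b] D ab
        by (simp add: sum_distrib_left[symmetric] case_prod_unfold)
      finally show ?thesis using \<eta>(2) by linarith
    qed
    show "\<exists>\<gamma>. gauge \<gamma> \<and> (\<forall>D. D tagged_division_of {a..b} \<and> \<gamma> fine D \<longrightarrow>
        norm ((\<Sum>(t, k)\<in>D. measure lborel k *\<^sub>R G t) - (x b - x a)) < e)"
      by (intro exI[of _ \<gamma>] conjI allI impI gauge) (elim conjE, rule small)
  qed
  then show ?thesis by (rule has_integral_spike[OF negN, rotated]) (simp add: G_def)
qed

lemma abs_continuous_subinterval:
  assumes "abs_continuous_on a b x" "a \<le> a'" "b' \<le> b"
  shows "abs_continuous_on a' b' x"
  unfolding abs_continuous_on_def
proof (intro allI impI)
  fix e :: real assume e: "e > 0"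
  obtain \<delta> where \<delta>: "\<delta> > 0" "\<And>(N::nat) u v. (\<forall>i<N. a \<le> u i \<and> u i \<le> v i \<and> v i \<le> b) \<Longrightarrow>
        (\<forall>i<N. \<forall>j<N. i \<noteq> j \<longrightarrow> v i \<le> u j \<or> v j \<le> u i) \<Longrightarrow>
        (\<Sum>i<N. v i - u i) < \<delta> \<Longrightarrow> (\<Sum>i<N. norm (x (v i) - x (u i))) < e"
    using assms(1)[unfolded abs_continuous_on_def, rule_format, OF e] by blast
  have "(\<Sum>i<N. norm (x (v i) - x (u i))) < e"
    if "\<forall>i<N. a' \<le> u i \<and> u i \<le> v i \<and> v i \<le> b'" "\<forall>i<N. \<forall>j<N. i \<noteq> j \<longrightarrow> v i \<le> u j \<or> v j \<le> u i"
      "(\<Sum>i<N. v i - u i) < \<delta>" for N :: nat and u v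
    by (rule \<delta>(2)[OF _ that(2,3)]) (use that(1) assms(2,3) in fastforce)
  with \<delta>(1) show "\<exists>\<delta>>0. \<forall>(N::nat) u v. (\<forall>i<N. a' \<le> u i \<and> u i \<le> v i \<and> v i \<le> b') \<and>
        (\<forall>i<N. \<forall>j<N. i \<noteq> j \<longrightarrow> v i \<le> u j \<or> v j \<le> u i) \<and>
        (\<Sum>i<N. v i - u i) < \<delta> \<longrightarrow> (\<Sum>i<N. norm (x (v i) - x (u i))) < e"
    by blast
qed

lemma abs_continuous_diff:
  fixes x y :: "real \<Rightarrow> 'a::real_normed_vector"
  assumes "abs_continuous_on a b x" "abs_continuous_on a b y"
  shows "abs_continuous_on a b (\<lambda>t. x t - y t)"
  unfolding abs_continuous_on_def
proof (intro allI impI)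
  fix e :: real assume e: "e > 0"
  let ?P = "\<lambda>N u v \<delta>. (\<forall>i<N. a \<le> u i \<and> u i \<le> v i \<and> v i \<le> b) \<and>
    (\<forall>i<N. \<forall>j<N. i \<noteq> j \<longrightarrow> v i \<le> u j \<or> v j \<le> u i) \<and> (\<Sum>i<N. v i - u i) < (\<delta>::real)"
  obtain \<delta>1 where 1: "\<delta>1 > 0" "\<And>(N::nat) u v. ?P N u v \<delta>1 \<Longrightarrow> (\<Sum>i<N. norm (x (v i) - x (u i))) < e / 2"
    using assms(1)[unfolded abs_continuous_on_def, rule_format, OF half_gt_zero[OF e]] by blast
  obtain \<delta>2 where 2: "\<delta>2 > 0" "\<And>(N::nat) u v. ?P N u v \<delta>2 \<Longrightarrow> (\<Sum>i<N. norm (y (v i) - y (u i))) < e / 2"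
    using assms(2)[unfolded abs_continuous_on_def, rule_format, OF half_gt_zero[OF e]] by blast
  have "(\<Sum>i<N. norm (x (v i) - y (v i) - (x (u i) - y (u i)))) < e" if "?P N u v (min \<delta>1 \<delta>2)" for N :: nat and u v
  proof -
    have "(\<Sum>i<N. norm (x (v i) - y (v i) - (x (u i) - y (u i))))
        \<le> (\<Sum>i<N. norm (x (v i) - x (u i)) + norm (y (v i) - y (u i)))"
    proof (rule sum_mono)
      fix i
      have "x (v i) - y (v i) - (x (u i) - y (u i)) = (x (v i) - x (u i)) - (y (v i) - y (u i))" by simp
      then show "norm (x (v i) - y (v i) - (x (u i) - y (u i))) \<le> norm (x (v i) - x (u i)) + norm (y (v i) - y (u i))"
        using norm_triangle_ineq4 by metis
    qed
    also have "\<dots> < e / 2 + e / 2"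
      unfolding sum.distrib using that by (intro add_strict_mono 1(2) 2(2)) auto
    finally show ?thesis by simp
  qed
  then show "\<exists>\<delta>>0. \<forall>(N::nat) u v. ?P N u v \<delta> \<longrightarrow> (\<Sum>i<N. norm (x (v i) - y (v i) - (x (u i) - y (u i)))) < e"
    using 1(1) 2(1) by (intro exI[of _ "min \<delta>1 \<delta>2"]) auto
qed

lemma abs_continuous_on_imp_continuous_on:
  assumes "abs_continuous_on a b x"
  shows "continuous_on {a..b} x"
  unfolding continuous_on_iff
proof (intro ballI allI impI)
  fix t e assume t: "t \<in> {a..b}" and e: "(0::real) < e"
  obtain \<delta> where \<delta>: "\<delta> > 0" "\<And>(N::nat) u v. (\<forall>i<N. a \<le> u i \<and> u i \<le> v i \<and> v i \<le> b) \<Longrightarrow>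
        (\<forall>i<N. \<forall>j<N. i \<noteq> j \<longrightarrow> v i \<le> u j \<or> v j \<le> u i) \<Longrightarrow>
        (\<Sum>i<N. v i - u i) < \<delta> \<Longrightarrow> (\<Sum>i<N. norm (x (v i) - x (u i))) < e"
    using assms[unfolded abs_continuous_on_def, rule_format, OF e] by blast
  have "dist (x s) (x t) < e" if s: "s \<in> {a..b}" "dist s t < \<delta>" for s
  proof (cases "s \<le> t")
    case True
    with \<delta>(2)[of 1 "\<lambda>_. s" "\<lambda>_. t"] s t show ?thesis by (simp add: dist_norm norm_minus_commute)
  next
    case False
    with \<delta>(2)[of 1 "\<lambda>_. t" "\<lambda>_. s"] s t show ?thesis by (simp add: dist_norm)
  qed
  then show "\<exists>d>0. \<forall>s\<in>{a..b}. dist s t < d \<longrightarrow> dist (x s) (x t) < e" using \<delta>(1) by blast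
qed

lemma lipschitz_imp_abs_continuous:
  assumes "\<And>s t. s \<in> {a..b} \<Longrightarrow> t \<in> {a..b} \<Longrightarrow> norm (x s - x t) \<le> L * \<bar>s - t\<bar>" "0 \<le> L"
  shows "abs_continuous_on a b x"
  unfolding abs_continuous_on_def
proof (intro allI impI)
  fix e :: real assume e: "e > 0"
  have "(\<Sum>i<N. norm (x (v i) - x (u i))) < e"
    if h: "\<forall>i<N. a \<le> u i \<and> u i \<le> v i \<and> v i \<le> b" "(\<Sum>i<N. v i - u i) < e / (L + 1)" for N :: nat and u v
  proof -
    \<comment> \<open>The factor \<open>L + 1\<close> keeps the quotient \<open>e / (L + 1)\<close>
      meaningful when \<open>L = 0\<close>.\<close>
    have "(\<Sum>i<N. norm (x (v i) - x (u i))) \<le> (\<Sum>i<N. (L + 1) * (v i - u i))"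
    proof (rule sum_mono)
      fix i assume "i \<in> {..<N}"
      with h have i: "a \<le> u i" "u i \<le> v i" "v i \<le> b" by auto
      then have "norm (x (v i) - x (u i)) \<le> L * (v i - u i)" using assms(1)[of "v i" "u i"] by auto
      also have "\<dots> \<le> (L + 1) * (v i - u i)" using i by (intro mult_right_mono) auto
      finally show "norm (x (v i) - x (u i)) \<le> (L + 1) * (v i - u i)" .
    qed
    also have "\<dots> < e" using h(2) assms(2) by (simp add: sum_distrib_left[symmetric] pos_less_divide_eq mult.commute)
    finally show ?thesis .
  qed
  then show "\<exists>\<delta>>0. \<forall>(N::nat) u v. (\<forall>i<N. a \<le> u i \<and> u i \<le> v i \<and> v i \<le> b) \<and>
        (\<forall>i<N. \<forall>j<N. i \<noteq> j \<longrightarrow> v i \<le> u j \<or> v j \<le> u i) \<and>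
        (\<Sum>i<N. v i - u i) < \<delta> \<longrightarrow> (\<Sum>i<N. norm (x (v i) - x (u i))) < e"
    using e assms(2) by (intro exI[of _ "e / (L + 1)"]) auto
qed

section \<open>Gronwall estimates and the state equation\<close>

text \<open>With the integrating factor, \<open>exp (- K * (t - a))\<close> times the right-hand
  side of the assumed bound has a derivative that is nowhere positive; the mean value theorem makes
  it at most its initial value \<open>A\<close>.\<close>

lemma gronwall_integral:
  fixes u :: "real \<Rightarrow> real"
  assumes cont: "continuous_on {a..b} u" and K: "0 < K" and t: "t \<in> {a..b}"
    and le: "\<And>t. t \<in> {a..b} \<Longrightarrow> u t \<le> A + K * integral {a..t} u"
  shows "u t \<le> A * exp (K * (t - a))"
proof -
  define I where "I t = A + K * integral {a..t} u" for t
  define U where "U t = exp (- K * (t - a)) * I t" for t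
  have dI: "(I has_real_derivative K * u s) (at s within {a..t})" if "s \<in> {a..t}" for s
    unfolding I_def
    using integral_has_vector_derivative[of a t u s] that continuous_on_subset[OF cont] t
    by (auto simp: has_real_derivative_iff_has_vector_derivative[symmetric] intro!: derivative_eq_intros)
  have dU: "(U has_real_derivative exp (- K * (s - a)) * K * (u s - I s)) (at s within {a..t})" if "s \<in> {a..t}" for s
    unfolding U_def
    by (rule derivative_eq_intros dI[OF that] refl)+ (simp add: algebra_simps)
  have at: "a \<le> t" using t by simp
  have "\<exists>s\<in>{a..t}. U t - U a = exp (- K * (s - a)) * K * (u s - I s) * (t - a)"
    by (rule mvt_very_simple[OF at]) (use dU in \<open>auto simp: has_field_derivative_def\<close>)
  then obtain s where s: "s \<in> {a..t}" "U t - U a = exp (- K * (s - a)) * K * (u s - I s) * (t - a)" by blast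
  have "u s - I s \<le> 0" using le[of s] s t by (simp add: I_def)
  then have "U t - U a \<le> 0" unfolding s(2) using K at by (simp add: mult_nonneg_nonpos mult_nonpos_nonneg)
  then have "exp (- K * (t - a)) * I t \<le> A" by (simp add: U_def I_def)
  then have "exp (K * (t - a)) * (exp (- K * (t - a)) * I t) \<le> exp (K * (t - a)) * A"
    by (rule mult_left_mono) simp
  moreover have "exp (K * (t - a)) * (exp (- K * (t - a)) * I t) = I t"
    by (simp add: mult.assoc[symmetric] exp_add[symmetric])
  ultimately have "I t \<le> exp (K * (t - a)) * A" by (simp only:)
  then have "I t \<le> A * exp (K * (t - a))" by (simp only: mult.commute)
  then show ?thesis using le[OF t] by (simp add: I_def)
qed

text \<open>The bound on \<open>F\<close> holds almost everywhere, but the integral estimate wants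
  it at every point. Overwriting \<open>F\<close> by 0 on the null set changes no integral, and
  \<open>0 \<le> \<psi>\<close> keeps the bound there.\<close>

lemma abs_continuous_norm_le:
  fixes x :: "real \<Rightarrow> 'a::euclidean_space"
  assumes ac: "abs_continuous_on a b x" and ab: "a \<le> b"
    and ae: "AE t in lborel. t \<in> {a..b} \<longrightarrow> (x has_vector_derivative F t) (at t within {a..b})"
    and F: "AE t in lborel. t \<in> {a..b} \<longrightarrow> norm (F t) \<le> \<psi> t"
    and \<psi>: "\<psi> integrable_on {a..b}" "\<And>t. t \<in> {a..b} \<Longrightarrow> 0 \<le> \<psi> t"
  shows "norm (x b - x a) \<le> integral {a..b} \<psi>"
proof -
  obtain N where N: "N \<in> null_sets lborel" "\<And>t. t \<notin> N \<Longrightarrow> t \<in> {a..b} \<Longrightarrow> norm (F t) \<le> \<psi> t"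
    using F by (auto elim!: AE_E3)
  have negN: "negligible N" using N(1) by (simp add: negligible_iff_null_sets null_sets_completionI)
  define G where "G t = (if t \<in> N then 0 else F t)" for t
  have hG: "(G has_integral x b - x a) {a..b}"
    by (rule has_integral_spike[OF negN _ abs_continuous_has_integral[OF ab ac ae]]) (simp add: G_def)
  have "norm (integral {a..b} G) \<le> integral {a..b} \<psi>"
  proof (rule integral_norm_bound_integral[OF _ \<psi>(1)])
    show "G integrable_on {a..b}" using hG by blast
    show "norm (G t) \<le> \<psi> t" if "t \<in> {a..b}" for t
      using N(2)[of t] \<psi>(2)[of t] that by (auto simp: G_def)
  qed
  then show ?thesis using integral_unique[OF hG] by simp
qed

lemma AE_derivative_subinterval:
  assumes "AE t in lborel. t \<in> {a..b} \<longrightarrow> (x has_vector_derivative F t) (at t within {a..b})" "a \<le> a'" "b' \<le> b"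
  shows "AE t in lborel. t \<in> {a'..b'} \<longrightarrow> (x has_vector_derivative F t) (at t within {a'..b'})"
  using assms(1) by eventually_elim (use assms(2,3) in \<open>auto intro: has_vector_derivative_within_subset\<close>)

text \<open>The norm of \<open>x\<close> is never differentiated: the increment of \<open>x\<close>
  is bounded on each \<open>{a..s}\<close>, and enlarging the integral of \<open>\<psi>\<close> to
  \<open>{a..b}\<close> gives the constant that the integral form of the inequality needs.\<close>

lemma abs_continuous_gronwall:
  fixes x :: "real \<Rightarrow> 'a::euclidean_space"
  assumes ac: "abs_continuous_on a b x" and K: "0 < K" and t: "t \<in> {a..b}"
    and ae: "AE t in lborel. t \<in> {a..b} \<longrightarrow> (x has_vector_derivative F t) (at t within {a..b})"
    and F: "AE t in lborel. t \<in> {a..b} \<longrightarrow> norm (F t) \<le> K * norm (x t) + \<psi> t"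
    and \<psi>: "\<psi> integrable_on {a..b}" "\<And>t. t \<in> {a..b} \<Longrightarrow> 0 \<le> \<psi> t"
  shows "norm (x t) \<le> (norm (x a) + integral {a..b} \<psi>) * exp (K * (t - a))"
proof (rule gronwall_integral[OF _ K t])
  have cont: "continuous_on {a..b} x" by (rule abs_continuous_on_imp_continuous_on[OF ac])
  then show "continuous_on {a..b} (\<lambda>t. norm (x t))" by (intro continuous_intros)
  fix s assume s: "s \<in> {a..b}"
  have as: "a \<le> s" "s \<le> b" using s by auto
  have nx: "(\<lambda>t. norm (x t)) integrable_on {a..s}"
    using as by (intro integrable_continuous_real continuous_intros continuous_on_subset[OF cont]) auto
  have \<psi>s: "\<psi> integrable_on {a..s}" using integrable_on_subinterval[OF \<psi>(1)] as by auto
  have "norm (x s - x a) \<le> integral {a..s} (\<lambda>t. K * norm (x t) + \<psi> t)"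
  proof (rule abs_continuous_norm_le[where F = F])
    show "abs_continuous_on a s x" by (rule abs_continuous_subinterval[OF ac]) (use as in auto)
    show "AE t in lborel. t \<in> {a..s} \<longrightarrow> (x has_vector_derivative F t) (at t within {a..s})"
      by (rule AE_derivative_subinterval[OF ae]) (use as in auto)
    show "AE t in lborel. t \<in> {a..s} \<longrightarrow> norm (F t) \<le> K * norm (x t) + \<psi> t"
      using F by eventually_elim (use as in auto)
    show "(\<lambda>t. K * norm (x t) + \<psi> t) integrable_on {a..s}"
      using nx \<psi>s by (intro integrable_add integrable_on_mult_right)
  qed (use as K \<psi>(2) in auto)
  also have "\<dots> = K * integral {a..s} (\<lambda>t. norm (x t)) + integral {a..s} \<psi>"
    using nx \<psi>s by (simp add: integral_add integrable_on_mult_right)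
  also have "integral {a..s} \<psi> \<le> integral {a..b} \<psi>"
    using as \<psi> \<psi>s by (intro integral_subset_le) auto
  finally show "norm (x s) \<le> norm (x a) + integral {a..b} \<psi> + K * integral {a..s} (\<lambda>t. norm (x t))"
    using norm_triangle_ineq2[of "x s" "x a"] by linarith
qed

text \<open>A measurable function is an almost everywhere limit of continuous ones. Projecting these
  onto the ball of radius \<open>c\<close> keeps them continuous and leaves the limit unchanged,
  since \<open>f\<close> already lies in the ball; it also supplies the dominating constant.\<close>

lemma L1_approx_bounded:
  fixes f :: "real \<Rightarrow> 'b::euclidean_space"
  assumes f: "f \<in> borel_measurable lborel" "\<And>t. norm (f t) \<le> c" and e: "0 < \<epsilon>"
  obtains g where "continuous_on UNIV g" "(LINT t:{lo..hi}|lborel. norm (f t - g t)) < \<epsilon>"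
proof -
  have c: "0 \<le> c" using f(2)[of 0] norm_ge_zero order_trans by blast
  have "f \<in> borel_measurable lebesgue" using f(1) by (simp add: measurable_completion)
  then have "f measurable_on UNIV" by (intro lebesgue_measurable_imp_measurable_on) auto
  then obtain N g where g: "negligible N" "\<And>n::nat. continuous_on UNIV (g n)" "\<And>x. x \<notin> N \<Longrightarrow> (\<lambda>n. g n x) \<longlonglongrightarrow> f x"
    unfolding measurable_on_def by auto
  define h where "h n = (\<lambda>t. closest_point (cball 0 c) (g n t))" for n
  have ne: "cball (0::'b) c \<noteq> {}" using c by simp
  have cp: "continuous_on S (closest_point (cball (0::'b) c))" for S
    using ne by (intro continuous_on_closest_point) auto
  have h_cont: "continuous_on UNIV (h n)" for n
    unfolding h_def using continuous_on_compose[OF g(2)[of n] cp] by (simp add: o_def)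
  have h_bd: "norm (h n t) \<le> c" for n t
    using closest_point_in_set[OF _ ne, of "g n t"] by (simp add: h_def)
  have h_lim: "(\<lambda>n. h n t) \<longlonglongrightarrow> f t" if "t \<notin> N" for t
  proof -
    have "(\<lambda>n. closest_point (cball 0 c) (g n t)) \<longlonglongrightarrow> closest_point (cball 0 c) (f t)"
      by (rule continuous_on_tendsto_compose[OF cp[of UNIV] g(3)[OF that]]) auto
    moreover have "closest_point (cball 0 c) (f t) = f t" using f(2) by (intro closest_point_self) auto
    ultimately show ?thesis by (simp add: h_def)
  qed
  have "(\<lambda>n. LINT t|lborel. indicator {lo..hi} t *\<^sub>R norm (f t - h n t)) \<longlonglongrightarrow> (LINT t|(lborel::real measure). 0)"
  proof (rule integral_dominated_convergence[where w = "\<lambda>t. indicator {lo..hi} t *\<^sub>R (2 * c)"])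
    show "integrable lborel (\<lambda>t. indicator {lo..hi} t *\<^sub>R (2 * c))"
      by (intro integrable_scaleR_left integrable_real_indicator) (auto simp: emeasure_lborel_Icc_eq)
    have "AE t in lebesgue. t \<notin> N" using g(1) by (intro AE_not_in) (simp add: negligible_iff_null_sets)
    then have "AE t in lborel. t \<notin> N" by (simp add: AE_completion_iff)
    then show "AE t in lborel. (\<lambda>n. indicator {lo..hi} t *\<^sub>R norm (f t - h n t)) \<longlonglongrightarrow> 0"
    proof eventually_elim
      case (elim t)
      have "(\<lambda>n. indicator {lo..hi} t *\<^sub>R norm (f t - h n t)) \<longlonglongrightarrow> indicator {lo..hi} t *\<^sub>R norm (f t - f t)"
        by (intro tendsto_intros h_lim elim)
      then show ?case by simp
    qed
    have "norm (f t - h n t) \<le> 2 * c" for n t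
      using norm_triangle_ineq4[of "f t" "h n t"] f(2)[of t] h_bd[of n t] by linarith
    then show "AE t in lborel. norm (indicat_real {lo..hi} t *\<^sub>R norm (f t - h n t)) \<le> indicat_real {lo..hi} t *\<^sub>R (2 * c)" for n
      by (intro AE_I2) (auto simp: indicator_def)
    have "h n \<in> borel_measurable borel" for n using h_cont by (rule borel_measurable_continuous_onI)
    then show "(\<lambda>t. indicat_real {lo..hi} t *\<^sub>R norm (f t - h n t)) \<in> borel_measurable lborel" for n
      using f(1) by (intro borel_measurable_scaleR borel_measurable_indicator borel_measurable_norm borel_measurable_diff) auto
  qed simp
  then have "(\<lambda>n. LINT t:{lo..hi}|lborel. norm (f t - h n t)) \<longlonglongrightarrow> 0"
    by (simp add: set_lebesgue_integral_def)
  then have "\<forall>\<^sub>F n in sequentially. (LINT t:{lo..hi}|lborel. norm (f t - h n t)) < \<epsilon>"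
    using e by (rule order_tendstoD(2))
  then obtain n where "(LINT t:{lo..hi}|lborel. norm (f t - h n t)) < \<epsilon>"
    by (auto simp: eventually_sequentially)
  with h_cont that show ?thesis by blast
qed

lemma set_integrable_continuous_real:
  fixes g :: "real \<Rightarrow> 'b::euclidean_space"
  shows "continuous_on {lo..hi} g \<Longrightarrow> set_integrable lborel {lo..hi} g"
  unfolding set_integrable_def by (rule borel_integrable_compact) auto

text \<open>Cutting off where the norm exceeds \<open>n\<close> converges in \<open>L^1\<close>,
  with the norm itself as dominating function; the bounded case then applies to the cut-off
  function.\<close>

lemma L1_approx_continuous:
  fixes f :: "real \<Rightarrow> 'b::euclidean_space"
  assumes f: "set_integrable lborel {lo..hi} f" and e: "0 < \<epsilon>"
  obtains g where "continuous_on UNIV g" "(LINT t:{lo..hi}|lborel. norm (f t - g t)) < \<epsilon>"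
proof -
  define F where "F t = indicator {lo..hi} t *\<^sub>R f t" for t
  have F: "integrable lborel F" using f by (simp add: F_def[abs_def] set_integrable_def)
  then have Fm: "F \<in> borel_measurable lborel" by auto
  define G where "G n t = (if norm (F t) \<le> real n then F t else 0)" for n t
  have Gm: "G n \<in> borel_measurable lborel" for n
    unfolding G_def using Fm by (intro measurable_If) auto
  have "(\<lambda>n. LINT t|lborel. norm (F t - G n t)) \<longlonglongrightarrow> (LINT t|(lborel::real measure). 0)"
  proof (rule integral_dominated_convergence[where w = "\<lambda>t. norm (F t)"])
    show "AE t in lborel. (\<lambda>n. norm (F t - G n t)) \<longlonglongrightarrow> 0"
    proof (rule AE_I2)
      fix t
      obtain n0 where n0: "norm (F t) \<le> real n0" using real_arch_simple by blast
      have "\<forall>\<^sub>F n in sequentially. norm (F t - G n t) = 0"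
        using eventually_ge_at_top[of n0] by eventually_elim (use n0 in \<open>auto simp: G_def\<close>)
      then show "(\<lambda>n. norm (F t - G n t)) \<longlonglongrightarrow> 0" by (rule tendsto_eventually)
    qed
  qed (use F Fm Gm in \<open>auto simp: G_def\<close>)
  then have "\<forall>\<^sub>F n in sequentially. (LINT t|lborel. norm (F t - G n t)) < \<epsilon> / 2"
    using e by (intro order_tendstoD(2)[where y = 0]) auto
  then obtain n where n: "(LINT t|lborel. norm (F t - G n t)) < \<epsilon> / 2"
    by (auto simp: eventually_sequentially)
  have "norm (G n t) \<le> real n" for t by (simp add: G_def)
  then obtain g where g: "continuous_on UNIV g" "(LINT t:{lo..hi}|lborel. norm (G n t - g t)) < \<epsilon> / 2"
    using L1_approx_bounded[OF Gm, of n n "\<epsilon> / 2" lo hi] e by auto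
  have gi: "set_integrable lborel {lo..hi} g"
    by (intro set_integrable_continuous_real continuous_on_subset[OF g(1)]) auto
  have Gi: "integrable lborel (G n)"
    by (rule Bochner_Integration.integrable_bound[OF F Gm]) (auto simp: G_def)
  have Gs: "set_integrable lborel {lo..hi} (G n)"
    using Gi unfolding set_integrable_def by (intro integrable_mult_indicator) auto
  have FG: "integrable lborel (\<lambda>t. norm (F t - G n t))" using F Gi by auto
  then have FGs: "set_integrable lborel {lo..hi} (\<lambda>t. norm (F t - G n t))"
    unfolding set_integrable_def by (intro integrable_mult_indicator) auto
  have Gg: "set_integrable lborel {lo..hi} (\<lambda>t. norm (G n t - g t))"
    by (intro set_integrable_norm set_integral_diff Gs gi)
  have "(LINT t:{lo..hi}|lborel. norm (f t - g t)) \<le> (LINT t:{lo..hi}|lborel. norm (F t - G n t) + norm (G n t - g t))"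
  proof (rule set_integral_mono)
    show "set_integrable lborel {lo..hi} (\<lambda>t. norm (f t - g t))"
      by (intro set_integrable_norm set_integral_diff f gi)
    show "set_integrable lborel {lo..hi} (\<lambda>t. norm (F t - G n t) + norm (G n t - g t))"
      by (rule set_integral_add[OF FGs Gg])
    show "norm (f t - g t) \<le> norm (F t - G n t) + norm (G n t - g t)" if "t \<in> {lo..hi}" for t
      using norm_triangle_ineq[of "F t - G n t" "G n t - g t"] that by (simp add: F_def)
  qed
  also have "\<dots> = (LINT t:{lo..hi}|lborel. norm (F t - G n t)) + (LINT t:{lo..hi}|lborel. norm (G n t - g t))"
    by (rule set_integral_add[OF FGs Gg])
  also have "(LINT t:{lo..hi}|lborel. norm (F t - G n t)) \<le> (LINT t|lborel. norm (F t - G n t))"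
    unfolding set_lebesgue_integral_def
    by (rule integral_mono[OF FGs[unfolded set_integrable_def] FG]) (auto simp: indicator_def)
  finally show ?thesis using that[OF g(1)] n g(2) by linarith
qed

text \<open>The Picard map in an exponentially weighted norm: the unknown is
  \<open>z t = exp (- \<kappa> * (t - a)) *\<^sub>R y t\<close>. For \<open>\<kappa> = 2 * K\<close>
  it contracts by \<open>K / \<kappa> = 1 / 2\<close> on the whole interval, so no local solutions
  have to be glued.\<close>

lemma ode_global_solution:
  fixes G :: "real \<Rightarrow> 'a::euclidean_space \<Rightarrow> 'a"
  assumes ab: "a \<le> b" and cont: "continuous_on ({a..b} \<times> UNIV) (\<lambda>(t, y). G t y)"
    and lip: "\<And>t y z. t \<in> {a..b} \<Longrightarrow> norm (G t y - G t z) \<le> K * norm (y - z)" and K: "0 < K"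
  obtains y where "y a = y0" "\<And>t. t \<in> {a..b} \<Longrightarrow> (y has_vector_derivative G t (y t)) (at t within {a..b})"
proof -
  \<comment> \<open>The complete space at hand consists of bounded continuous functions on all
    reals; clamping the time extends functions from \<open>{a..b}\<close> to it.\<close>
  define cl where "cl t = max a (min b t)" for t :: real
  have cl: "cl t \<in> {a..b}" "t \<in> {a..b} \<Longrightarrow> cl t = t" for t using ab by (auto simp: cl_def)
  have cl_cont: "continuous_on S cl" for S unfolding cl_def by (intro continuous_intros)
  define \<kappa> where "\<kappa> = 2 * K"
  have \<kappa>: "\<kappa> > 0" using K by (simp add: \<kappa>_def)
  define g where "g z s = G s (exp (\<kappa> * (s - a)) *\<^sub>R apply_bcontfun z s)" for z s
  define Q where "Q z t = exp (- \<kappa> * (t - a)) *\<^sub>R (y0 + integral {a..t} (g z))" for z t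
  have g_cont: "continuous_on {a..b} (g z)" for z
  proof -
    have "continuous_on {a..b} (\<lambda>s. (s, exp (\<kappa> * (s - a)) *\<^sub>R apply_bcontfun z s))"
      by (intro continuous_intros continuous_on_apply_bcontfun)
    from continuous_on_compose2[OF cont this] show ?thesis by (simp add: g_def image_subset_iff)
  qed
  have g_int: "g z integrable_on {a..t}" if "t \<in> {a..b}" for z t
    using that by (intro integrable_continuous_real continuous_on_subset[OF g_cont]) auto
  have Q_cont: "continuous_on {a..b} (Q z)" for z
    unfolding Q_def using g_cont ab
    by (intro continuous_intros indefinite_integral_continuous_1 g_int) auto
  have QC: "(\<lambda>t. Q z (cl t)) \<in> bcontfun" for z
  proof -
    have "compact (Q z ` {a..b})" using Q_cont by (rule compact_continuous_image) simp
    then obtain B where B: "\<And>t. t \<in> {a..b} \<Longrightarrow> norm (Q z t) \<le> B"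
      using compact_imp_bounded bounded_iff by (metis imageI)
    show ?thesis
    proof (rule bcontfun_normI)
      show "continuous_on UNIV (\<lambda>t. Q z (cl t))"
        by (rule continuous_on_compose2[OF Q_cont cl_cont]) (use cl(1) in auto)
      show "norm (Q z (cl t)) \<le> B" for t using B cl(1) by blast
    qed
  qed
  define P where "P z = Bcontfun (\<lambda>t. Q z (cl t))" for z
  have P: "apply_bcontfun (P z) t = Q z (cl t)" for z t
    unfolding P_def using Bcontfun_inverse[OF QC] by simp
  have Q_lip: "norm (Q z t - Q w t) \<le> (1 / 2) * dist z w" if t: "t \<in> {a..b}" for z w t
  proof -
    have e: "((\<lambda>s. exp (\<kappa> * (s - a)) * (K * dist z w)) has_integral
        (exp (\<kappa> * (t - a)) - 1) / \<kappa> * (K * dist z w)) {a..t}"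
    proof -
      have "((\<lambda>s. exp (\<kappa> * (s - a)) * (K * dist z w)) has_integral
        exp (\<kappa> * (t - a)) / \<kappa> * (K * dist z w) - exp (\<kappa> * (a - a)) / \<kappa> * (K * dist z w)) {a..t}"
        by (rule fundamental_theorem_of_calculus)
          (use t \<kappa> in \<open>auto intro!: derivative_eq_intros simp: has_real_derivative_iff_has_vector_derivative[symmetric]\<close>)
      then show ?thesis by (simp add: diff_divide_distrib left_diff_distrib)
    qed
    have "norm (integral {a..t} (\<lambda>s. g z s - g w s)) \<le> integral {a..t} (\<lambda>s. exp (\<kappa> * (s - a)) * (K * dist z w))"
    proof (rule integral_norm_bound_integral)
      show "(\<lambda>s. g z s - g w s) integrable_on {a..t}" using g_int[OF t] by (intro integrable_diff)
      show "(\<lambda>s. exp (\<kappa> * (s - a)) * (K * dist z w)) integrable_on {a..t}" using e by blast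
      fix s assume s: "s \<in> {a..t}"
      have "norm (g z s - g w s) \<le> K * norm (exp (\<kappa> * (s - a)) *\<^sub>R apply_bcontfun z s - exp (\<kappa> * (s - a)) *\<^sub>R apply_bcontfun w s)"
        unfolding g_def using s t by (intro lip) auto
      also have "\<dots> = K * (exp (\<kappa> * (s - a)) * dist (apply_bcontfun z s) (apply_bcontfun w s))"
        by (simp add: scaleR_diff_right[symmetric] dist_norm)
      also have "\<dots> \<le> K * (exp (\<kappa> * (s - a)) * dist z w)"
        using K by (intro mult_left_mono dist_bounded) auto
      finally show "norm (g z s - g w s) \<le> exp (\<kappa> * (s - a)) * (K * dist z w)" by (simp add: algebra_simps)
    qed
    also have "\<dots> = (exp (\<kappa> * (t - a)) - 1) / \<kappa> * (K * dist z w)" using e by (rule integral_unique)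
    also have "\<dots> \<le> exp (\<kappa> * (t - a)) * (1 / 2 * dist z w)"
      using K by (simp add: \<kappa>_def field_simps)
    finally have "exp (- \<kappa> * (t - a)) * norm (integral {a..t} (\<lambda>s. g z s - g w s))
        \<le> exp (- \<kappa> * (t - a)) * (exp (\<kappa> * (t - a)) * (1 / 2 * dist z w))"
      by (rule mult_left_mono) simp
    also have "\<dots> = 1 / 2 * dist z w" unfolding mult.assoc[symmetric] exp_add[symmetric] by simp
    finally show ?thesis
      using integral_diff[OF g_int[OF t, of z] g_int[OF t, of w]]
      by (simp add: Q_def scaleR_diff_right[symmetric])
  qed
  have "\<exists>!z. P z = z"
  proof (rule banach_fix_type[of "1 / 2"])
    show "\<forall>z w. dist (P z) (P w) \<le> 1 / 2 * dist z w"
    proof (intro allI dist_bound)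
      fix z w t
      show "dist (apply_bcontfun (P z) t) (apply_bcontfun (P w) t) \<le> 1 / 2 * dist z w"
        unfolding P dist_norm[of "Q z (cl t)"] by (rule Q_lip[OF cl(1)])
    qed
  qed auto
  then obtain z where z: "P z = z" by blast
  define y where "y t = y0 + integral {a..t} (g z)" for t
  have zt: "exp (\<kappa> * (t - a)) *\<^sub>R apply_bcontfun z t = y t" if "t \<in> {a..b}" for t
  proof -
    have "apply_bcontfun z t = Q z t" using P[of z t] z cl(2)[OF that] by simp
    then show ?thesis by (simp add: Q_def y_def exp_add[symmetric])
  qed
  show ?thesis
  proof
    show "y a = y0" by (simp add: y_def)
    fix t assume t: "t \<in> {a..b}"
    have "(y has_vector_derivative g z t) (at t within {a..b})"
      unfolding y_def using integral_has_vector_derivative[OF g_cont t, of z]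
      by (auto intro!: derivative_eq_intros)
    then show "(y has_vector_derivative G t (y t)) (at t within {a..b})"
      using zt[OF t] by (simp add: g_def)
  qed
qed

section \<open>The Steiner representation\<close>

locale hamiltonian =
  fixes H :: "real \<Rightarrow> 'a::euclidean_space \<Rightarrow> 'a \<Rightarrow> real"
    and c :: "real \<Rightarrow> real" and k :: "real \<Rightarrow> real \<Rightarrow> real" and T :: real
  assumes H_cont: "continuous_on ({0..T} \<times> UNIV \<times> UNIV) (\<lambda>(t, x, p). H t x p)"
    and H_convex: "t \<in> {0..T} \<Longrightarrow> convex_on UNIV (H t x)"
    and c_cont: "continuous_on {0..T} c"
    and c_nonneg: "t \<in> {0..T} \<Longrightarrow> 0 \<le> c t"
    and H4: "t \<in> {0..T} \<Longrightarrow> \<bar>H t x p - H t x q\<bar> \<le> c t * (1 + norm x) * norm (p - q)"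
    and k_cont: "R > 0 \<Longrightarrow> continuous_on {0..T} (k R)"
    and k_nonneg: "R > 0 \<Longrightarrow> t \<in> {0..T} \<Longrightarrow> 0 \<le> k R t"
    and HLC: "R > 0 \<Longrightarrow> t \<in> {0..T} \<Longrightarrow> x \<in> cball 0 R \<Longrightarrow> y \<in> cball 0 R \<Longrightarrow>
                \<bar>H t x p - H t y p\<bar> \<le> k R t * (1 + norm p) * norm (x - y)"
begin

abbreviation E where "E \<equiv> epiHstar H"

text \<open>Both components are kept together as one point of the epigraph, so one estimate of
  Hausdorff type serves \<open>f\<close> and \<open>l\<close>.\<close>

definition e :: "real \<Rightarrow> 'a \<Rightarrow> 'a \<times> real \<Rightarrow> 'a \<times> real"
  where "e t x a = steiner_point (Phi_set H t x a)"

lemma steiner_f_e: "steiner_f H t x a = fst (e t x a)"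
  and steiner_l_e: "steiner_l H t x a = snd (e t x a)"
  by (simp_all add: steiner_f_def steiner_l_def e_def)

lemma E_subgradient:
  assumes "t \<in> {0..T}"
  obtains v where "norm v \<le> c t * (1 + norm x)" "(v, - H t x 0) \<in> E t x"
  using epiHstar_subgradient[of H t x "c t * (1 + norm x)"] H_convex H4 c_nonneg assms by auto

lemma E_nonempty: "t \<in> {0..T} \<Longrightarrow> E t x \<noteq> {}"
  using E_subgradient by blast

lemma infdist_E_le:
  assumes "t \<in> {0..T}"
  shows "infdist a (E t x) \<le> norm a + c t * (1 + norm x) + \<bar>H t x 0\<bar>"
proof -
  obtain v where v: "norm v \<le> c t * (1 + norm x)" "(v, - H t x 0) \<in> E t x" by (rule E_subgradient[OF assms])
  have "infdist a (E t x) \<le> dist a (v, - H t x 0)" by (rule infdist_le[OF v(2)])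
  also have "\<dots> \<le> norm a + norm (v, - H t x 0)" unfolding dist_norm by (rule norm_triangle_ineq4)
  also have "norm (v, - H t x 0) \<le> norm v + \<bar>H t x 0\<bar>" using norm_Pair_le[of v "- H t x 0"] by simp
  finally show ?thesis using v(1) by simp
qed

lemma Phi_set_nonempty: assumes "t \<in> {0..T}" shows "Phi_set H t x a \<noteq> {}"
proof -
  obtain z where "z \<in> E t x" "infdist a (E t x) = dist a z"
    using infdist_attains_inf[OF closed_epiHstar E_nonempty[OF assms]] by blast
  then have "z \<in> Phi_set H t x a" using infdist_nonneg[of a "E t x"] by (auto simp: Phi_set_def)
  then show ?thesis by blast
qed

lemma compact_Phi_set: "compact (Phi_set H t x a)"
  unfolding Phi_set_def by (intro closed_Int_compact closed_epiHstar compact_cball)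

lemma convex_Phi_set: "convex (Phi_set H t x a)"
  unfolding Phi_set_def by (intro convex_Int convex_epiHstar convex_cball)

lemma e_mem: "t \<in> {0..T} \<Longrightarrow> e t x a \<in> Phi_set H t x a"
  unfolding e_def by (intro steiner_point_mem Phi_set_nonempty compact_Phi_set convex_Phi_set)

text \<open>The constants come from \<open>norm z \<le> norm a + 2 * infdist\<close>, where the
  distance is itself at most \<open>norm a\<close> plus the size of the subgradient point.\<close>

lemma Phi_set_norm_le:
  assumes "t \<in> {0..T}" "z \<in> Phi_set H t x a"
  shows "norm z \<le> 3 * norm a + 2 * (c t * (1 + norm x) + \<bar>H t x 0\<bar>)"
proof -
  have "norm z \<le> norm a + dist a z" using norm_triangle_sub[of z a] by (simp add: dist_norm norm_minus_commute)
  also have "dist a z \<le> 2 * infdist a (E t x)" using assms(2) by (simp add: Phi_set_def)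
  finally have "norm z \<le> norm a + 2 * infdist a (E t x)" by simp
  then show ?thesis using infdist_E_le[OF assms(1), of a x] by (simp add: algebra_simps)
qed

text \<open>Only membership in the epigraph enters, hence the bound does not depend on the control;
  all a priori bounds on trajectories rest on this.\<close>

lemma norm_fst_e:
  assumes "t \<in> {0..T}" shows "norm (fst (e t x a)) \<le> c t * (1 + norm x)"
proof -
  have "(fst (e t x a), snd (e t x a)) \<in> E t x" using e_mem[OF assms, of x a] by (simp add: Phi_set_def)
  then show ?thesis by (rule epiHstar_norm_le) (rule H4[OF assms])
qed

lemma snd_e_ge:
  assumes "t \<in> {0..T}" shows "- H t x 0 \<le> snd (e t x a)"
proof -
  have "(fst (e t x a), snd (e t x a)) \<in> E t x" using e_mem[OF assms, of x a] by (simp add: Phi_set_def)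
  then show ?thesis by (rule epiHstar_ge)
qed

text \<open>The factor 10 is that of \<open>near_ball_trace\<close>, the dimension that of
  \<open>steiner_point_dist\<close>. The majorant \<open>\<theta>\<close> is separate because it
  must be positive even when \<open>\<epsilon> + dist a b\<close> is 0.\<close>

lemma e_dist:
  fixes \<epsilon> \<theta> :: real
  assumes t: "t \<in> {0..T}" and s: "s \<in> {0..T}"
    and EF: "\<And>z. z \<in> Phi_set H t x a \<Longrightarrow> \<exists>w\<in>E s y. dist z w \<le> \<epsilon>"
    and FE: "\<And>z. z \<in> Phi_set H s y b \<Longrightarrow> \<exists>w\<in>E t x. dist z w \<le> \<epsilon>"
    and \<theta>: "\<epsilon> + dist a b \<le> \<theta>" "0 < \<theta>"
  shows "dist (e t x a) (e s y b) \<le> 10 * real DIM('a \<times> real) * \<theta>"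
proof -
  have "dist (e t x a) (e s y b) \<le> DIM('a \<times> real) * (10 * \<theta>)"
    unfolding e_def
  proof (rule steiner_point_dist)
    show "\<exists>w\<in>Phi_set H s y b. dist z w \<le> 10 * \<theta>" if "z \<in> Phi_set H t x a" for z
      unfolding Phi_set_def
      by (rule near_ball_trace[OF closed_epiHstar E_nonempty[OF t] closed_epiHstar convex_epiHstar E_nonempty[OF s]])
        (use that EF FE \<theta> in \<open>auto simp: Phi_set_def\<close>)
    show "\<exists>w\<in>Phi_set H t x a. dist z w \<le> 10 * \<theta>" if "z \<in> Phi_set H s y b" for z
      unfolding Phi_set_def
      by (rule near_ball_trace[OF closed_epiHstar E_nonempty[OF s] closed_epiHstar convex_epiHstar E_nonempty[OF t]])
        (use that EF FE \<theta> in \<open>auto simp: Phi_set_def dist_commute\<close>)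
  qed (use t s Phi_set_nonempty compact_imp_bounded[OF compact_Phi_set] in auto)
  then show ?thesis by (simp add: algebra_simps)
qed

text \<open>The factor \<open>1 + norm p\<close> in \<open>HLC\<close> splits into a constant and a
  cone. The first raises the point, the second tilts it, each by \<open>d\<close>; hence the
  2.\<close>

lemma E_near_lipschitz:
  assumes "R > 0" "t \<in> {0..T}" "x \<in> cball 0 R" "y \<in> cball 0 R" "z \<in> E t x"
  shows "\<exists>w\<in>E t y. dist z w \<le> 2 * (k R t * norm (x - y))"
proof -
  obtain v r where z: "z = (v, r)" by fastforce
  define d where "d = k R t * norm (x - y)"
  have d: "0 \<le> d" using k_nonneg assms by (simp add: d_def)
  have "inner v p - r - d - d * norm p \<le> H t y p" for p
  proof -
    have "inner v p - r \<le> H t x p" using assms(5) mem_epiHstar[of v r H t x] by (simp add: z)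
    moreover have "\<bar>H t x p - H t y p\<bar> \<le> d + d * norm p"
      using HLC[OF assms(1-4), of p] by (simp add: d_def algebra_simps)
    ultimately show ?thesis by linarith
  qed
  then obtain w where "norm (w - v) \<le> d" "(w, r + d) \<in> E t y"
    by (rule epiHstar_perturb[where H = H and t = t and x = y, OF H_convex[OF assms(2)] d])
  with d dist_epi_le[of w v d r d] show ?thesis by (auto simp: z d_def)
qed

lemma e_lipschitz:
  assumes "R > 0" "t \<in> {0..T}" "x \<in> cball 0 R" "y \<in> cball 0 R"
  shows "dist (e t x a) (e t y b) \<le> 10 * real DIM('a \<times> real) * (2 * (k R t * norm (x - y)) + dist a b)"
proof (rule field_le_epsilon)
  fix \<eta> :: real assume \<eta>: "\<eta> > 0"
  let ?m = "10 * real DIM('a \<times> real)"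
  define d where "d = 2 * (k R t * norm (x - y))"
  have "0 \<le> d" using k_nonneg assms by (simp add: d_def)
  \<comment> \<open>The slack \<open>\<eta> / ?m\<close> supplies the strict positivity that
    \<open>d + dist a b\<close> need not have.\<close>
  then have "dist (e t x a) (e t y b) \<le> ?m * (d + dist a b + \<eta> / ?m)"
    using e_dist[OF assms(2,2), of x a y d b "d + dist a b + \<eta> / ?m"] \<eta>
      E_near_lipschitz[OF assms] E_near_lipschitz[OF assms(1,2,4,3)]
    by (auto simp: Phi_set_def d_def norm_minus_commute add_nonneg_pos)
  also have "\<dots> = ?m * (d + dist a b) + \<eta>" by (simp only: distrib_left) simp
  finally show "dist (e t x a) (e t y b) \<le> ?m * (2 * (k R t * norm (x - y)) + dist a b) + \<eta>"
    by (simp add: d_def)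
qed

text \<open>Convexity propagates the closeness of \<open>H t x\<close> and \<open>H s y\<close> from \<open>|p| \<le> P\<close> to all \<open>p\<close>, at the
  price of an error of slope \<open>O(1/P)\<close>.\<close>
lemma E_near_of_uniform:
  assumes t: "t \<in> {0..T}" and s: "s \<in> {0..T}" and "0 < P" "0 \<le> \<eta>" "0 \<le> D" "0 \<le> \<rho>"
    and near: "\<And>p. norm p \<le> P \<Longrightarrow> \<bar>H t x p - H s y p\<bar> \<le> \<eta>"
    and D: "\<bar>H s y 0\<bar> \<le> D" and z: "z \<in> E t x" "norm z \<le> \<rho>"
  shows "\<exists>w\<in>E s y. dist z w \<le> (\<rho> + \<eta> + D) / P + \<eta>"
proof -
  obtain v r where zv: "z = (v, r)" by fastforce
  have r: "\<bar>r\<bar> \<le> \<rho>" using z(2) norm_snd_le[of r v] by (simp add: zv)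
  define d where "d = (\<rho> + \<eta> + D) / P"
  have d: "0 \<le> d" using assms by (simp add: d_def)
  have vr: "inner v p - r \<le> H t x p" for p using z(1) mem_epiHstar[of v r H t x] by (simp add: zv)
  have "inner v p - r - \<eta> - d * norm p \<le> H s y p" for p
  proof (cases "norm p \<le> P")
    case True
    have "0 \<le> d * norm p" using d by simp
    then show ?thesis using near[OF True] vr[of p] by linarith
  next
    case False
    \<comment> \<open>The point \<open>q *\<^sub>R p\<close> lies on the sphere of radius
      \<open>P\<close>, where closeness is known, and on the segment from 0 to \<open>p\<close>,
      where convexity of \<open>H s y\<close> applies.\<close>
    define q where "q = P / norm p"
    have "0 < norm p" using False \<open>0 < P\<close> by linarith
    then have q: "0 < q" "q < 1" using False \<open>0 < P\<close> by (auto simp: q_def divide_less_eq)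
    have "norm (q *\<^sub>R p) \<le> P" using False \<open>0 < P\<close> by (auto simp: q_def)
    then have "q * inner v p - r - \<eta> \<le> H s y (q *\<^sub>R p)"
      using near[of "q *\<^sub>R p"] vr[of "q *\<^sub>R p"] by simp
    also have "\<dots> \<le> (1 - q) * H s y 0 + q * H s y p"
      using convex_onD[OF H_convex[OF s], of q 0 p y] q by simp
    also have "\<dots> \<le> (1 - q) * D + q * H s y p" using D q by (intro add_mono mult_left_mono) auto
    finally have "q * inner v p - q * (r + \<eta>) - (1 - q) * (r + \<eta> + D) \<le> q * H s y p"
      by (simp add: algebra_simps)
    moreover have "(1 - q) * (r + \<eta> + D) \<le> (1 - q) * (\<rho> + \<eta> + D)"
      using q r by (intro mult_left_mono) auto
    moreover have "(1 - q) * (\<rho> + \<eta> + D) \<le> 1 * (\<rho> + \<eta> + D)"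
      using q assms(4-6) by (intro mult_right_mono) auto
    ultimately have "q * inner v p - q * (r + \<eta>) - (\<rho> + \<eta> + D) \<le> q * H s y p" by (simp add: algebra_simps)
    \<comment> \<open>The slope \<open>d\<close> is defined so that the remaining constant, divided
      by \<open>q\<close>, is exactly \<open>d * norm p\<close>.\<close>
    moreover have "\<rho> + \<eta> + D = q * (d * norm p)" using False \<open>0 < P\<close> by (auto simp: q_def d_def)
    ultimately have "q * (inner v p - r - \<eta> - d * norm p) \<le> q * H s y p" by (simp add: algebra_simps)
    then show ?thesis using q by simp
  qed
  then obtain w where "norm (w - v) \<le> d" "(w, r + \<eta>) \<in> E s y"
    by (rule epiHstar_perturb[where H = H and t = s and x = y, OF H_convex[OF s] d])
  with dist_epi_le[of w v d r \<eta>] \<open>0 \<le> \<eta>\<close> show ?thesis by (auto simp: zv d_def)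
qed

section \<open>Local bounds and joint continuity of the representation\<close>

lemma c_bound:
  obtains M where "0 < M" "\<And>t. t \<in> {0..T} \<Longrightarrow> c t \<le> M"
proof -
  have "bounded (c ` {0..T})" using compact_continuous_image[OF c_cont] by (simp add: compact_imp_bounded)
  then obtain M where "0 < M" "\<And>t. t \<in> {0..T} \<Longrightarrow> norm (c t) \<le> M" unfolding bounded_pos by blast
  with that show ?thesis by force
qed

lemma k_bound:
  assumes "R > 0"
  obtains K where "0 < K" "\<And>t. t \<in> {0..T} \<Longrightarrow> k R t \<le> K"
proof -
  have "bounded (k R ` {0..T})"
    using compact_continuous_image[OF k_cont[OF assms]] by (simp add: compact_imp_bounded)
  then obtain M where "0 < M" "\<And>t. t \<in> {0..T} \<Longrightarrow> norm (k R t) \<le> M" unfolding bounded_pos by blast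
  with that show ?thesis by force
qed

lemma local_bound:
  obtains D where "0 < D" "\<And>t x. t \<in> {0..T} \<Longrightarrow> norm x \<le> R \<Longrightarrow> c t * (1 + norm x) + \<bar>H t x 0\<bar> \<le> D"
proof -
  obtain M where M: "0 < M" "\<And>t. t \<in> {0..T} \<Longrightarrow> c t \<le> M" using c_bound by blast
  have "continuous_on ({0..T} \<times> cball 0 R \<times> {0}) (\<lambda>(t, x, p). H t x p)"
    by (rule continuous_on_subset[OF H_cont]) auto
  then have "bounded ((\<lambda>(t, x, p). H t x p) ` ({0..T} \<times> cball 0 R \<times> {0}))"
    by (intro compact_imp_bounded compact_continuous_image compact_Times) auto
  then obtain B where B: "0 < B" "\<And>t x. t \<in> {0..T} \<Longrightarrow> norm x \<le> R \<Longrightarrow> \<bar>H t x 0\<bar> \<le> B"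
    unfolding bounded_pos by force
  show ?thesis
  proof (rule that)
    show "0 < M * (1 + \<bar>R\<bar>) + B" using M B by (simp add: add_nonneg_pos)
    show "c t * (1 + norm x) + \<bar>H t x 0\<bar> \<le> M * (1 + \<bar>R\<bar>) + B" if "t \<in> {0..T}" "norm x \<le> R" for t x
      using M B c_nonneg that by (intro add_mono mult_mono) auto
  qed
qed

text \<open>\<open>HLC\<close> compares Hamiltonians at one time only. For changes of time there is
  uniform continuity of \<open>H\<close> on compact sets, with \<open>p\<close> restricted to a
  large ball, and \<open>E_near_of_uniform\<close> handles the rest. Joint continuity is used for
  measurability along trajectories and for solving the state equation.\<close>

lemma continuous_e: "continuous_on ({0..T} \<times> UNIV \<times> UNIV) (\<lambda>(t, x, a). e t x a)"
  unfolding continuous_on_iff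
proof (intro ballI allI impI)
  fix z :: "real \<times> 'a \<times> 'a \<times> real" and \<epsilon> :: real
  assume "z \<in> {0..T} \<times> UNIV \<times> UNIV" and \<epsilon>: "\<epsilon> > 0"
  then obtain t x a b where z: "z = (t, x, a, b)" and t: "t \<in> {0..T}" by (cases z) auto
  define m where "m = 10 * real DIM('a \<times> real)"
  have m: "m > 0" by (simp add: m_def)
  define \<theta> where "\<theta> = \<epsilon> / (2 * m)"
  have \<theta>: "\<theta> > 0" "m * \<theta> < \<epsilon>" using m \<epsilon> by (auto simp: \<theta>_def)
  define R where "R = norm x + 1"
  obtain D where D: "0 < D" "\<And>t x. t \<in> {0..T} \<Longrightarrow> norm x \<le> R \<Longrightarrow> c t * (1 + norm x) + \<bar>H t x 0\<bar> \<le> D"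
    using local_bound[of R] by blast
  have HD: "\<bar>H t x 0\<bar> \<le> D" if "t \<in> {0..T}" "norm x \<le> R" for t x
  proof -
    have "0 \<le> c t * (1 + norm x)" using c_nonneg[OF that(1)] by simp
    then show ?thesis using D(2)[OF that] by linarith
  qed
  \<comment> \<open>A bound for all points of \<open>Phi_set\<close> at states of norm at most
    \<open>R\<close> and controls within distance 1 of \<open>(a, b)\<close>.\<close>
  define \<rho> where "\<rho> = 3 * (norm (a, b) + 1) + 2 * D"
  have \<rho>: "0 \<le> \<rho>" using D by (simp add: \<rho>_def)
  \<comment> \<open>The slope error and the height error are \<open>\<eta>\<close> each, half of
    \<open>\<theta>\<close> together; the other half is left for the change of the control.\<close>
  define \<eta> where "\<eta> = \<theta> / 4"
  have \<eta>: "\<eta> > 0" using \<theta> by (simp add: \<eta>_def)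
  define P where "P = (\<rho> + \<eta> + D) / \<eta>"
  have P: "P > 0" "(\<rho> + \<eta> + D) / P = \<eta>" using \<rho> \<eta> D by (auto simp: P_def)
  have "uniformly_continuous_on ({0..T} \<times> cball 0 R \<times> cball 0 P) (\<lambda>(t, x, p). H t x p)"
    by (intro compact_uniformly_continuous continuous_on_subset[OF H_cont] compact_Times) auto
  from this[unfolded uniformly_continuous_on_def, rule_format, OF \<eta>]
  obtain d where d: "d > 0" "\<And>t x t' x' p. t \<in> {0..T} \<Longrightarrow> t' \<in> {0..T} \<Longrightarrow> norm x \<le> R \<Longrightarrow> norm x' \<le> R \<Longrightarrow>
      norm p \<le> P \<Longrightarrow> dist (t', x', p) (t, x, p) < d \<Longrightarrow> \<bar>H t' x' p - H t x p\<bar> < \<eta>"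
    by (force simp: dist_real_def)
  define \<delta> where "\<delta> = min (min d 1) (\<theta> / 2)"
  have "\<delta> > 0" using d \<theta> by (simp add: \<delta>_def)
  moreover have "dist (e t' x' (a', b')) (e t x (a, b)) < \<epsilon>"
    if t': "t' \<in> {0..T}" and ds: "dist (t', x', a', b') (t, x, a, b) < \<delta>" for t' b' and x' a' :: 'a
  proof -
    have d1: "dist (t', x') (t, x) < \<delta>"
      using ds by (simp add: dist_prod_def) (smt (verit) real_sqrt_le_mono zero_le_power2)
    have d2: "dist (a', b') (a, b) < \<delta>" 
      using ds dist_snd_le[of "(x', a', b')" "(x, a, b)"] dist_snd_le[of "(t', x', a', b')" "(t, x, a, b)"] by simp
    have dx: "dist x' x < \<delta>" using d1 dist_snd_le[of "(t', x')" "(t, x)"] by simp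
    have xR: "norm x \<le> R" "norm x' \<le> R"
      using dx norm_triangle_sub[of x' x] by (auto simp: R_def \<delta>_def dist_norm)
    have dp: "dist (t', x', p) (t, x, p) < d" "dist (t, x, p) (t', x', p) < d" for p
      using d1 by (auto simp: dist_prod_def \<delta>_def dist_commute)
    have ab: "norm (a', b') \<le> norm (a, b) + 1"
      using d2 norm_triangle_sub[of "(a', b')" "(a, b)"] by (simp add: \<delta>_def dist_norm)
    have n1: "norm z \<le> \<rho>" if "z \<in> Phi_set H t x (a, b)" for z
      using Phi_set_norm_le[OF t that] D(2)[OF t xR(1)] by (simp add: \<rho>_def)
    have n2: "norm z \<le> \<rho>" if "z \<in> Phi_set H t' x' (a', b')" for z
      using Phi_set_norm_le[OF t' that] D(2)[OF t' xR(2)] ab by (simp add: \<rho>_def)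
    have "dist (e t' x' (a', b')) (e t x (a, b)) \<le> m * \<theta>"
      unfolding m_def
    proof (rule e_dist[OF t' t])
      show "\<exists>w\<in>E t x. dist z w \<le> \<eta> + \<eta>" if "z \<in> Phi_set H t' x' (a', b')" for z
      proof -
        have "\<exists>w\<in>E t x. dist z w \<le> (\<rho> + \<eta> + D) / P + \<eta>"
        proof (rule E_near_of_uniform[OF t' t P(1) _ _ \<rho> _ HD[OF t xR(1)] _ n2[OF that]])
          show "\<bar>H t' x' p - H t x p\<bar> \<le> \<eta>" if "norm p \<le> P" for p
            using d(2)[OF t t' xR that dp(1)] by simp
        qed (use that \<eta> D in \<open>auto simp: Phi_set_def\<close>)
        then show ?thesis by (simp only: P(2))
      qed
      show "\<exists>w\<in>E t' x'. dist z w \<le> \<eta> + \<eta>" if "z \<in> Phi_set H t x (a, b)" for z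
      proof -
        have "\<exists>w\<in>E t' x'. dist z w \<le> (\<rho> + \<eta> + D) / P + \<eta>"
        proof (rule E_near_of_uniform[OF t t' P(1) _ _ \<rho> _ HD[OF t' xR(2)] _ n1[OF that]])
          show "\<bar>H t x p - H t' x' p\<bar> \<le> \<eta>" if "norm p \<le> P" for p
            using d(2)[OF t' t xR(2,1) that dp(2)] by simp
        qed (use that \<eta> D in \<open>auto simp: Phi_set_def\<close>)
        then show ?thesis by (simp only: P(2))
      qed
      show "\<eta> + \<eta> + dist (a', b') (a, b) \<le> \<theta>" using d2 by (simp add: \<eta>_def \<delta>_def)
    qed (rule \<theta>(1))
    then show ?thesis using \<theta>(2) by simp
  qed
  ultimately show "\<exists>\<delta>>0. \<forall>z'\<in>{0..T} \<times> UNIV \<times> UNIV. dist z' z < \<delta> \<longrightarrow>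
      dist (case z' of (t, x, a) \<Rightarrow> e t x a) (case z of (t, x, a) \<Rightarrow> e t x a) < \<epsilon>"
    unfolding z by (intro exI[of _ \<delta>]) auto
qed

end

section \<open>Trajectories\<close>

text \<open>Reduces to the parametrised notion \<open>local_lipschitz\<close>, with the single dummy
  time 0.\<close>

lemma loc_lipschitz_on_compact:
  fixes g :: "'a::metric_space \<Rightarrow> real"
  assumes "loc_lipschitz_on UNIV g" "compact S"
  obtains L where "L-lipschitz_on S g"
proof -
  have "local_lipschitz {0::real} UNIV (\<lambda>_. g)"
  proof (rule local_lipschitzI)
    fix t :: real and z :: 'a
    obtain r L where r: "r > 0" "\<forall>u\<in>UNIV \<inter> ball z r. \<forall>w\<in>UNIV \<inter> ball z r. dist (g u) (g w) \<le> L * dist u w"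
      using assms(1) unfolding loc_lipschitz_on_def by blast
    have "\<bar>L\<bar>-lipschitz_on (cball z (r / 2) \<inter> UNIV) g"
    proof (rule lipschitz_onI)
      fix u w assume "u \<in> cball z (r / 2) \<inter> UNIV" "w \<in> cball z (r / 2) \<inter> UNIV"
      then have "u \<in> ball z r" "w \<in> ball z r" using r(1) by auto
      then have "dist (g u) (g w) \<le> L * dist u w" using r(2) by blast
      also have "\<dots> \<le> \<bar>L\<bar> * dist u w" by (intro mult_right_mono) auto
      finally show "dist (g u) (g w) \<le> \<bar>L\<bar> * dist u w" .
    qed simp
    then show "\<exists>u>0. \<exists>L. \<forall>t\<in>cball t u \<inter> {0}. L-lipschitz_on (cball z u \<inter> UNIV) g"
      using r(1) by (intro exI[of _ "r / 2"]) auto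
  qed
  then have "local_lipschitz {0::real} S (\<lambda>_. g)" by (rule local_lipschitz_subset) auto
  then obtain L where "\<And>t. t \<in> {0::real} \<Longrightarrow> L-lipschitz_on S g"
    by (rule local_lipschitz_compact_implies_lipschitz[OF _ assms(2)]) auto
  with that show ?thesis by blast
qed

context hamiltonian
begin

definition cost :: "('a \<Rightarrow> real) \<Rightarrow> real \<Rightarrow> (real \<Rightarrow> 'a) \<Rightarrow> (real \<Rightarrow> 'a \<times> real) \<Rightarrow> real"
  where "cost g t0 x a = g (x T) + (LINT t:{t0..T}|lborel. steiner_l H t (x t) (a t))"

abbreviation traj where "traj \<equiv> traj_pairs (steiner_f H) T"

text \<open>Measurability is taken in restricted spaces: \<open>a\<close> is known to be measurable
  on \<open>{t0..T}\<close> only, and \<open>e\<close> to be continuous over \<open>{0..T}\<close>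
  only. Domination is by \<open>3 * norm (a t) + 2 * D\<close>.\<close>

lemma e_set_integrable:
  assumes t0: "t0 \<in> {0..T}" and x: "continuous_on {t0..T} x" and a: "set_integrable lborel {t0..T} a"
  shows "set_integrable lborel {t0..T} (\<lambda>t. e t (x t) (a t))"
proof -
  let ?S = "{t0..T}" and ?D = "{0..T} \<times> (UNIV :: 'a set) \<times> (UNIV :: ('a \<times> real) set)"
  have "bounded (x ` ?S)" using x by (intro compact_imp_bounded compact_continuous_image) auto
  then obtain R where R: "\<And>t. t \<in> ?S \<Longrightarrow> norm (x t) \<le> R" unfolding bounded_iff by blast
  obtain D where D: "0 < D" "\<And>t x. t \<in> {0..T} \<Longrightarrow> norm x \<le> R \<Longrightarrow> c t * (1 + norm x) + \<bar>H t x 0\<bar> \<le> D"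
    using local_bound[of R] by blast
  have am: "a \<in> borel_measurable (restrict_space borel ?S)"
    using a by (subst borel_measurable_restrict_space_iff) (auto simp: set_integrable_def)
  have xm: "x \<in> borel_measurable (restrict_space borel ?S)"
    using x by (rule borel_measurable_continuous_on_restrict)
  have tm: "(\<lambda>t. t) \<in> borel_measurable (restrict_space borel ?S)" by (rule measurable_restrict_space1) simp
  have pm: "(\<lambda>t. (t, x t, a t)) \<in> measurable (restrict_space borel ?S) (restrict_space borel ?D)"
    using t0 by (intro measurable_restrict_space2 borel_measurable_Pair tm xm am) (auto simp: space_restrict_space)
  have em: "(\<lambda>(t, x, a). e t x a) \<in> borel_measurable (restrict_space borel ?D)"
    by (rule borel_measurable_continuous_on_restrict[OF continuous_e])
  have "(\<lambda>t. e t (x t) (a t)) \<in> borel_measurable (restrict_space borel ?S)"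
    using measurable_compose[OF pm em] by simp
  then have m: "(\<lambda>t. indicator ?S t *\<^sub>R e t (x t) (a t)) \<in> borel_measurable lborel"
    by (subst (asm) borel_measurable_restrict_space_iff) auto
  have "set_integrable lborel ?S (\<lambda>t. 3 * norm (a t) + 2 * D)"
    by (intro set_integral_add set_integrable_mult_right set_integrable_norm a)
      (auto intro: set_integrable_continuous_real)
  then show ?thesis
    unfolding set_integrable_def
  proof (rule Bochner_Integration.integrable_bound[OF _ m])
    have "norm (e t (x t) (a t)) \<le> 3 * norm (a t) + 2 * D" if "t \<in> ?S" for t
    proof -
      have t: "t \<in> {0..T}" using that t0 by auto
      show ?thesis using Phi_set_norm_le[OF t e_mem[OF t, of "x t" "a t"]] D(2)[OF t R[OF that]] by simp
    qed
    then show "AE t in lborel. norm (indicat_real ?S t *\<^sub>R e t (x t) (a t))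
        \<le> norm (indicat_real ?S t *\<^sub>R (3 * norm (a t) + 2 * D))"
      using D(1) by (intro AE_I2) (auto simp: indicator_def intro: order_trans[OF _ abs_ge_self])
  qed
qed

lemma l_set_integrable:
  assumes "t0 \<in> {0..T}" "continuous_on {t0..T} x" "set_integrable lborel {t0..T} a"
  shows "set_integrable lborel {t0..T} (\<lambda>t. steiner_l H t (x t) (a t))"
  using integrable_bounded_linear[OF bounded_linear_snd e_set_integrable[OF assms, unfolded set_integrable_def]]
  by (simp add: set_integrable_def steiner_l_e)

lemma trajD:
  assumes "(x, a) \<in> traj t0 x0"
  shows "abs_continuous_on t0 T x" "set_integrable lborel {t0..T} a" "x t0 = x0"
    "AE t in lborel. t \<in> {t0..T} \<longrightarrow> (x has_vector_derivative fst (e t (x t) (a t))) (at t within {t0..T})"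
  using assms by (auto simp: traj_pairs_def steiner_f_e)

lemma exp_growth_bound:
  assumes "0 \<le> R" "0 < M" "t0 \<in> {0..T}" "t \<in> {t0..T}" "norm x0 \<le> R"
  shows "(norm x0 + integral {t0..T} (\<lambda>_. M)) * exp (M * (t - t0)) \<le> (R + M * T) * exp (M * T)"
  using assms by (intro mult_mono add_mono) (auto simp: mult_le_cancel_left)

lemma traj_norm_le:
  assumes tr: "(x, a) \<in> traj t0 x0" and t0: "t0 \<in> {0..T}" and t: "t \<in> {t0..T}"
    and M: "0 < M" "\<And>t. t \<in> {0..T} \<Longrightarrow> c t \<le> M" and R: "norm x0 \<le> R"
  shows "norm (x t) \<le> (R + M * T) * exp (M * T)"
proof -
  have "norm (x t) \<le> (norm (x t0) + integral {t0..T} (\<lambda>_. M)) * exp (M * (t - t0))"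
  proof (rule abs_continuous_gronwall[OF trajD(1)[OF tr] M(1) t trajD(4)[OF tr]])
    have "norm (fst (e s (x s) (a s))) \<le> M * norm (x s) + M" if "s \<in> {t0..T}" for s
    proof -
      have s: "s \<in> {0..T}" using that t0 by auto
      have "norm (fst (e s (x s) (a s))) \<le> c s * (1 + norm (x s))" by (rule norm_fst_e[OF s])
      also have "\<dots> \<le> M * (1 + norm (x s))" using M(2)[OF s] by (intro mult_right_mono) auto
      finally show ?thesis by (simp add: algebra_simps)
    qed
    then show "AE s in lborel. s \<in> {t0..T} \<longrightarrow> norm (fst (e s (x s) (a s))) \<le> M * norm (x s) + M" by simp
  qed (use M in auto)
  also have "\<dots> \<le> (R + M * T) * exp (M * T)"
    unfolding trajD(3)[OF tr] using exp_growth_bound[OF _ M(1) t0 t R] R norm_ge_zero[of x0] by linarith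
  finally show ?thesis .
qed

text \<open>Along a bounded trajectory the speed is bounded independently of the control. This
  carries two trajectories with different starting times to the later one.\<close>

lemma traj_displacement:
  assumes tr: "(x, a) \<in> traj t0 x0" and t0: "t0 \<in> {0..T}" and s: "s \<in> {t0..T}"
    and M: "0 < M" "\<And>t. t \<in> {0..T} \<Longrightarrow> c t \<le> M" and R: "0 \<le> R" "\<And>t. t \<in> {t0..T} \<Longrightarrow> norm (x t) \<le> R"
  shows "norm (x s - x0) \<le> M * (1 + R) * (s - t0)"
proof -
  have "norm (x s - x t0) \<le> integral {t0..s} (\<lambda>_. M * (1 + R))"
  proof (rule abs_continuous_norm_le)
    show "abs_continuous_on t0 s x" by (rule abs_continuous_subinterval[OF trajD(1)[OF tr]]) (use s in auto)
    show "AE t in lborel. t \<in> {t0..s} \<longrightarrow> (x has_vector_derivative fst (e t (x t) (a t))) (at t within {t0..s})"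
      by (rule AE_derivative_subinterval[OF trajD(4)[OF tr]]) (use s in auto)
    have "norm (fst (e t (x t) (a t))) \<le> M * (1 + R)" if "t \<in> {t0..s}" for t
    proof -
      have t: "t \<in> {0..T}" "t \<in> {t0..T}" using that t0 s by auto
      have "norm (fst (e t (x t) (a t))) \<le> c t * (1 + norm (x t))" by (rule norm_fst_e[OF t(1)])
      also have "\<dots> \<le> M * (1 + R)" using M R(2)[OF t(2)] t c_nonneg by (intro mult_mono) auto
      finally show ?thesis .
    qed
    then show "AE t in lborel. t \<in> {t0..s} \<longrightarrow> norm (fst (e t (x t) (a t))) \<le> M * (1 + R)" by simp
  qed (use s M R in auto)
  then show ?thesis using s trajD(3)[OF tr] by (simp add: mult.commute mult.left_commute)
qed

lemma e_lipschitz_const: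
  assumes "R > 0"
  obtains L where "0 < L"
    "\<And>t x y a b. t \<in> {0..T} \<Longrightarrow> norm x \<le> R \<Longrightarrow> norm y \<le> R \<Longrightarrow>
      dist (e t x a) (e t y b) \<le> L * norm (x - y) + L * norm (a - b)"
proof -
  obtain K where K: "0 < K" "\<And>t. t \<in> {0..T} \<Longrightarrow> k R t \<le> K" using k_bound[OF assms] by blast
  define m where "m = 10 * real DIM('a \<times> real)"
  have m: "0 < m" by (simp add: m_def)
  show ?thesis
  proof (rule that)
    show "0 < m * (2 * K + 1)" using m K by simp
    fix t x y a b assume h: "t \<in> {0..T}" "norm (x::'a) \<le> R" "norm (y::'a) \<le> R"
    have "dist (e t x a) (e t y b) \<le> m * (2 * (k R t * norm (x - y)) + dist a b)"
      unfolding m_def using h by (intro e_lipschitz[OF assms]) auto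
    also have "\<dots> \<le> m * (2 * (K * norm (x - y)) + dist a b)"
      using K(2)[OF h(1)] m by (intro mult_left_mono add_right_mono mult_right_mono) auto
    also have "\<dots> \<le> m * ((2 * K + 1) * norm (x - y) + (2 * K + 1) * norm (a - b))"
      using K(1) m by (intro mult_left_mono) (auto simp: algebra_simps dist_norm)
    finally show "dist (e t x a) (e t y b) \<le> m * (2 * K + 1) * norm (x - y) + m * (2 * K + 1) * norm (a - b)"
      by (simp add: algebra_simps)
  qed
qed

text \<open>Truncating the state by projection onto a large ball makes the right-hand side globally
  Lipschitz; the a priori bound shows that the truncation is never active.\<close>
lemma traj_exists:
  assumes t1: "t1 \<in> {0..T}" and b: "continuous_on UNIV b"
  obtains y where "(y, b) \<in> traj t1 y0"
proof -
  obtain M where M: "0 < M" "\<And>t. t \<in> {0..T} \<Longrightarrow> c t \<le> M" using c_bound by blast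
  \<comment> \<open>The Gronwall bound for the state; the \<open>+ 1\<close> makes the radius
    positive even for \<open>y0 = 0\<close> and \<open>T = 0\<close>.\<close>
  define R where "R = (norm y0 + M * T) * exp (M * T) + 1"
  have MT: "0 \<le> M * T" using M t1 by auto
  have R: "R > 0" unfolding R_def using MT by (intro add_nonneg_pos mult_nonneg_nonneg) auto
  define pr where "pr = closest_point (cball (0::'a) R)"
  have ne: "cball (0::'a) R \<noteq> {}" using R by simp
  have pr_lip: "dist (pr y) (pr z) \<le> dist y z" for y z
    unfolding pr_def using ne by (intro closest_point_lipschitz) auto
  have pr_R: "norm (pr y) \<le> R" for y
    using closest_point_in_set[OF _ ne, of y] by (simp add: pr_def)
  have pr_id: "pr y = y" if "norm y \<le> R" for y
    unfolding pr_def using that by (intro closest_point_self) auto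
  \<comment> \<open>Since the projection does not increase norms, the growth of \<open>G\<close> is
    controlled by \<open>norm y\<close> with constants free of \<open>R\<close>; otherwise the a
    priori bound could not be compared with \<open>R\<close>.\<close>
  have pr_le: "norm (pr y) \<le> norm y" for y
    using pr_lip[of y 0] pr_id[of 0] R by (simp add: dist_norm)
  have pr_cont: "continuous_on S pr" for S
    unfolding pr_def using ne by (intro continuous_on_closest_point) auto
  obtain L where L: "0 < L"
    "\<And>t x y a b. t \<in> {0..T} \<Longrightarrow> norm x \<le> R \<Longrightarrow> norm y \<le> R \<Longrightarrow>
      dist (e t x a) (e t y b) \<le> L * norm (x - y) + L * norm (a - b)"
    using e_lipschitz_const[OF R] by blast
  define G where "G t y = fst (e t (pr y) (b t))" for t y
  have G_cont: "continuous_on ({t1..T} \<times> UNIV) (\<lambda>(t, y). G t y)"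
  proof -
    have "continuous_on ({t1..T} \<times> UNIV) (\<lambda>z. (fst z, pr (snd z), b (fst z)))"
      by (intro continuous_intros continuous_on_compose2[OF pr_cont[of UNIV]] continuous_on_compose2[OF b]) auto
    then have "continuous_on ({t1..T} \<times> UNIV) (\<lambda>z. case (fst z, pr (snd z), b (fst z)) of (t, x, a) \<Rightarrow> e t x a)"
      by (rule continuous_on_compose2[OF continuous_e]) (use t1 in auto)
    then have "continuous_on ({t1..T} \<times> UNIV) (\<lambda>z. fst (e (fst z) (pr (snd z)) (b (fst z))))"
      by (auto intro: continuous_on_fst)
    then show ?thesis by (simp add: G_def case_prod_unfold)
  qed
  have G_lip: "norm (G t y - G t z) \<le> L * norm (y - z)" if "t \<in> {t1..T}" for t y z
  proof -
    have "norm (G t y - G t z) \<le> dist (e t (pr y) (b t)) (e t (pr z) (b t))"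
      unfolding G_def dist_norm[symmetric] by (rule dist_fst_le)
    also have "\<dots> \<le> L * norm (pr y - pr z)"
      using L(2)[of t "pr y" "pr z" "b t" "b t"] pr_R that t1 by auto
    also have "\<dots> \<le> L * norm (y - z)" using L(1) pr_lip[of y z] by (simp add: dist_norm)
    finally show ?thesis .
  qed
  have G_le: "norm (G t y) \<le> M * (1 + norm (pr y))" if "t \<in> {t1..T}" for t y
  proof -
    have t: "t \<in> {0..T}" using that t1 by auto
    have "norm (G t y) \<le> c t * (1 + norm (pr y))" unfolding G_def by (rule norm_fst_e[OF t])
    also have "\<dots> \<le> M * (1 + norm (pr y))" using M(2)[OF t] by (intro mult_right_mono) auto
    finally show ?thesis .
  qed
  obtain y where y: "y t1 = y0" "\<And>t. t \<in> {t1..T} \<Longrightarrow> (y has_vector_derivative G t (y t)) (at t within {t1..T})"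
    using ode_global_solution[OF _ G_cont G_lip L(1), of y0] t1 by auto
  have ac: "abs_continuous_on t1 T y"
  proof (rule lipschitz_imp_abs_continuous)
    show "0 \<le> M * (1 + R)" using M R by simp
    show "norm (y s - y t) \<le> M * (1 + R) * \<bar>s - t\<bar>" if "s \<in> {t1..T}" "t \<in> {t1..T}" for s t
    proof -
      have "norm (y s - y t) \<le> M * (1 + R) * norm (s - t)"
      proof (rule differentiable_bound[where S = "{t1..T}"])
        show "(y has_derivative (\<lambda>h. h *\<^sub>R G u (y u))) (at u within {t1..T})" if "u \<in> {t1..T}" for u
          using y(2)[OF that] by (simp add: has_vector_derivative_def)
        show "onorm (\<lambda>h. h *\<^sub>R G u (y u)) \<le> M * (1 + R)" if "u \<in> {t1..T}" for u
        proof (rule onorm_le)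
          have "norm (G u (y u)) \<le> M * (1 + R)"
            using G_le[OF that, of "y u"] pr_R[of "y u"] M by (smt (verit) mult_left_mono)
          then show "norm (h *\<^sub>R G u (y u)) \<le> M * (1 + R) * norm h" for h
            by (simp add: mult.commute mult_left_mono)
        qed
      qed (use that in auto)
      then show ?thesis by simp
    qed
  qed
  have yR: "norm (y t) \<le> R" if t: "t \<in> {t1..T}" for t
  proof -
    have "norm (y t) \<le> (norm (y t1) + integral {t1..T} (\<lambda>_. M)) * exp (M * (t - t1))"
    proof (rule abs_continuous_gronwall[OF ac M(1) t])
      show "AE t in lborel. t \<in> {t1..T} \<longrightarrow> (y has_vector_derivative G t (y t)) (at t within {t1..T})"
        using y(2) by simp
      have "norm (G s (y s)) \<le> M * norm (y s) + M" if "s \<in> {t1..T}" for s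
      proof -
        have "M * (1 + norm (pr (y s))) \<le> M * (1 + norm (y s))" using M pr_le by (intro mult_left_mono) auto
        then show ?thesis using G_le[OF that, of "y s"] by (simp add: algebra_simps)
      qed
      then show "AE s in lborel. s \<in> {t1..T} \<longrightarrow> norm (G s (y s)) \<le> M * norm (y s) + M" by simp
    qed (use M in auto)
    also have "\<dots> \<le> (norm y0 + M * T) * exp (M * T)"
      unfolding y(1) by (rule exp_growth_bound[OF _ M(1) t1 t]) auto
    finally show ?thesis by (simp add: R_def)
  qed
  have "set_integrable lborel {t1..T} b"
    by (intro set_integrable_continuous_real continuous_on_subset[OF b]) auto
  moreover have "(y has_vector_derivative steiner_f H t (y t) (b t)) (at t within {t1..T})" if "t \<in> {t1..T}" for t
    using y(2)[OF that] pr_id[OF yR[OF that]] by (simp add: G_def steiner_f_e)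
  ultimately have "(y, b) \<in> traj t1 y0" using ac y(1) by (simp add: traj_pairs_def)
  with that show ?thesis .
qed

lemma integral_affine_comp:
  fixes N :: "real \<Rightarrow> real"
  assumes "N integrable_on {r..s}" "r \<le> s"
  shows "integral {r..s} (\<lambda>t. q + p * N t) = q * (s - r) + p * integral {r..s} N"
proof -
  have "integral {r..s} (\<lambda>t. q + p * N t) = integral {r..s} (\<lambda>t. q) + integral {r..s} (\<lambda>t. p * N t)"
    using assms by (intro integral_add integrable_on_mult_right) auto
  then show ?thesis using assms(2) by (simp add: mult.commute)
qed

text \<open>Gronwall for the difference, started at a time \<open>\<tau>\<close> when both pairs are
  running. The error of the controls is a separate function \<open>N\<close>, because its integral
  is estimated for an extension of \<open>a\<close> that agrees with \<open>a\<close> only after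
  \<open>t0\<close>.\<close>

lemma traj_gap:
  assumes x: "(x, a) \<in> traj t0 x0" and y: "(y, b) \<in> traj t1 y0" and t01: "t0 \<in> {0..T}" "t1 \<in> {0..T}"
    and L: "0 < L" "\<And>t x y a b. t \<in> {0..T} \<Longrightarrow> norm x \<le> R \<Longrightarrow> norm y \<le> R \<Longrightarrow>
      dist (e t x a) (e t y b) \<le> L * norm (x - y) + L * norm (a - b)"
    and xR: "\<And>t. t \<in> {t0..T} \<Longrightarrow> norm (x t) \<le> R" and yR: "\<And>t. t \<in> {t1..T} \<Longrightarrow> norm (y t) \<le> R"
    and \<tau>: "t0 \<le> \<tau>" "t1 \<le> \<tau>" and t: "t \<in> {\<tau>..T}"
    and N: "N integrable_on {\<tau>..T}" "integral {\<tau>..T} N \<le> \<epsilon>" "\<And>t. t \<in> {\<tau>..T} \<Longrightarrow> norm (a t - b t) = N t"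
  shows "norm (x t - y t) \<le> (norm (x \<tau> - y \<tau>) + L * \<epsilon>) * exp (L * T)"
proof -
  have N0: "0 \<le> N t" if "t \<in> {\<tau>..T}" for t using N(3)[OF that] norm_ge_zero by metis
  have "norm (x t - y t) \<le> (norm (x \<tau> - y \<tau>) + integral {\<tau>..T} (\<lambda>t. L * N t)) * exp (L * (t - \<tau>))"
  proof (rule abs_continuous_gronwall[OF _ L(1) t])
    show "abs_continuous_on \<tau> T (\<lambda>t. x t - y t)"
      by (rule abs_continuous_diff[OF abs_continuous_subinterval[OF trajD(1)[OF x]]
            abs_continuous_subinterval[OF trajD(1)[OF y]]]) (use \<tau> in auto)
    show "AE t in lborel. t \<in> {\<tau>..T} \<longrightarrow> ((\<lambda>t. x t - y t) has_vector_derivative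
        fst (e t (x t) (a t)) - fst (e t (y t) (b t))) (at t within {\<tau>..T})"
      using AE_derivative_subinterval[OF trajD(4)[OF x] \<tau>(1) order_refl]
        AE_derivative_subinterval[OF trajD(4)[OF y] \<tau>(2) order_refl]
      by eventually_elim (auto intro: has_vector_derivative_diff)
    have "norm (fst (e t (x t) (a t)) - fst (e t (y t) (b t))) \<le> L * norm (x t - y t) + L * N t"
      if t: "t \<in> {\<tau>..T}" for t
    proof -
      have "norm (fst (e t (x t) (a t)) - fst (e t (y t) (b t))) \<le> dist (e t (x t) (a t)) (e t (y t) (b t))"
        unfolding dist_norm[symmetric] by (rule dist_fst_le)
      also have "\<dots> \<le> L * norm (x t - y t) + L * norm (a t - b t)"
        using t \<tau> t01 by (intro L(2) xR yR) auto
      finally show ?thesis using N(3)[OF t] by simp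
    qed
    then show "AE t in lborel. t \<in> {\<tau>..T} \<longrightarrow>
        norm (fst (e t (x t) (a t)) - fst (e t (y t) (b t))) \<le> L * norm (x t - y t) + L * N t" by simp
    show "(\<lambda>t. L * N t) integrable_on {\<tau>..T}" using N(1) by (rule integrable_on_mult_right)
    show "0 \<le> L * N t" if "t \<in> {\<tau>..T}" for t using N0[OF that] L(1) by simp
  qed
  also have "\<dots> \<le> (norm (x \<tau> - y \<tau>) + L * \<epsilon>) * exp (L * T)"
  proof (rule mult_mono)
    show "norm (x \<tau> - y \<tau>) + integral {\<tau>..T} (\<lambda>t. L * N t) \<le> norm (x \<tau> - y \<tau>) + L * \<epsilon>"
      using N(2) L(1) by simp
    show "exp (L * (t - \<tau>)) \<le> exp (L * T)" using t \<tau> t01 L(1) by (auto simp: mult_le_cancel_left)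
    have "0 \<le> integral {\<tau>..T} N" using N(1) N0 by (intro integral_nonneg) auto
    then have "0 \<le> \<epsilon>" using N(2) by linarith
    then show "0 \<le> norm (x \<tau> - y \<tau>) + L * \<epsilon>" using L(1) by simp
  qed simp
  finally show ?thesis .
qed

end

section \<open>The value function\<close>

context hamiltonian
begin

text \<open>The lower bound comes from membership in the epigraph and is uniform in the control; the
  upper bound comes from the radius of \<open>Phi_set\<close> and grows linearly with the
  control.\<close>

lemma running_cost_bounds:
  assumes x: "(x, a) \<in> traj t0 x0" and t0: "t0 \<in> {0..T}"
    and D: "\<And>t x. t \<in> {0..T} \<Longrightarrow> norm x \<le> R \<Longrightarrow> c t * (1 + norm x) + \<bar>H t x 0\<bar> \<le> D"
    and xR: "\<And>t. t \<in> {t0..T} \<Longrightarrow> norm (x t) \<le> R" and t: "t \<in> {t0..T}"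
  shows "- D \<le> steiner_l H t (x t) (a t)" "steiner_l H t (x t) (a t) \<le> 3 * norm (a t) + 2 * D"
proof -
  have t': "t \<in> {0..T}" using t t0 by auto
  have "0 \<le> c t * (1 + norm (x t))" using c_nonneg[OF t'] by simp
  then have "- D \<le> - H t (x t) 0" using D[OF t' xR[OF t]] by linarith
  also have "\<dots> \<le> steiner_l H t (x t) (a t)" unfolding steiner_l_e by (rule snd_e_ge[OF t'])
  finally show "- D \<le> steiner_l H t (x t) (a t)" .
  have "steiner_l H t (x t) (a t) \<le> norm (e t (x t) (a t))"
    unfolding steiner_l_e using norm_snd_le[of "snd (e t (x t) (a t))" "fst (e t (x t) (a t))"]
    by (simp add: abs_le_iff)
  also have "\<dots> \<le> 3 * norm (a t) + 2 * D"
    using Phi_set_norm_le[OF t' e_mem[OF t', of "x t" "a t"]] D[OF t' xR[OF t]] by simp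
  finally show "steiner_l H t (x t) (a t) \<le> 3 * norm (a t) + 2 * D" .
qed

lemma traj_l_integrable:
  assumes "(x, a) \<in> traj t0 x0" "t0 \<in> {0..T}"
  shows "(\<lambda>t. steiner_l H t (x t) (a t)) integrable_on {t0..T}"
    and "cost g t0 x a = g (x T) + integral {t0..T} (\<lambda>t. steiner_l H t (x t) (a t))"
  using set_borel_integral_eq_integral[OF l_set_integrable[OF assms(2)
        abs_continuous_on_imp_continuous_on[OF trajD(1)[OF assms(1)]] trajD(2)[OF assms(1)]]]
  by (simp_all add: cost_def)

text \<open>Up to \<open>\<tau> = max t0 t1\<close> at most one of the pairs runs for positive time:
  the old one costs at least \<open>- D\<close> per unit time, the new one about
  \<open>2 * D\<close> at most, its control being near 0. After \<open>\<tau>\<close> the gap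
  estimate bounds both the difference of running costs and that of terminal costs. \<open>Q\<close>
  is fixed before the pair, so it is independent of \<open>a\<close>.\<close>

lemma cost_compare:
  assumes R: "R > 0" and g: "loc_lipschitz_on UNIV g"
  obtains Q where "0 \<le> Q"
    "\<And>t0 t1 x0 y0 x a \<epsilon>. t0 \<in> {0..T} \<Longrightarrow> t1 \<in> {0..T} \<Longrightarrow> norm x0 \<le> R \<Longrightarrow> norm y0 \<le> R \<Longrightarrow>
      (x, a) \<in> traj t0 x0 \<Longrightarrow> 0 < \<epsilon> \<Longrightarrow>
      \<exists>y b. (y, b) \<in> traj t1 y0 \<and>
        cost g t1 y b \<le> cost g t0 x a + Q * (norm (x0 - y0) + \<bar>t0 - t1\<bar>) + Q * \<epsilon>"
proof (cases "0 \<le> T")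
  case False
  then have "{0..T} = {}" by simp
  then show ?thesis using that[of 0] by blast
next
  case T: True
  obtain M where M: "0 < M" "\<And>t. t \<in> {0..T} \<Longrightarrow> c t \<le> M" using c_bound by blast
  define R' where "R' = (R + M * T) * exp (M * T)"
  have R': "R' > 0" unfolding R'_def using R M T by (intro mult_pos_pos add_pos_nonneg) auto
  obtain D where D: "0 < D" "\<And>t x. t \<in> {0..T} \<Longrightarrow> norm x \<le> R' \<Longrightarrow> c t * (1 + norm x) + \<bar>H t x 0\<bar> \<le> D"
    using local_bound[of R'] by blast
  obtain L where L: "0 < L"
    "\<And>t x y a b. t \<in> {0..T} \<Longrightarrow> norm x \<le> R' \<Longrightarrow> norm y \<le> R' \<Longrightarrow>
      dist (e t x a) (e t y b) \<le> L * norm (x - y) + L * norm (a - b)"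
    using e_lipschitz_const[OF R'] by blast
  obtain G where G: "G-lipschitz_on (cball 0 R') g"
    using loc_lipschitz_on_compact[OF g compact_cball] by blast
  have G0: "0 \<le> G" using G by (rule lipschitz_on_nonneg)
  define v where "v = M * (1 + R')"
  have v: "0 \<le> v" using M R' by (simp add: v_def)
  define X where "X = exp (L * T)"
  define Q where "Q = (G + L * T) * X * (1 + v + L) + 3 + L + 3 * D"
  have W0: "0 \<le> (G + L * T) * X" using G0 L T by (simp add: X_def)
  show ?thesis
  proof (rule that)
    show "0 \<le> Q" unfolding Q_def using W0 v L D by (intro add_nonneg_nonneg mult_nonneg_nonneg[of "(G + L * T) * X"]) auto
    fix t0 t1 \<epsilon> :: real and x0 y0 :: 'a and x a
    assume t01: "t0 \<in> {0..T}" "t1 \<in> {0..T}" and x0: "norm x0 \<le> R" "norm y0 \<le> R"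
      and tr: "(x, a) \<in> traj t0 x0" and \<epsilon>: "0 < \<epsilon>"
    define A where "A t = (if t \<in> {t0..T} then a t else 0)" for t
    have "(\<lambda>t. indicat_real {0..T} t *\<^sub>R A t) = (\<lambda>t. indicat_real {t0..T} t *\<^sub>R a t)"
      using t01 by (auto simp: A_def indicator_def fun_eq_iff)
    then have A: "set_integrable lborel {0..T} A"
      using trajD(2)[OF tr] by (simp add: set_integrable_def)
    obtain b where b: "continuous_on UNIV b" "(LINT t:{0..T}|lborel. norm (A t - b t)) < \<epsilon>"
      using L1_approx_continuous[OF A \<epsilon>] by blast
    define N where "N t = norm (A t - b t)" for t
    have "set_integrable lborel {0..T} b"
      by (intro set_integrable_continuous_real continuous_on_subset[OF b(1)]) auto
    then have "set_integrable lborel {0..T} (\<lambda>t. norm (A t - b t))"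
      by (intro set_integrable_norm set_integral_diff A)
    then have N: "N integrable_on {0..T}" "integral {0..T} N < \<epsilon>"
      using set_borel_integral_eq_integral[of "{0..T}" "\<lambda>t. norm (A t - b t)"] b(2) by (auto simp: N_def[abs_def])
    have N0: "0 \<le> N t" for t by (simp add: N_def)
    have N_sub: "N integrable_on {r..s}" "integral {r..s} N \<le> \<epsilon>" if "0 \<le> r" "s \<le> T" for r s
    proof -
      show i: "N integrable_on {r..s}" using integrable_on_subinterval[OF N(1)] that by auto
      have "integral {r..s} N \<le> integral {0..T} N"
        using that i N(1) N0 by (intro integral_subset_le) auto
      then show "integral {r..s} N \<le> \<epsilon>" using N(2) by simp
    qed
    obtain y where ty: "(y, b) \<in> traj t1 y0" using traj_exists[OF t01(2) b(1)] by blast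
    have xR: "norm (x t) \<le> R'" if "t \<in> {t0..T}" for t
      unfolding R'_def by (rule traj_norm_le[OF tr t01(1) that M x0(1)])
    have yR: "norm (y t) \<le> R'" if "t \<in> {t1..T}" for t
      unfolding R'_def by (rule traj_norm_le[OF ty t01(2) that M x0(2)])
    define lx where "lx t = steiner_l H t (x t) (a t)" for t
    define ly where "ly t = steiner_l H t (y t) (b t)" for t
    have lxi: "lx integrable_on {t0..T}" and cx: "cost g t0 x a = g (x T) + integral {t0..T} lx"
      using traj_l_integrable[OF tr t01(1)] by (simp_all add: lx_def[abs_def])
    have lyi: "ly integrable_on {t1..T}" and cy: "cost g t1 y b = g (y T) + integral {t1..T} ly"
      using traj_l_integrable[OF ty t01(2)] by (simp_all add: ly_def[abs_def])
    define \<tau> where "\<tau> = max t0 t1"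
    have \<tau>: "t0 \<le> \<tau>" "t1 \<le> \<tau>" "\<tau> \<le> T" "0 \<le> \<tau>" "(\<tau> - t0) + (\<tau> - t1) = \<bar>t0 - t1\<bar>"
      using t01 by (auto simp: \<tau>_def)
    define S where "S = norm (x0 - y0) + \<bar>t0 - t1\<bar>"
    have gap\<tau>: "norm (x \<tau> - y \<tau>) \<le> (1 + v) * S"
    proof -
      have "norm (x \<tau> - x0) \<le> v * (\<tau> - t0)" unfolding v_def
        by (rule traj_displacement[OF tr t01(1) _ M _ xR]) (use \<tau> R' in auto)
      moreover have "norm (y \<tau> - y0) \<le> v * (\<tau> - t1)" unfolding v_def
        by (rule traj_displacement[OF ty t01(2) _ M _ yR]) (use \<tau> R' in auto)
      moreover have "norm (x \<tau> - y \<tau>) \<le> norm (x \<tau> - x0) + norm (y \<tau> - y0) + norm (x0 - y0)"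
      proof -
        have "norm (x \<tau> - y \<tau>) = norm ((x \<tau> - x0) - (y \<tau> - y0) + (x0 - y0))" by simp
        then show ?thesis
          using norm_triangle_ineq[of "(x \<tau> - x0) - (y \<tau> - y0)" "x0 - y0"]
            norm_triangle_ineq4[of "x \<tau> - x0" "y \<tau> - y0"] by linarith
      qed
      ultimately have "norm (x \<tau> - y \<tau>) \<le> v * ((\<tau> - t0) + (\<tau> - t1)) + norm (x0 - y0)"
        by (simp add: algebra_simps)
      also have "\<dots> \<le> (1 + v) * S" using v unfolding \<tau>(5) S_def by (simp add: algebra_simps)
      finally show ?thesis .
    qed
    define Z where "Z = ((1 + v) * S + L * \<epsilon>) * X"
    have gap: "norm (x t - y t) \<le> Z" if t: "t \<in> {\<tau>..T}" for t
    proof -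
      have "norm (x t - y t) \<le> (norm (x \<tau> - y \<tau>) + L * \<epsilon>) * X" unfolding X_def
      proof (rule traj_gap[OF tr ty t01 L xR yR \<tau>(1,2) t N_sub[OF \<tau>(4) order_refl]])
        show "norm (a t - b t) = N t" if "t \<in> {\<tau>..T}" for t
          using that \<tau> by (simp add: N_def A_def)
      qed
      also have "\<dots> \<le> Z" unfolding Z_def X_def using gap\<tau> by (intro mult_right_mono) auto
      finally show ?thesis .
    qed
    have gT: "g (y T) - g (x T) \<le> G * Z"
    proof -
      have "dist (g (y T)) (g (x T)) \<le> G * dist (y T) (x T)"
        by (rule lipschitz_onD[OF G]) (use xR[of T] yR[of T] t01 in auto)
      also have "\<dots> \<le> G * Z"
        using gap[of T] \<tau>(3) G0 by (intro mult_left_mono) (auto simp: dist_norm norm_minus_commute)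
      finally show ?thesis by (simp add: dist_real_def)
    qed
    have lx_sub: "lx integrable_on {t0..\<tau>}" "lx integrable_on {\<tau>..T}"
      and ly_sub: "ly integrable_on {t1..\<tau>}" "ly integrable_on {\<tau>..T}"
      using integrable_on_subinterval[OF lxi] integrable_on_subinterval[OF lyi] \<tau> by auto
    have "integral {t0..\<tau>} (\<lambda>_. - D) \<le> integral {t0..\<tau>} lx"
      using lx_sub(1) running_cost_bounds(1)[OF tr t01(1) D(2) xR] \<tau>
      by (intro integral_le) (auto simp: lx_def)
    then have Ix: "- (D * (\<tau> - t0)) \<le> integral {t0..\<tau>} lx" using \<tau> by (simp add: mult.commute)
    have Iy: "integral {t1..\<tau>} ly \<le> 3 * \<epsilon> + 2 * D * (\<tau> - t1)"
    proof -
      \<comment> \<open>If \<open>\<tau> = t0\<close>, the extension \<open>A\<close> equals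
        \<open>a\<close> and not 0 at the endpoint \<open>\<tau>\<close>, and the bound may fail
        there; altering the integrand at this one point is harmless.\<close>
      define ly' where "ly' t = (if t = \<tau> then 3 * N t + 2 * D else ly t)" for t
      have "integral {t1..\<tau>} ly = integral {t1..\<tau>} ly'"
        by (rule integral_spike[OF negligible_sing[of \<tau>]]) (simp add: ly'_def)
      also have "\<dots> \<le> integral {t1..\<tau>} (\<lambda>t. 3 * N t + 2 * D)"
      proof (rule integral_le)
        show "ly' integrable_on {t1..\<tau>}"
          by (rule integrable_spike[OF ly_sub(1) negligible_sing[of \<tau>]]) (simp add: ly'_def)
        show "(\<lambda>t. 3 * N t + 2 * D) integrable_on {t1..\<tau>}"
          using N_sub(1)[of t1 \<tau>] t01 \<tau> by (intro integrable_add integrable_on_mult_right) auto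
        show "ly' t \<le> 3 * N t + 2 * D" if t: "t \<in> {t1..\<tau>}" for t
        proof (cases "t = \<tau>")
          case False
          then have "t < t0" using t by (auto simp: \<tau>_def max_def split: if_splits)
          then have "N t = norm (b t)" by (simp add: N_def A_def)
          then show ?thesis
            using running_cost_bounds(2)[OF ty t01(2) D(2) yR, of t] t \<tau> False by (simp add: ly'_def ly_def)
        qed (simp add: ly'_def)
      qed
      also have "\<dots> = 3 * integral {t1..\<tau>} N + 2 * D * (\<tau> - t1)"
        using integral_affine_comp[OF N_sub(1)[of t1 \<tau>], of "2 * D" 3] t01 \<tau> by (simp add: add.commute)
      also have "\<dots> \<le> 3 * \<epsilon> + 2 * D * (\<tau> - t1)" using N_sub(2)[of t1 \<tau>] t01 \<tau> by simp
      finally show ?thesis .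
    qed
    have Ixy: "integral {\<tau>..T} ly - integral {\<tau>..T} lx \<le> L * T * Z + L * \<epsilon>"
    proof -
      have "integral {\<tau>..T} ly - integral {\<tau>..T} lx = integral {\<tau>..T} (\<lambda>t. ly t - lx t)"
        using ly_sub lx_sub by (simp add: integral_diff)
      also have "\<dots> \<le> integral {\<tau>..T} (\<lambda>t. L * Z + L * N t)"
      proof (rule integral_le)
        show "(\<lambda>t. ly t - lx t) integrable_on {\<tau>..T}" using ly_sub lx_sub by (intro integrable_diff)
        show "(\<lambda>t. L * Z + L * N t) integrable_on {\<tau>..T}"
          using N_sub(1)[OF \<tau>(4) order_refl] by (intro integrable_add integrable_on_mult_right) auto
        fix t assume t: "t \<in> {\<tau>..T}"
        have "ly t - lx t \<le> dist (e t (y t) (b t)) (e t (x t) (a t))"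
          using dist_snd_le[of "e t (y t) (b t)" "e t (x t) (a t)"] by (simp add: ly_def lx_def steiner_l_e dist_real_def)
        also have "\<dots> \<le> L * norm (y t - x t) + L * norm (b t - a t)"
          using t \<tau> by (intro L(2) xR yR) auto
        also have "\<dots> \<le> L * Z + L * N t"
          using gap[OF t] L(1) t \<tau> by (intro add_mono mult_left_mono) (auto simp: N_def A_def norm_minus_commute)
        finally show "ly t - lx t \<le> L * Z + L * N t" .
      qed
      also have "\<dots> = L * Z * (T - \<tau>) + L * integral {\<tau>..T} N"
        by (rule integral_affine_comp[OF N_sub(1)[OF \<tau>(4) order_refl] \<tau>(3)])
      also have "\<dots> \<le> L * Z * T + L * \<epsilon>"
      proof (intro add_mono mult_left_mono)
        have "0 \<le> Z" by (rule order_trans[OF norm_ge_zero gap[of T]]) (use \<tau>(3) in simp)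
        then show "0 \<le> L * Z" using L(1) by simp
      qed (use \<tau> L N_sub(2)[OF \<tau>(4) order_refl] in auto)
      finally show ?thesis by (simp add: mult.commute mult.left_commute)
    qed
    have "integral {t0..T} lx = integral {t0..\<tau>} lx + integral {\<tau>..T} lx"
      "integral {t1..T} ly = integral {t1..\<tau>} ly + integral {\<tau>..T} ly"
      using Henstock_Kurzweil_Integration.integral_combine[OF \<tau>(1,3) lxi]
        Henstock_Kurzweil_Integration.integral_combine[OF \<tau>(2,3) lyi] by simp_all
    then have "cost g t1 y b - cost g t0 x a
        \<le> G * Z + (3 * \<epsilon> + 2 * D * (\<tau> - t1)) + (L * T * Z + L * \<epsilon>) + D * (\<tau> - t0)"
      unfolding cx cy using gT Ix Iy Ixy by linarith
    also have "\<dots> = (G + L * T) * Z + (3 + L) * \<epsilon> + 2 * D * (\<tau> - t1) + D * (\<tau> - t0)"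
      by (simp add: algebra_simps)
    also have "\<dots> \<le> (G + L * T) * Z + (3 + L) * \<epsilon> + 3 * D * S"
    proof -
      have "\<tau> - t1 \<le> S" "\<tau> - t0 \<le> S"
        unfolding S_def using \<tau> norm_ge_zero[of "x0 - y0"] by linarith+
      then have "D * (\<tau> - t1) \<le> D * S" "D * (\<tau> - t0) \<le> D * S"
        using D(1) by simp_all
      then show ?thesis by simp
    qed
    also have "\<dots> \<le> Q * S + Q * \<epsilon>"
    proof -
      \<comment> \<open>\<open>W\<close> collects the Gronwall factor with the Lipschitz constants
        of terminal and running cost; then the coefficients of \<open>S\<close> and of
        \<open>\<epsilon>\<close> are both partial sums of \<open>Q\<close>.\<close>
      define W where "W = (G + L * T) * X"
      have W: "0 \<le> W" using W0 by (simp add: W_def)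
      have S: "0 \<le> S" by (simp add: S_def)
      have "0 \<le> W * L * S" "0 \<le> (3 + L) * S" "0 \<le> W * (1 + v) * \<epsilon>" "0 \<le> D * \<epsilon>"
        using W S L v \<epsilon> D by auto
      moreover have "(G + L * T) * Z = W * (1 + v) * S + W * L * \<epsilon>"
        by (simp add: Z_def W_def algebra_simps)
      moreover have "Q = W * (1 + v) + W * L + (3 + L) + 3 * D"
        by (simp add: Q_def W_def algebra_simps)
      ultimately show ?thesis by (simp add: algebra_simps)
    qed
    finally have "cost g t1 y b \<le> cost g t0 x a + Q * (norm (x0 - y0) + \<bar>t0 - t1\<bar>) + Q * \<epsilon>"
      by (simp add: S_def)
    with ty show "\<exists>y b. (y, b) \<in> traj t1 y0 \<and>
        cost g t1 y b \<le> cost g t0 x a + Q * (norm (x0 - y0) + \<bar>t0 - t1\<bar>) + Q * \<epsilon>" by blast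
  qed
qed

text \<open>Terminal states of all admissible pairs stay in one ball, on which \<open>g\<close> is
  bounded, and the running cost is at least \<open>- D\<close>.\<close>

lemma cost_bounded_below:
  assumes t0: "t0 \<in> {0..T}" and g: "loc_lipschitz_on UNIV g"
  obtains B where "\<And>x a. (x, a) \<in> traj t0 x0 \<Longrightarrow> B \<le> cost g t0 x a"
proof -
  obtain M where M: "0 < M" "\<And>t. t \<in> {0..T} \<Longrightarrow> c t \<le> M" using c_bound by blast
  define R' where "R' = (norm x0 + M * T) * exp (M * T)"
  obtain D where D: "0 < D" "\<And>t x. t \<in> {0..T} \<Longrightarrow> norm x \<le> R' \<Longrightarrow> c t * (1 + norm x) + \<bar>H t x 0\<bar> \<le> D"
    using local_bound[of R'] by blast
  obtain G where "G-lipschitz_on (cball 0 R') g"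
    using loc_lipschitz_on_compact[OF g compact_cball] by blast
  then have "bounded (g ` cball 0 R')"
    by (intro compact_imp_bounded compact_continuous_image lipschitz_on_continuous_on) auto
  then obtain B where "\<forall>r\<in>g ` cball 0 R'. norm r \<le> B" unfolding bounded_iff by blast
  then have B: "\<bar>g z\<bar> \<le> B" if "norm z \<le> R'" for z using that by simp
  have "- B - D * (T - t0) \<le> cost g t0 x a" if tr: "(x, a) \<in> traj t0 x0" for x a
  proof -
    have xR: "norm (x t) \<le> R'" if "t \<in> {t0..T}" for t
      unfolding R'_def by (rule traj_norm_le[OF tr t0 that M order_refl])
    have "integral {t0..T} (\<lambda>_. - D) \<le> integral {t0..T} (\<lambda>t. steiner_l H t (x t) (a t))"
      using traj_l_integrable(1)[OF tr t0] running_cost_bounds(1)[OF tr t0 D(2) xR]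
      by (intro integral_le) auto
    moreover have "integral {t0..T} (\<lambda>_. - D) = - (D * (T - t0))" using t0 by (simp add: mult.commute)
    moreover have "\<bar>g (x T)\<bar> \<le> B" by (rule B[OF xR]) (use t0 in auto)
    ultimately show ?thesis unfolding traj_l_integrable(2)[OF tr t0] by linarith
  qed
  with that show ?thesis .
qed

definition V :: "('a \<Rightarrow> real) \<Rightarrow> real \<times> 'a \<Rightarrow> real"
  where "V g z = (INF (x, a)\<in>traj (fst z) (snd z). cost g (fst z) x a)"

text \<open>The infimum in \<open>value_fun\<close> is extended-real. It agrees with the real one
  because the control 0 is admissible, so the set of costs is nonempty, and because costs are
  bounded below.\<close>

lemma value_fun_V:
  assumes t0: "t0 \<in> {0..T}" and g: "loc_lipschitz_on UNIV g"
  shows "value_fun (steiner_f H) (steiner_l H) g T t0 x0 = ereal (V g (t0, x0))"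
proof -
  obtain B where B: "\<And>x a. (x, a) \<in> traj t0 x0 \<Longrightarrow> B \<le> cost g t0 x a"
    using cost_bounded_below[OF t0 g] by blast
  obtain y where y: "(y, \<lambda>_. 0) \<in> traj t0 x0"
    by (rule traj_exists[OF t0, of "\<lambda>_. 0" x0]) auto
  define C where "C = (\<lambda>(x, a). cost g t0 x a) ` traj t0 x0"
  have C: "C \<noteq> {}" "bdd_below C" using y B by (auto simp: C_def intro!: bdd_belowI)
  have "value_fun (steiner_f H) (steiner_l H) g T t0 x0 = (INF r\<in>C. ereal r)"
    by (simp add: value_fun_def C_def cost_def image_image case_prod_unfold)
  also have "\<dots> = ereal (Inf C)" using ereal_Inf'[OF C(2,1)] by simp
  finally show ?thesis by (simp add: V_def C_def)
qed

lemma V_lipschitz: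
  assumes R: "R > 0" and g: "loc_lipschitz_on UNIV g"
  obtains Q where "0 \<le> Q"
    "\<And>t0 t1 x0 y0. t0 \<in> {0..T} \<Longrightarrow> t1 \<in> {0..T} \<Longrightarrow> norm x0 \<le> R \<Longrightarrow> norm y0 \<le> R \<Longrightarrow>
      V g (t1, y0) \<le> V g (t0, x0) + Q * (norm (x0 - y0) + \<bar>t0 - t1\<bar>)"
proof -
  obtain Q where Q: "0 \<le> Q"
    "\<And>t0 t1 x0 y0 x a \<epsilon>. t0 \<in> {0..T} \<Longrightarrow> t1 \<in> {0..T} \<Longrightarrow> norm x0 \<le> R \<Longrightarrow> norm y0 \<le> R \<Longrightarrow>
      (x, a) \<in> traj t0 x0 \<Longrightarrow> 0 < \<epsilon> \<Longrightarrow>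
      \<exists>y b. (y, b) \<in> traj t1 y0 \<and>
        cost g t1 y b \<le> cost g t0 x a + Q * (norm (x0 - y0) + \<bar>t0 - t1\<bar>) + Q * \<epsilon>"
    using cost_compare[OF R g] by blast
  have "V g (t1, y0) \<le> V g (t0, x0) + Q * (norm (x0 - y0) + \<bar>t0 - t1\<bar>)"
    if h: "t0 \<in> {0..T}" "t1 \<in> {0..T}" "norm x0 \<le> R" "norm y0 \<le> R" for t0 t1 x0 y0
  proof -
    let ?q = "Q * (norm (x0 - y0) + \<bar>t0 - t1\<bar>)"
    obtain B where B: "\<And>x a. (x, a) \<in> traj t1 y0 \<Longrightarrow> B \<le> cost g t1 x a"
      using cost_bounded_below[OF h(2) g] by blast
    have V1: "V g (t1, y0) \<le> cost g t1 y b" if "(y, b) \<in> traj t1 y0" for y b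
    proof -
      have "(INF z\<in>traj t1 y0. (case z of (x, a) \<Rightarrow> cost g t1 x a)) \<le> (case (y, b) of (x, a) \<Rightarrow> cost g t1 x a)"
        by (rule cINF_lower[OF _ that]) (use B in \<open>auto intro!: bdd_belowI\<close>)
      then show ?thesis by (simp add: V_def)
    qed
    have "V g (t1, y0) - ?q \<le> cost g t0 x a" if tr: "(x, a) \<in> traj t0 x0" for x a
    proof (rule field_le_epsilon)
      fix \<eta> :: real assume \<eta>: "\<eta> > 0"
      \<comment> \<open>Division by \<open>Q + 1\<close> also covers \<open>Q = 0\<close>.\<close>
      define \<epsilon> where "\<epsilon> = \<eta> / (Q + 1)"
      have \<epsilon>: "\<epsilon> > 0" "Q * \<epsilon> \<le> \<eta>" using \<eta> Q(1) by (auto simp: \<epsilon>_def field_simps)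
      obtain y b where "(y, b) \<in> traj t1 y0" "cost g t1 y b \<le> cost g t0 x a + ?q + Q * \<epsilon>"
        using Q(2)[OF h tr \<epsilon>(1)] by blast
      with V1 \<epsilon>(2) show "V g (t1, y0) - ?q \<le> cost g t0 x a + \<eta>" by fastforce
    qed
    moreover obtain y where "(y, \<lambda>_. 0) \<in> traj t0 x0"
      by (rule traj_exists[OF h(1), of "\<lambda>_. 0" x0]) auto
    ultimately have "V g (t1, y0) - ?q \<le> (INF z\<in>traj t0 x0. (case z of (x, a) \<Rightarrow> cost g t0 x a))"
      by (intro cINF_greatest) auto
    then show ?thesis by (simp add: V_def)
  qed
  with Q(1) that show ?thesis by blast
qed

lemma V_loc_lipschitz:
  assumes g: "loc_lipschitz_on UNIV g"
  shows "loc_lipschitz_on ({0..T} \<times> UNIV) (V g)"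
  unfolding loc_lipschitz_on_def
proof (intro ballI)
  fix z :: "real \<times> 'a" assume "z \<in> {0..T} \<times> UNIV"
  define R where "R = norm (snd z) + 1"
  have "R > 0" by (simp add: R_def add_nonneg_pos)
  then obtain Q where Q: "0 \<le> Q"
    "\<And>t0 t1 x0 y0. t0 \<in> {0..T} \<Longrightarrow> t1 \<in> {0..T} \<Longrightarrow> norm x0 \<le> R \<Longrightarrow> norm y0 \<le> R \<Longrightarrow>
      V g (t1, y0) \<le> V g (t0, x0) + Q * (norm (x0 - y0) + \<bar>t0 - t1\<bar>)"
    using V_lipschitz[OF _ g] by blast
  have le: "V g w \<le> V g u + 2 * Q * dist u w"
    if u: "u \<in> ({0..T} \<times> UNIV) \<inter> ball z 1" and w: "w \<in> ({0..T} \<times> UNIV) \<inter> ball z 1" for u w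
  proof -
    have nR: "norm (snd s) \<le> R" if "s \<in> ball z 1" for s
      using that dist_snd_le[of z s] norm_triangle_sub[of "snd s" "snd z"]
      by (simp add: R_def dist_norm norm_minus_commute)
    have "V g (fst w, snd w) \<le> V g (fst u, snd u) + Q * (norm (snd u - snd w) + \<bar>fst u - fst w\<bar>)"
      using u w by (intro Q(2) nR) auto
    \<comment> \<open>In the product metric each component is at most \<open>dist u w\<close>, which
      accounts for the constant \<open>2 * Q\<close>.\<close>
    also have "\<dots> \<le> V g (fst u, snd u) + Q * (dist u w + dist u w)"
      using dist_snd_le[of u w] dist_fst_le[of u w] Q(1)
      by (intro add_left_mono mult_left_mono add_mono) (auto simp: dist_norm)
    finally show ?thesis by simp
  qed
  show "\<exists>r>0. \<exists>L. \<forall>u\<in>{0..T} \<times> UNIV \<inter> ball z r. \<forall>w\<in>{0..T} \<times> UNIV \<inter> ball z r.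
      dist (V g u) (V g w) \<le> L * dist u w"
  proof (rule exI[of _ 1], intro conjI exI[of _ "2 * Q"] ballI)
    fix u w assume "u \<in> {0..T} \<times> UNIV \<inter> ball z 1" "w \<in> {0..T} \<times> UNIV \<inter> ball z 1"
    from le[OF this] le[OF this(2,1)] show "dist (V g u) (V g w) \<le> 2 * Q * dist u w"
      by (simp add: dist_real_def dist_commute abs_le_iff)
  qed simp
qed

end

theorem theorem4p8:
  fixes H :: "real \<Rightarrow> 'a::euclidean_space \<Rightarrow> 'a \<Rightarrow> real"
    and c :: "real \<Rightarrow> real"
    and k :: "real \<Rightarrow> real \<Rightarrow> real"
    and g :: "'a \<Rightarrow> real"
    and T :: real
  assumes H_cont: "continuous_on ({0..T} \<times> UNIV \<times> UNIV) (\<lambda>(t, x, p). H t x p)"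
    and H_meas: "\<And>x p. (\<lambda>t. H t x p) \<in> borel_measurable (restrict_space lebesgue {0..T})"
    and H_convex: "\<And>t x. t \<in> {0..T} \<Longrightarrow> convex_on UNIV (H t x)"
    and c_cont: "continuous_on {0..T} c"
    and c_nonneg: "\<And>t. t \<in> {0..T} \<Longrightarrow> 0 \<le> c t"
    and H4: "\<And>t x p q. t \<in> {0..T} \<Longrightarrow> \<bar>H t x p - H t x q\<bar> \<le> c t * (1 + norm x) * norm (p - q)"
    and k_cont: "\<And>R. R > 0 \<Longrightarrow> continuous_on {0..T} (k R)"
    and k_nonneg: "\<And>R t. R > 0 \<Longrightarrow> t \<in> {0..T} \<Longrightarrow> 0 \<le> k R t"
    and HLC: "\<And>R t x y p. R > 0 \<Longrightarrow> t \<in> {0..T} \<Longrightarrow> x \<in> cball 0 R \<Longrightarrow> y \<in> cball 0 R \<Longrightarrow>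
                \<bar>H t x p - H t y p\<bar> \<le> k R t * (1 + norm p) * norm (x - y)"
    and g_lip: "loc_lipschitz_on UNIV g"
  shows "\<exists>V :: real \<times> 'a \<Rightarrow> real.
           (\<forall>t0 x0. t0 \<in> {0..T} \<longrightarrow>
              value_fun (steiner_f H) (steiner_l H) g T t0 x0 = ereal (V (t0, x0))) \<and>
           loc_lipschitz_on ({0..T} \<times> UNIV) V"
proof -
  interpret hamiltonian H c k T
    by unfold_locales (fact assms)+
  show ?thesis using value_fun_V[OF _ g_lip] V_loc_lipschitz[OF g_lip] by blast
qed

end
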